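(* Suppose the Main Assumption (see context) holds, $\mathcal R$ is loxodromic, and $\nu\in\mathrm{Fix}(\mathcal R)$ is an invariant field of boundary measures such that the support of $\nu_x$ has cardinality 2 for a.e. $x$. Then $\mathcal L_x$ is the support of $\nu_x$ for a.e. $x$. In particular, $|\mathcal L_x|=2$ for a.e. $x$.
   Context: Equivalence relations. $(X,\mu)$ is a standard probability space. A Borel equivalence relation $\mathcal R\subset X\times X$ is discrete if every class $[x]_{\mathcal R}$ is countable. $\mu$ is $\mathcal R$-invariant if $\phi_*\mu=\mu$ for every Borel isomorphism $\phi:X\to X$ with graph contained in $\mathcal R$; then $\mathcal R$ carries the measure $\hat\mu(F)=\int|\{y:(x,y)\in F\}|\,d\mu(x)$, and "a.e. $(x,y)\in\mathcal R$" refers to $\hat\mu$. $\mathcal R$ is ergodic if every Borel union $Y$ of $\mathcal R$-classes has $\mu(Y)\in\{0,1\}$. $\mathcal R$ is hyperfinite if (up to null sets) there are Borel subequivalence relations $\mathcal R_1\le\mathcal R_2\le\cdots$ with all $\mathcal R_n$-classes finite and $\mathcal R=\bigcup_n\mathcal R_n$. Hyperbolic spaces. In a metric space $(H,d)$ put $(x|y)_z=\frac12(d(x,z)+d(y,z)-d(x,y))$. $H$ is $\delta$-hyperbolic if $(x|y)_z\ge\min\{(x|w)_z,(w|y)_z\}-\delta$ for all $x,y,z,w$; Gromov hyperbolic means $\delta$-hyperbolic for some $\delta$. $\partial H$ is the Gromov boundary, $\overline H=H\cup\partial H$ the Gromov completion with its usual topology; Gromov products extend to $\overline H$ by taking the infimum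 over representing sequences of the lower limits. Bundles and actions. A Borel bundle over $X$ is a standard Borel space $B$ with a Borel surjection $\pi:B\to X$; fibers $B_x=\pi^{-1}(x)$, $B*B=\{(y,z):\pi(y)=\pi(z)\}$. A metric bundle also has a Borel map $d:B*B\to[0,\infty)$ restricting to a metric on each $B_x$. A section is a map $\sigma:X\to B$ with $\sigma(x)\in B_x$. The bundle is separable if there are countably many Borel sections $\sigma_i$ with $\{\sigma_i(x)\}_i$ dense in $B_x$ for every $x$. A bundle of hyperbolic spaces is a metric bundle $\pi:\mathcal H\to X$ whose fibers are geodesic Gromov hyperbolic spaces. An isometric action of $\mathcal R$ on $\mathcal H$ is a family of isometries $\alpha(x,y):\mathcal H_y\to\mathcal H_x$, $(x,y)\in\mathcal R$, with $\alpha(x,y)\alpha(y,z)=\alpha(x,z)$ and $\{(p,q)\in\mathcal H\times\mathcal H:\alpha(\pi(p),\pi(q))(q)=p\}$ Borel. Each $\alpha(x,y)$ extends uniquely to a homeomorphism $\overline{\mathcal H}_y\to\overline{\mathcal H}_x$, also denoted $\alpha(x,y)$. $\overline{\mathcal H}=\bigsqcup_x\overline{\mathcal H}_x$ has the smallest Borel structure making $\{\xi\in\overline{\mathcal H}:(\xi|\sigma(x))_{\eta(x)}\in B \text{ where } x=\pi(\xi)\}$ Borel for all Borel sections $\sigma,\eta:X\to\mathcal H$ and Borel $B\subset[0,\infty)$. Orbits and limit sets. For a section $\sigma$ of $\mathcal H$, let $\sigma_x(y)=\alpha(x,y)\sigma(y)$ for $y\in[x]_{\mathcal R}$, and $\mathcal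 O^\sigma_x=\sigma_x([x]_{\mathcal R})$. $\sigma$ is metrically proper if for a.e. $x$ and every metric ball $\mathcal B\subset\mathcal H_x$, only finitely many $y\in[x]_{\mathcal R}$ have $\sigma_x(y)\in\mathcal B$. Main Assumption: $(X,\mu)$ is a standard non-atomic probability space, $\mathcal R\subset X\times X$ is a discrete Borel equivalence relation, $\mu$ is $\mathcal R$-invariant and ergodic, $\pi:\mathcal H\to X$ is a separable bundle of hyperbolic spaces with an isometric action $\alpha$ of $\mathcal R$, and $\sigma:X\to\mathcal H$ is a metrically proper Borel section such that the closure $\overline{\mathcal O^\sigma_x}$ is compact in $\overline{\mathcal H}_x$ for a.e. $x$. The limit set is $\mathcal L_x=\overline{\mathcal O^\sigma_x}\cap\partial\mathcal H_x$ (up to null sets it does not depend on the choice of such $\sigma$), and $\mathcal L=\bigsqcup_x\mathcal L_x$. Fields of boundary measures. $C(\mathcal L\to X)$ is the set of Borel functions $F:\mathcal L\to\mathbb C$ with $F_x=F|_{\mathcal L_x}$ continuous for a.e. $x$ and $\operatorname{ess\,sup}_x\|F_x\|_\infty<\infty$. A field of boundary measures is $\nu=\{\nu_x\}_{x\in X}$ with $\nu_x$ a Borel probability measure on $\mathcal L_x$ and $x\mapsto\int F_x\,d\nu_x$ $\mu$-measurable for all $F\in C(\mathcal L\to X)$; fields agreeing a.e. are identified; the set of them is $\mathrm{Prob}(\mathcal L\to X)$. $\mathrm{Fix}(\mathcal R)$ is the set of $\eta\in\mathrm{Prob}(\mathcal L\to X)$ with $\alpha(y,x)_*\eta_x=\eta_y$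 for a.e. $(x,y)\in\mathcal R$. $\mathcal R$ is loxodromic if it is hyperfinite and there is $\eta\in\mathrm{Fix}(\mathcal R)$ such that the support of $\eta_x$ has cardinality 2 for a.e. $x$. *)

theory Defs
  imports "HOL-Probability.Probability"
begin

section \<open>Standard Borel spaces and supports\<close>

definition borel_of :: "'a topology \<Rightarrow> 'a measure" where
  "borel_of T = sigma (topspace T) {U. openin T U}"

definition polish_topology :: "'a topology \<Rightarrow> bool" where
  "polish_topology T \<longleftrightarrow> completely_metrizable_space T \<and> second_countable T"

text \<open>Only the space and the measurable sets of the argument matter: here and for bundles below,
  a measurable space is represented by a value of the type of measures, as usual in this library.\<close>

definition standard_borel :: "'a measure \<Rightarrow> bool" where
  "standard_borel N \<longleftrightarrow> (\<exists>T. polish_topology T \<and> sets N = sets (borel_of T))"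

definition nonatomic :: "'a measure \<Rightarrow> bool" where
  "nonatomic M \<longleftrightarrow> (\<forall>A\<in>sets M. emeasure M A > 0 \<longrightarrow>
     (\<exists>B\<in>sets M. B \<subseteq> A \<and> 0 < emeasure M B \<and> emeasure M B < emeasure M A))"

definition msupport :: "'a topology \<Rightarrow> 'a measure \<Rightarrow> 'a set" where
  "msupport T N = {\<xi> \<in> topspace T. \<forall>U. openin T U \<and> \<xi> \<in> U \<longrightarrow> emeasure N U > 0}"


section \<open>Measured equivalence relations\<close>

definition discrete_borel_equiv :: "'a measure \<Rightarrow> ('a \<times> 'a) set \<Rightarrow> bool" where
  "discrete_borel_equiv M R \<longleftrightarrow>
     R \<in> sets (M \<Otimes>\<^sub>M M) \<and> equiv (space M) R \<and> (\<forall>x\<in>space M. countable (R `` {x}))"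

definition borel_automorphism :: "'a measure \<Rightarrow> ('a \<Rightarrow> 'a) \<Rightarrow> bool" where
  "borel_automorphism M \<phi> \<longleftrightarrow> \<phi> \<in> measurable M M \<and> bij_betw \<phi> (space M) (space M) \<and>
     inv_into (space M) \<phi> \<in> measurable M M"

definition invariant_measure :: "'a measure \<Rightarrow> ('a \<times> 'a) set \<Rightarrow> bool" where
  "invariant_measure M R \<longleftrightarrow>
     (\<forall>\<phi>. borel_automorphism M \<phi> \<and> (\<forall>x\<in>space M. (x, \<phi> x) \<in> R) \<longrightarrow> distr M M \<phi> = M)"

definition ergodic_relation :: "'a measure \<Rightarrow> ('a \<times> 'a) set \<Rightarrow> bool" where
  "ergodic_relation M R \<longleftrightarrow>
     (\<forall>Y\<in>sets M. Y = (\<Union>x\<in>Y. R `` {x}) \<longrightarrow> emeasure M Y = 0 \<or> emeasure M Y = 1)"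

definition rel_measure :: "'a measure \<Rightarrow> ('a \<times> 'a) set \<Rightarrow> ennreal" where
  "rel_measure M F = (\<integral>\<^sup>+ x. emeasure (count_space UNIV) {y. (x, y) \<in> F} \<partial>M)"

text \<open>\<open>P x y\<close> holds for almost every \<open>(x, y) \<in> R\<close> with respect to \<open>rel_measure M\<close>.\<close>

definition rel_ae :: "'a measure \<Rightarrow> ('a \<times> 'a) set \<Rightarrow> ('a \<Rightarrow> 'a \<Rightarrow> bool) \<Rightarrow> bool" where
  "rel_ae M R P \<longleftrightarrow> (\<exists>N\<in>sets (M \<Otimes>\<^sub>M M). N \<subseteq> R \<and> rel_measure M N = 0 \<and>
     (\<forall>x y. (x, y) \<in> R - N \<longrightarrow> P x y))"

definition hyperfinite :: "'a measure \<Rightarrow> ('a \<times> 'a) set \<Rightarrow> bool" where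
  "hyperfinite M R \<longleftrightarrow> (\<exists>X0\<in>sets M. emeasure M (space M - X0) = 0 \<and>
     (\<exists>Rn :: nat \<Rightarrow> ('a \<times> 'a) set.
        (\<forall>n. Rn n \<in> sets (M \<Otimes>\<^sub>M M) \<and> equiv X0 (Rn n) \<and> (\<forall>x\<in>X0. finite (Rn n `` {x})) \<and>
             Rn n \<subseteq> Rn (Suc n)) \<and>
        (\<Union>n. Rn n) = R \<inter> X0 \<times> X0))"


section \<open>Gromov hyperbolic spaces and the Gromov completion\<close>

text \<open>Throughout, a metric space is a carrier \<open>S\<close> with a distance \<open>d\<close>.\<close>

definition gromov_product :: "('b \<Rightarrow> 'b \<Rightarrow> real) \<Rightarrow> 'b \<Rightarrow> 'b \<Rightarrow> 'b \<Rightarrow> real" where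
  "gromov_product d z x y = (d x z + d y z - d x y) / 2"

definition gromov_hyperbolic :: "'b set \<Rightarrow> ('b \<Rightarrow> 'b \<Rightarrow> real) \<Rightarrow> bool" where
  "gromov_hyperbolic S d \<longleftrightarrow> (\<exists>\<delta>. \<forall>x\<in>S. \<forall>y\<in>S. \<forall>z\<in>S. \<forall>w\<in>S.
     gromov_product d z x y \<ge> min (gromov_product d z x w) (gromov_product d z w y) - \<delta>)"

definition geodesic_metric :: "'b set \<Rightarrow> ('b \<Rightarrow> 'b \<Rightarrow> real) \<Rightarrow> bool" where
  "geodesic_metric S d \<longleftrightarrow> (\<forall>x\<in>S. \<forall>y\<in>S. \<exists>\<gamma> :: real \<Rightarrow> 'b.
     \<gamma> ` {0..d x y} \<subseteq> S \<and> \<gamma> 0 = x \<and> \<gamma> (d x y) = y \<and>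
     (\<forall>s\<in>{0..d x y}. \<forall>t\<in>{0..d x y}. d (\<gamma> s) (\<gamma> t) = \<bar>s - t\<bar>))"

text \<open>Two sequences are related if their mutual Gromov products \<open>(u i|v j)\<close> tend to infinity as
  \<open>i, j\<close> tend to infinity. This does not depend on the base point; quantifying over all base points
  avoids choosing one. Boundary points are classes of sequences, and a point of the
  completion is either a point of the space or a boundary point.\<close>

definition diverge_together ::
    "'b set \<Rightarrow> ('b \<Rightarrow> 'b \<Rightarrow> real) \<Rightarrow> (nat \<Rightarrow> 'b) \<Rightarrow> (nat \<Rightarrow> 'b) \<Rightarrow> bool" where
  "diverge_together S d u v \<longleftrightarrow> (\<forall>z\<in>S. filterlim (\<lambda>(i, j). gromov_product d z (u i) (v j))
     at_top (sequentially \<times>\<^sub>F sequentially))"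

definition gromov_sequences :: "'b set \<Rightarrow> ('b \<Rightarrow> 'b \<Rightarrow> real) \<Rightarrow> (nat \<Rightarrow> 'b) set" where
  "gromov_sequences S d = {u. range u \<subseteq> S \<and> diverge_together S d u u}"

definition boundary_rel :: "'b set \<Rightarrow> ('b \<Rightarrow> 'b \<Rightarrow> real) \<Rightarrow> ((nat \<Rightarrow> 'b) \<times> (nat \<Rightarrow> 'b)) set" where
  "boundary_rel S d = {(u, v). u \<in> gromov_sequences S d \<and> v \<in> gromov_sequences S d \<and>
     diverge_together S d u v}"

type_synonym 'b gpoint = "'b + (nat \<Rightarrow> 'b) set"

definition gromov_boundary :: "'b set \<Rightarrow> ('b \<Rightarrow> 'b \<Rightarrow> real) \<Rightarrow> 'b gpoint set" where
  "gromov_boundary S d = Inr ` (gromov_sequences S d // boundary_rel S d)"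

definition gromov_completion :: "'b set \<Rightarrow> ('b \<Rightarrow> 'b \<Rightarrow> real) \<Rightarrow> 'b gpoint set" where
  "gromov_completion S d = Inl ` S \<union> gromov_boundary S d"

text \<open>A point of the space is represented by its constant sequence; allowing all sequences
  converging to it gives the same extended product, since \<open>(x|y)\<^sub>z\<close> is 1-Lipschitz in \<open>x\<close>.\<close>

fun representatives :: "'b gpoint \<Rightarrow> (nat \<Rightarrow> 'b) set" where
  "representatives (Inl a) = {\<lambda>_. a}"
| "representatives (Inr C) = C"

definition ext_gromov_product :: "('b \<Rightarrow> 'b \<Rightarrow> real) \<Rightarrow> 'b \<Rightarrow> 'b gpoint \<Rightarrow> 'b gpoint \<Rightarrow> ereal" where
  "ext_gromov_product d z \<xi> \<eta> = (INF u\<in>representatives \<xi>. INF v\<in>representatives \<eta>.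
     Liminf (sequentially \<times>\<^sub>F sequentially) (\<lambda>(i, j). ereal (gromov_product d z (u i) (v j))))"

text \<open>A set is open if its trace on the space is open for the metric and, with each boundary
  point \<open>\<xi>\<close>, it contains some \<open>{\<eta>. (\<eta>|\<xi>)\<^sub>z > t}\<close>. Whether this holds does not depend on \<open>z\<close>.\<close>

definition gromov_open :: "'b set \<Rightarrow> ('b \<Rightarrow> 'b \<Rightarrow> real) \<Rightarrow> 'b gpoint set \<Rightarrow> bool" where
  "gromov_open S d U \<longleftrightarrow> U \<subseteq> gromov_completion S d \<and>
     openin (Metric_space.mtopology S d) {a. Inl a \<in> U} \<and>
     (\<forall>\<xi>\<in>U \<inter> gromov_boundary S d. \<forall>z\<in>S. \<exists>t::real.
        {\<eta> \<in> gromov_completion S d. ext_gromov_product d z \<eta> \<xi> > ereal t} \<subseteq> U)"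

definition gromov_topology :: "'b set \<Rightarrow> ('b \<Rightarrow> 'b \<Rightarrow> real) \<Rightarrow> 'b gpoint topology" where
  "gromov_topology S d = topology (gromov_open S d)"

lemma openin_gromov_topology:
  "openin (gromov_topology S d) U \<longleftrightarrow> gromov_open S d U"
proof -
  have int: "gromov_open S d (U \<inter> V)" if U: "gromov_open S d U" and V: "gromov_open S d V" for U V
  proof -
    have "\<exists>t::real. {\<eta> \<in> gromov_completion S d. ext_gromov_product d z \<eta> \<xi> > ereal t} \<subseteq> U \<inter> V"
      if \<xi>: "\<xi> \<in> U \<inter> V \<inter> gromov_boundary S d" and z: "z \<in> S" for \<xi> z
    proof -
      obtain t where t: "{\<eta> \<in> gromov_completion S d. ext_gromov_product d z \<eta> \<xi> > ereal t} \<subseteq> U"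
        using U \<xi> z unfolding gromov_open_def by blast
      obtain t' where t': "{\<eta> \<in> gromov_completion S d. ext_gromov_product d z \<eta> \<xi> > ereal t'} \<subseteq> V"
        using V \<xi> z unfolding gromov_open_def by blast
      have "ext_gromov_product d z \<eta> \<xi> > ereal t \<and> ext_gromov_product d z \<eta> \<xi> > ereal t'"
        if "ext_gromov_product d z \<eta> \<xi> > ereal (max t t')" for \<eta>
        using that by (meson ereal_less_eq(3) le_less_trans max.cobounded1 max.cobounded2)
      then show ?thesis using t t' by (intro exI[of _ "max t t'"]) blast
    qed
    moreover have "{a. Inl a \<in> U \<inter> V} = {a. Inl a \<in> U} \<inter> {a. Inl a \<in> V}" by auto
    ultimately show ?thesis using U V unfolding gromov_open_def by auto
  qed
  have un: "gromov_open S d (\<Union>K)" if K: "\<forall>U\<in>K. gromov_open S d U" for K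
  proof -
    have "{a. Inl a \<in> \<Union>K} = (\<Union>U\<in>K. {a. Inl a \<in> U})" by auto
    moreover have "openin (Metric_space.mtopology S d) (\<Union>U\<in>K. {a. Inl a \<in> U})"
      using K unfolding gromov_open_def by (intro openin_Union) auto
    moreover have "\<Union>K \<subseteq> gromov_completion S d"
      using K unfolding gromov_open_def by blast
    moreover have "\<exists>t::real. {\<eta> \<in> gromov_completion S d. ext_gromov_product d z \<eta> \<xi> > ereal t} \<subseteq> \<Union>K"
      if \<xi>: "\<xi> \<in> \<Union>K \<inter> gromov_boundary S d" and z: "z \<in> S" for \<xi> z
    proof -
      obtain U where U: "U \<in> K" "\<xi> \<in> U" using \<xi> by blast
      then have "\<exists>t::real. {\<eta> \<in> gromov_completion S d. ext_gromov_product d z \<eta> \<xi> > ereal t} \<subseteq> U"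
        using K \<xi> z unfolding gromov_open_def by blast
      then show ?thesis using U by blast
    qed
    ultimately show ?thesis unfolding gromov_open_def by auto
  qed
  have "istopology (gromov_open S d)"
    unfolding istopology_def using int un by blast
  then show ?thesis by (simp add: gromov_topology_def)
qed

lemma topspace_gromov_topology:
  assumes "Metric_space S d"
  shows "topspace (gromov_topology S d) = gromov_completion S d"
proof -
  interpret Metric_space S d by fact
  have "{a. Inl a \<in> gromov_completion S d} = S"
    by (auto simp: gromov_completion_def gromov_boundary_def)
  then have "gromov_open S d (gromov_completion S d)"
    unfolding gromov_open_def by auto
  then show ?thesis
    by (metis gromov_open_def openin_gromov_topology openin_subset openin_topspace subset_antisym)
qed

text \<open>The extension to completions of an isometry between metric spaces.\<close>

fun ext_isometry :: "('b \<Rightarrow> 'b) \<Rightarrow> 'b gpoint \<Rightarrow> 'b gpoint" where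
  "ext_isometry f (Inl a) = Inl (f a)"
| "ext_isometry f (Inr C) = Inr ((\<lambda>u. f \<circ> u) ` C)"


section \<open>Bundles of hyperbolic spaces and actions\<close>

definition fiber :: "'b measure \<Rightarrow> ('b \<Rightarrow> 'a) \<Rightarrow> 'a \<Rightarrow> 'b set" where
  "fiber H p x = {b \<in> space H. p b = x}"

definition borel_bundle :: "'a measure \<Rightarrow> 'b measure \<Rightarrow> ('b \<Rightarrow> 'a) \<Rightarrow> bool" where
  "borel_bundle M H p \<longleftrightarrow> standard_borel H \<and> p \<in> measurable H M \<and> p ` space H = space M"

text \<open>The predicate \<^const>\<open>Metric_space\<close> also requires \<open>d\<close> to be symmetric and nonnegative at pairs of
  points not both in the carrier. As \<open>d\<close> is only used on pairs in a common fiber, this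
  merely normalises irrelevant values (which can be taken to be 0).\<close>

definition metric_bundle ::
    "'a measure \<Rightarrow> 'b measure \<Rightarrow> ('b \<Rightarrow> 'a) \<Rightarrow> ('b \<Rightarrow> 'b \<Rightarrow> real) \<Rightarrow> bool" where
  "metric_bundle M H p d \<longleftrightarrow> borel_bundle M H p \<and>
     (\<lambda>(a, b). d a b) \<in> borel_measurable
        (restrict_space (H \<Otimes>\<^sub>M H) {(a, b). a \<in> space H \<and> b \<in> space H \<and> p a = p b}) \<and>
     (\<forall>x\<in>space M. Metric_space (fiber H p x) d)"

definition borel_section :: "'a measure \<Rightarrow> 'b measure \<Rightarrow> ('b \<Rightarrow> 'a) \<Rightarrow> ('a \<Rightarrow> 'b) \<Rightarrow> bool" where
  "borel_section M H p s \<longleftrightarrow> s \<in> measurable M H \<and> (\<forall>x\<in>space M. s x \<in> fiber H p x)"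

definition separable_bundle ::
    "'a measure \<Rightarrow> 'b measure \<Rightarrow> ('b \<Rightarrow> 'a) \<Rightarrow> ('b \<Rightarrow> 'b \<Rightarrow> real) \<Rightarrow> bool" where
  "separable_bundle M H p d \<longleftrightarrow> (\<exists>s :: nat \<Rightarrow> 'a \<Rightarrow> 'b. (\<forall>i. borel_section M H p (s i)) \<and>
     (\<forall>x\<in>space M. Metric_space.mtopology (fiber H p x) d closure_of (range (\<lambda>i. s i x))
        = fiber H p x))"

definition hyperbolic_bundle ::
    "'a measure \<Rightarrow> 'b measure \<Rightarrow> ('b \<Rightarrow> 'a) \<Rightarrow> ('b \<Rightarrow> 'b \<Rightarrow> real) \<Rightarrow> bool" where
  "hyperbolic_bundle M H p d \<longleftrightarrow> metric_bundle M H p d \<and>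
     (\<forall>x\<in>space M. geodesic_metric (fiber H p x) d \<and> gromov_hyperbolic (fiber H p x) d)"

text \<open>\<open>\<alpha> x y\<close> maps the fiber over \<open>y\<close> to the fiber over \<open>x\<close>.\<close>

definition isometric_action ::
    "('a \<times> 'a) set \<Rightarrow> 'b measure \<Rightarrow> ('b \<Rightarrow> 'a) \<Rightarrow> ('b \<Rightarrow> 'b \<Rightarrow> real) \<Rightarrow>
     ('a \<Rightarrow> 'a \<Rightarrow> 'b \<Rightarrow> 'b) \<Rightarrow> bool" where
  "isometric_action R H p d \<alpha> \<longleftrightarrow>
     (\<forall>x y. (x, y) \<in> R \<longrightarrow> \<alpha> x y ` fiber H p y = fiber H p x \<and>
        (\<forall>a\<in>fiber H p y. \<forall>b\<in>fiber H p y. d (\<alpha> x y a) (\<alpha> x y b) = d a b)) \<and>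
     (\<forall>x y z. (x, y) \<in> R \<and> (y, z) \<in> R \<longrightarrow>
        (\<forall>a\<in>fiber H p z. \<alpha> x y (\<alpha> y z a) = \<alpha> x z a)) \<and>
     {(a, b). a \<in> space H \<and> b \<in> space H \<and> (p a, p b) \<in> R \<and> \<alpha> (p a) (p b) b = a}
        \<in> sets (H \<Otimes>\<^sub>M H)"

definition bundle_completion ::
    "'a measure \<Rightarrow> 'b measure \<Rightarrow> ('b \<Rightarrow> 'a) \<Rightarrow> ('b \<Rightarrow> 'b \<Rightarrow> real) \<Rightarrow> 'b gpoint set" where
  "bundle_completion M H p d = (\<Union>x\<in>space M. gromov_completion (fiber H p x) d)"

definition bundle_completion_borel ::
    "'a measure \<Rightarrow> 'b measure \<Rightarrow> ('b \<Rightarrow> 'a) \<Rightarrow> ('b \<Rightarrow> 'b \<Rightarrow> real) \<Rightarrow> 'b gpoint measure" where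
  "bundle_completion_borel M H p d = sigma (bundle_completion M H p d)
     {{\<xi>. \<exists>x\<in>space M. \<xi> \<in> gromov_completion (fiber H p x) d \<and>
            ext_gromov_product d (\<eta> x) \<xi> (Inl (\<sigma> x)) \<in> ereal ` B} | \<sigma> \<eta> B.
        borel_section M H p \<sigma> \<and> borel_section M H p \<eta> \<and> B \<in> sets borel \<and> B \<subseteq> {0..}}"


section \<open>Orbits and limit sets\<close>

definition orbit :: "('a \<times> 'a) set \<Rightarrow> ('a \<Rightarrow> 'a \<Rightarrow> 'b \<Rightarrow> 'b) \<Rightarrow> ('a \<Rightarrow> 'b) \<Rightarrow> 'a \<Rightarrow> 'b set" where
  "orbit R \<alpha> \<sigma> x = (\<lambda>y. \<alpha> x y (\<sigma> y)) ` (R `` {x})"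

definition metrically_proper ::
    "'a measure \<Rightarrow> ('a \<times> 'a) set \<Rightarrow> 'b measure \<Rightarrow> ('b \<Rightarrow> 'a) \<Rightarrow> ('b \<Rightarrow> 'b \<Rightarrow> real) \<Rightarrow>
     ('a \<Rightarrow> 'a \<Rightarrow> 'b \<Rightarrow> 'b) \<Rightarrow> ('a \<Rightarrow> 'b) \<Rightarrow> bool" where
  "metrically_proper M R H p d \<alpha> \<sigma> \<longleftrightarrow> (AE x in M. \<forall>c\<in>fiber H p x. \<forall>r.
     finite {y \<in> R `` {x}. \<alpha> x y (\<sigma> y) \<in> Metric_space.mball (fiber H p x) d c r})"

definition orbit_closure ::
    "('a \<times> 'a) set \<Rightarrow> 'b measure \<Rightarrow> ('b \<Rightarrow> 'a) \<Rightarrow> ('b \<Rightarrow> 'b \<Rightarrow> real) \<Rightarrow>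
     ('a \<Rightarrow> 'a \<Rightarrow> 'b \<Rightarrow> 'b) \<Rightarrow> ('a \<Rightarrow> 'b) \<Rightarrow> 'a \<Rightarrow> 'b gpoint set" where
  "orbit_closure R H p d \<alpha> \<sigma> x =
     gromov_topology (fiber H p x) d closure_of (Inl ` orbit R \<alpha> \<sigma> x)"

definition limit_set ::
    "('a \<times> 'a) set \<Rightarrow> 'b measure \<Rightarrow> ('b \<Rightarrow> 'a) \<Rightarrow> ('b \<Rightarrow> 'b \<Rightarrow> real) \<Rightarrow>
     ('a \<Rightarrow> 'a \<Rightarrow> 'b \<Rightarrow> 'b) \<Rightarrow> ('a \<Rightarrow> 'b) \<Rightarrow> 'a \<Rightarrow> 'b gpoint set" where
  "limit_set R H p d \<alpha> \<sigma> x = orbit_closure R H p d \<alpha> \<sigma> x \<inter> gromov_boundary (fiber H p x) d"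

definition limit_topology ::
    "('a \<times> 'a) set \<Rightarrow> 'b measure \<Rightarrow> ('b \<Rightarrow> 'a) \<Rightarrow> ('b \<Rightarrow> 'b \<Rightarrow> real) \<Rightarrow>
     ('a \<Rightarrow> 'a \<Rightarrow> 'b \<Rightarrow> 'b) \<Rightarrow> ('a \<Rightarrow> 'b) \<Rightarrow> 'a \<Rightarrow> 'b gpoint topology" where
  "limit_topology R H p d \<alpha> \<sigma> x =
     subtopology (gromov_topology (fiber H p x) d) (limit_set R H p d \<alpha> \<sigma> x)"

definition limit_bundle ::
    "'a measure \<Rightarrow> ('a \<times> 'a) set \<Rightarrow> 'b measure \<Rightarrow> ('b \<Rightarrow> 'a) \<Rightarrow> ('b \<Rightarrow> 'b \<Rightarrow> real) \<Rightarrow>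
     ('a \<Rightarrow> 'a \<Rightarrow> 'b \<Rightarrow> 'b) \<Rightarrow> ('a \<Rightarrow> 'b) \<Rightarrow> 'b gpoint set" where
  "limit_bundle M R H p d \<alpha> \<sigma> = (\<Union>x\<in>space M. limit_set R H p d \<alpha> \<sigma> x)"

definition main_assumption ::
    "'a measure \<Rightarrow> ('a \<times> 'a) set \<Rightarrow> 'b measure \<Rightarrow> ('b \<Rightarrow> 'a) \<Rightarrow> ('b \<Rightarrow> 'b \<Rightarrow> real) \<Rightarrow>
     ('a \<Rightarrow> 'a \<Rightarrow> 'b \<Rightarrow> 'b) \<Rightarrow> ('a \<Rightarrow> 'b) \<Rightarrow> bool" where
  "main_assumption M R H p d \<alpha> \<sigma> \<longleftrightarrow>
     prob_space M \<and> standard_borel M \<and> nonatomic M \<and>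
     discrete_borel_equiv M R \<and> invariant_measure M R \<and> ergodic_relation M R \<and>
     hyperbolic_bundle M H p d \<and> separable_bundle M H p d \<and>
     isometric_action R H p d \<alpha> \<and>
     borel_section M H p \<sigma> \<and> metrically_proper M R H p d \<alpha> \<sigma> \<and>
     (AE x in M. compactin (gromov_topology (fiber H p x) d) (orbit_closure R H p d \<alpha> \<sigma> x))"


section \<open>Fields of boundary measures\<close>

text \<open>Measurability for the measure of \<open>X\<close> means measurability for its completion. A field only
  needs to consist of probability measures almost everywhere, since fields agreeing almost everywhere
  are identified (and on a null set the limit set may be empty). The quotient by this identification
  is not formed: all notions below are insensitive to it.\<close>

definition limit_functions ::
    "'a measure \<Rightarrow> ('a \<times> 'a) set \<Rightarrow> 'b measure \<Rightarrow> ('b \<Rightarrow> 'a) \<Rightarrow> ('b \<Rightarrow> 'b \<Rightarrow> real) \<Rightarrow>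
     ('a \<Rightarrow> 'a \<Rightarrow> 'b \<Rightarrow> 'b) \<Rightarrow> ('a \<Rightarrow> 'b) \<Rightarrow> ('b gpoint \<Rightarrow> complex) set" where
  "limit_functions M R H p d \<alpha> \<sigma> = {F.
     F \<in> borel_measurable
       (restrict_space (bundle_completion_borel M H p d) (limit_bundle M R H p d \<alpha> \<sigma>)) \<and>
     (AE x in M. continuous_map (limit_topology R H p d \<alpha> \<sigma> x) euclidean F) \<and>
     (\<exists>C::real. AE x in M. \<forall>\<xi>\<in>limit_set R H p d \<alpha> \<sigma> x. norm (F \<xi>) \<le> C)}"

definition boundary_measure_fields ::
    "'a measure \<Rightarrow> ('a \<times> 'a) set \<Rightarrow> 'b measure \<Rightarrow> ('b \<Rightarrow> 'a) \<Rightarrow> ('b \<Rightarrow> 'b \<Rightarrow> real) \<Rightarrow>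
     ('a \<Rightarrow> 'a \<Rightarrow> 'b \<Rightarrow> 'b) \<Rightarrow> ('a \<Rightarrow> 'b) \<Rightarrow> ('a \<Rightarrow> 'b gpoint measure) set" where
  "boundary_measure_fields M R H p d \<alpha> \<sigma> = {\<nu>.
     (AE x in M. prob_space (\<nu> x) \<and>
        sets (\<nu> x) = sets (borel_of (limit_topology R H p d \<alpha> \<sigma> x))) \<and>
     (\<forall>F\<in>limit_functions M R H p d \<alpha> \<sigma>.
        (\<lambda>x. integral\<^sup>L (\<nu> x) F) \<in> borel_measurable (completion M))}"

definition fixed_fields ::
    "'a measure \<Rightarrow> ('a \<times> 'a) set \<Rightarrow> 'b measure \<Rightarrow> ('b \<Rightarrow> 'a) \<Rightarrow> ('b \<Rightarrow> 'b \<Rightarrow> real) \<Rightarrow>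
     ('a \<Rightarrow> 'a \<Rightarrow> 'b \<Rightarrow> 'b) \<Rightarrow> ('a \<Rightarrow> 'b) \<Rightarrow> ('a \<Rightarrow> 'b gpoint measure) set" where
  "fixed_fields M R H p d \<alpha> \<sigma> = {\<nu> \<in> boundary_measure_fields M R H p d \<alpha> \<sigma>.
     rel_ae M R (\<lambda>x y. distr (\<nu> x) (borel_of (limit_topology R H p d \<alpha> \<sigma> y))
        (ext_isometry (\<alpha> y x)) = \<nu> y)}"

definition loxodromic ::
    "'a measure \<Rightarrow> ('a \<times> 'a) set \<Rightarrow> 'b measure \<Rightarrow> ('b \<Rightarrow> 'a) \<Rightarrow> ('b \<Rightarrow> 'b \<Rightarrow> real) \<Rightarrow>
     ('a \<Rightarrow> 'a \<Rightarrow> 'b \<Rightarrow> 'b) \<Rightarrow> ('a \<Rightarrow> 'b) \<Rightarrow> bool" where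
  "loxodromic M R H p d \<alpha> \<sigma> \<longleftrightarrow> hyperfinite M R \<and>
     (\<exists>\<eta>\<in>fixed_fields M R H p d \<alpha> \<sigma>.
        AE x in M. card (msupport (limit_topology R H p d \<alpha> \<sigma> x) (\<eta> x)) = 2)"

end

theory Submission
  imports Defs
begin

text \<open>
  Almost every fibre carries two boundary points \<open>a\<^sub>x\<close>, \<open>b\<^sub>x\<close>, the support of \<open>\<nu> x\<close>, and the
  action carries the pair of one point to the pair of any equivalent point. The Gromov product
  \<open>(a\<^sub>x|b\<^sub>x)\<close> based at \<open>\<sigma> x\<close> is, up to a bounded error, the distance from \<open>\<sigma> x\<close> to a line joining
  \<open>a\<^sub>x\<close> to \<open>b\<^sub>x\<close>. Cover almost all of \<open>X\<close> by countably many Borel sets \<open>Y\<close> such that this product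
  is bounded on each of them (\<open>AE_near_cover\<close>). It suffices to treat points \<open>x\<close> of one such set
  \<open>Y\<close>.

  The part of the orbit of \<open>x\<close> that is indexed by \<open>Y\<close> stays at bounded distance from a line with
  ends \<open>a\<^sub>x\<close> and \<open>b\<^sub>x\<close>, so it can accumulate only at these two points: any third boundary point
  \<open>\<xi>\<close> has bounded Gromov product with all of it (\<open>near_line_bounded_product\<close>). Suppose that \<open>\<xi>\<close> is
  nevertheless a limit point of the full orbit. Then infinitely many orbit points are close to
  \<open>\<xi>\<close>, and for each of them a nearest orbit point indexed by \<open>Y\<close> lies in one fixed ball around
  \<open>\<sigma> x\<close> (\<open>nearest_point_bound\<close>); metric properness leaves only finitely many candidates. Hence a
  map \<open>t\<close> that sends each point to a nearest point of \<open>Y\<close> in its class has an infinite fibre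
  inside the class of \<open>x\<close>. This contradicts mass transport: if every point sends mass \<open>1\<close> along
  \<open>t\<close>, then by invariance of the measure the mean mass received is \<open>1\<close>, so almost every point
  receives finite mass (\<open>AE_finite_fibres\<close>).

  Two measure-theoretic facts make this work. First, invariance speaks only of Borel
  automorphisms, so one needs enough of them: outside a null set, countably many automorphisms
  with graphs in \<open>R\<close> cover \<open>R\<close> (\<open>AE_cover_by_full_group\<close>). They are assembled from measurable
  selections (\<open>AE_measurable_selection\<close>), applied to the finite relations whose union is \<open>R\<close>.
  Second, the only measurability known of \<open>\<nu>\<close> concerns integrals of functions that are Borel on
  the bundle and continuous on the fibres. Such functions are obtained from a chain metric on a
  dense sequence, extended to the boundary (\<open>dist_to\<close>). Their variance under \<open>\<nu> x\<close> is measurable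
  in \<open>x\<close>, is positive for one of countably many of them, and is at most a decreasing exponential
  function of \<open>(a\<^sub>x|b\<^sub>x)\<close>; so the sets on which it is bounded below, for a fixed hyperbolicity
  constant, serve as the sets \<open>Y\<close>.
\<close>


section \<open>Measurable branches of Souslin schemes\<close>

definition baire :: "(nat \<Rightarrow> nat) measure" where
  "baire = PiM UNIV (\<lambda>_. count_space UNIV)"

text \<open>
  Countable families indexed by finite sequences are encoded as families \<open>P n r\<close> indexed by
  infinite sequences \<open>r\<close> in which only the first \<open>n\<close> entries matter.
\<close>

definition prefix_dependent :: "(nat \<Rightarrow> (nat \<Rightarrow> nat) \<Rightarrow> 'c) \<Rightarrow> bool" where
  "prefix_dependent P \<longleftrightarrow> (\<forall>n r r'. (\<forall>i<n. r i = r' i) \<longrightarrow> P n r = P n r')"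

lemma prefix_dependentD: "prefix_dependent P \<Longrightarrow> (\<And>i. i < n \<Longrightarrow> r i = r' i) \<Longrightarrow> P n r = P n r'"
  unfolding prefix_dependent_def by blast

lemma countable_eventually_zero: "countable {r :: nat \<Rightarrow> nat. \<forall>i\<ge>k. r i = 0}"
proof (rule countable_subset)
  show "{r :: nat \<Rightarrow> nat. \<forall>i\<ge>k. r i = 0} \<subseteq> range (\<lambda>xs i. if i < length xs then xs ! i else 0)"
  proof
    fix r :: "nat \<Rightarrow> nat" assume "r \<in> {r. \<forall>i\<ge>k. r i = 0}"
    then have "r = (\<lambda>i. if i < length (map r [0..<k]) then map r [0..<k] ! i else 0)"
      by (auto simp: fun_eq_iff)
    then show "r \<in> range (\<lambda>xs i. if i < length xs then xs ! i else 0)" by blast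
  qed
qed simp

text \<open>
  The set \<open>branch_domain\<close> below is the result of the Souslin operation on \<open>P\<close>; the aim of this
  section is that it is measurable for the completion of every finite measure, with a measurable
  choice of branches.
\<close>

locale measurable_scheme =
  fixes M :: "'a measure" and P :: "nat \<Rightarrow> (nat \<Rightarrow> nat) \<Rightarrow> 'a set"
  assumes P_sets: "\<And>n r. P n r \<in> sets M"
    and P_prefix: "prefix_dependent P"
begin

definition branch_domain :: "'a set" where
  "branch_domain = {x. \<exists>r. \<forall>n. x \<in> P n r}"

definition bounded_level :: "(nat \<Rightarrow> nat) \<Rightarrow> nat \<Rightarrow> nat \<Rightarrow> (nat \<Rightarrow> nat) \<Rightarrow> 'a set" where
  "bounded_level b N n r =
     {x. \<exists>r'. (\<forall>i<n. r' i = r i) \<and> (\<forall>i<N. r' i \<le> b i) \<and> (\<forall>m\<le>N. x \<in> P m r')}"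

lemma sets_bounded_level: "bounded_level b N n r \<in> sets M"
proof -
  \<comment> \<open>all conditions read only the entries of \<open>r'\<close> below \<open>max n N\<close>, so the others may be set to \<open>0\<close>\<close>
  let ?k = "max n N"
  let ?R = "{r'. (\<forall>i\<ge>?k. r' i = 0) \<and> (\<forall>i<n. r' i = r i) \<and> (\<forall>i<N. r' i \<le> b i)}"
  have "bounded_level b N n r = (\<Union>r'\<in>?R. \<Inter>m\<in>{..N}. P m r')"
  proof (intro equalityI subsetI)
    fix x assume "x \<in> bounded_level b N n r"
    then obtain r' where r': "\<forall>i<n. r' i = r i" "\<forall>i<N. r' i \<le> b i" "\<forall>m\<le>N. x \<in> P m r'"
      unfolding bounded_level_def by blast
    let ?r = "\<lambda>i. if i < ?k then r' i else 0"
    have "P m ?r = P m r'" if "m \<le> N" for m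
      using P_prefix by (rule prefix_dependentD) (use that in auto)
    then show "x \<in> (\<Union>r'\<in>?R. \<Inter>m\<in>{..N}. P m r')"
      using r' by (intro UN_I[of ?r]) auto
  qed (auto simp: bounded_level_def)
  moreover have "countable ?R"
    by (rule countable_subset[OF _ countable_eventually_zero[of ?k]]) auto
  ultimately show ?thesis
    using P_sets by (auto intro!: sets.countable_UN')
qed

lemma bounded_level_antimono: "N \<le> N' \<Longrightarrow> bounded_level b N' n r \<subseteq> bounded_level b N n r"
  unfolding bounded_level_def by (smt (verit) mem_Collect_eq order_trans order_less_le_trans subsetI)

text \<open>
  Pigeonhole: if none of the finitely many values up to \<open>b n\<close> could be continued to all levels,
  then some level would exclude them all.
\<close>

lemma bounded_level_extend:
  assumes "\<And>N. N \<ge> n \<Longrightarrow> x \<in> bounded_level b N n r"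
  shows "\<exists>v. \<forall>N\<ge>Suc n. x \<in> bounded_level b N (Suc n) (r(n := v))"
proof (rule ccontr)
  assume "\<nexists>v. \<forall>N\<ge>Suc n. x \<in> bounded_level b N (Suc n) (r(n := v))"
  then obtain N where N: "\<And>v. N v \<ge> Suc n" "\<And>v. x \<notin> bounded_level b (N v) (Suc n) (r(n := v))"
    by metis
  define K where "K = Max (N ` {..b n})"
  have K: "N v \<le> K" if "v \<le> b n" for v using that unfolding K_def by (intro Max_ge) auto
  then have "K \<ge> Suc n" using order_trans[OF N(1) K[of 0]] by simp
  then obtain r' where r': "\<forall>i<n. r' i = r i" "\<forall>i<K. r' i \<le> b i" "\<forall>m\<le>K. x \<in> P m r'"
    using assms[of K] unfolding bounded_level_def by auto
  have "x \<in> bounded_level b K (Suc n) (r(n := r' n))"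
    unfolding bounded_level_def using r' by (auto simp: less_Suc_eq)
  moreover have "r' n \<le> b n" using r' \<open>K \<ge> Suc n\<close> by auto
  ultimately show False using N(2) bounded_level_antimono[OF K] by blast
qed

text \<open>
  The branches below \<open>b\<close> form a compact set, so a point that has partial branches of every length
  below \<open>b\<close> has an infinite one. The lexicographically least one depends measurably on the point,
  because each of its entries is a least number with a measurable property.
\<close>

lemma bounded_branch_selection:
  obtains f where "f \<in> M \<rightarrow>\<^sub>M baire"
    and "\<And>x n. (\<And>N. x \<in> bounded_level b N 0 (\<lambda>_. 0)) \<Longrightarrow> x \<in> P n (f x)"
proof -
  \<comment> \<open>the first \<open>n\<close> entries of \<open>r\<close> extend to partial branches of every length\<close>
  define W where "W n r = (\<Inter>N\<in>{n..}. bounded_level b N n r)" for n r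
  have W_sets[measurable]: "W n r \<in> sets M" for n r
    unfolding W_def by (intro sets.countable_INT') (auto simp: sets_bounded_level)
  define g where "g x = rec_nat (\<lambda>_. 0) (\<lambda>n r. r(n := LEAST v. x \<in> W (Suc n) (r(n := v))))" for x
  have g0: "g x 0 = (\<lambda>_. 0)" and gSuc: "g x (Suc n) = (g x n)(n := LEAST v. x \<in> W (Suc n) ((g x n)(n := v)))"
    for x n by (simp_all add: g_def)
  have g_zero: "i \<ge> n \<Longrightarrow> g x n i = 0" for x n i
    by (induction n) (auto simp: g0 gSuc)
  define f where "f x i = g x (Suc i) i" for x i
  have gf: "i < n \<Longrightarrow> g x n i = f x i" for x n i
    by (induction n) (auto simp: f_def gSuc less_Suc_eq)
  have g_sets: "{x \<in> space M. g x n = r} \<in> sets M" for n r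
  proof (induction n arbitrary: r)
    case (Suc n)
    have [measurable]: "Measurable.pred M (\<lambda>x. x \<in> W (Suc n) (r(n := v)))" for v
      by measurable
    have "{x \<in> space M. g x (Suc n) = r} =
        {x \<in> space M. g x n = r(n := 0)} \<inter> {x \<in> space M. r n = (LEAST v. x \<in> W (Suc n) (r(n := v)))}"
    proof -
      have "g x (Suc n) = r \<longleftrightarrow> g x n = r(n := 0) \<and> r n = (LEAST v. x \<in> W (Suc n) (r(n := v)))" for x
      proof -
        have eq: "g x n = (g x n)(n := 0)" using g_zero[of n n x] by (metis fun_upd_triv order_refl)
        define L where "L r = (LEAST v. x \<in> W (Suc n) (r(n := v)))" for r
        have L: "L (r(n := c)) = L r" for r c unfolding L_def by simp
        have "(g x n)(n := L (g x n)) = r \<longleftrightarrow> g x n = r(n := 0) \<and> r n = L r"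
        proof
          assume a: "(g x n)(n := L (g x n)) = r"
          have "r(n := 0) = g x n" unfolding a[symmetric] by (simp flip: eq)
          moreover have "L r = L (g x n)" unfolding a[symmetric] L ..
          moreover have "r n = L (g x n)" unfolding a[symmetric] by simp
          ultimately show "g x n = r(n := 0) \<and> r n = L r" by simp
        next
          assume a: "g x n = r(n := 0) \<and> r n = L r"
          then have "L (g x n) = r n" by (simp add: L)
          then show "(g x n)(n := L (g x n)) = r" using a by (metis fun_upd_triv fun_upd_upd)
        qed
        then show ?thesis unfolding gSuc L_def .
      qed
      then show ?thesis by blast
    qed
    also have "\<dots> \<in> sets M" using Suc by measurable
    finally show ?case .
  qed (auto simp: g0)
  have "f \<in> M \<rightarrow>\<^sub>M baire"
    unfolding baire_def
  proof (subst measurable_cong[of _ _ "\<lambda>x i. f x i"], simp, rule measurable_PiM_single')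
    fix n
    have "{x \<in> space M. f x n = v} \<in> sets M" for v
    proof -
      have "{x \<in> space M. f x n = v} =
          (\<Union>r\<in>{r. (\<forall>i\<ge>Suc n. r i = 0) \<and> r n = v}. {x \<in> space M. g x (Suc n) = r})"
        using g_zero[of "Suc n"] by (auto simp: f_def)
      moreover have "countable {r::nat\<Rightarrow>nat. (\<forall>i\<ge>Suc n. r i = 0) \<and> r n = v}"
        by (rule countable_subset[OF _ countable_eventually_zero[of "Suc n"]]) auto
      ultimately show ?thesis using g_sets by (auto intro!: sets.countable_UN')
    qed
    then show "(\<lambda>x. f x n) \<in> M \<rightarrow>\<^sub>M count_space UNIV"
      by (subst measurable_count_space_eq2_countable) (auto simp: vimage_def Int_def conj_commute)
  qed auto
  moreover have "x \<in> P n (f x)" if x: "\<And>N. x \<in> bounded_level b N 0 (\<lambda>_. 0)" for x n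
  proof -
    have "x \<in> W n (g x n)"
    proof (induction n)
      case 0 then show ?case using x by (simp add: W_def g0)
    next
      case (Suc n)
      then have "\<exists>v. x \<in> W (Suc n) ((g x n)(n := v))"
        using bounded_level_extend[of n x b "g x n"] by (auto simp: W_def)
      then show ?case unfolding gSuc by (rule LeastI_ex)
    qed
    then have "x \<in> bounded_level b n n (g x n)" unfolding W_def by blast
    then obtain r' where r': "\<forall>i<n. r' i = g x n i" "x \<in> P n r'"
      unfolding bounded_level_def by blast
    then have "P n r' = P n (f x)"
      by (intro prefix_dependentD[OF P_prefix]) (auto simp: gf)
    with r' show ?thesis by simp
  qed
  ultimately show thesis using that by blast
qed

text \<open>
  The argument by which analytic sets are shown to be capacitable. Outer measure is continuous
  along increasing sequences of arbitrary sets, so the entries of the branch can be bounded one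
  after the other without letting the outer measure fall to \<open>t\<close>. The sets \<open>bounded_level b N 0\<close>
  are measurable and contain what remains, so continuity from above applies to them.
\<close>

lemma bounded_approximation:
  assumes "finite_measure M" and t: "t < outer_measure_of M branch_domain"
  obtains b where "t \<le> emeasure M (\<Inter>N. bounded_level b N 0 (\<lambda>_. 0))"
proof -
  interpret finite_measure M by fact
  have P_space: "P n r \<subseteq> space M" for n r using P_sets sets.sets_into_space by blast
  define A where "A n b = {x. \<exists>r. (\<forall>i<n. r i \<le> b i) \<and> (\<forall>m. x \<in> P m r)}" for n b
  have A0: "A 0 b = branch_domain" for b unfolding A_def branch_domain_def by simp
  have step: "\<exists>c. t < outer_measure_of M (A (Suc n) (b(n := c)))"
    if "t < outer_measure_of M (A n b)" for n b
  proof -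
    have "incseq (\<lambda>c. A (Suc n) (b(n := c)))"
    proof (unfold incseq_def, intro allI impI subsetI)
      fix c c' x assume "c \<le> c'" "x \<in> A (Suc n) (b(n := c))"
      then obtain r where r: "\<forall>i<Suc n. r i \<le> (b(n := c)) i" "\<forall>m. x \<in> P m r" unfolding A_def by blast
      have "r i \<le> (b(n := c')) i" if "i < Suc n" for i
        using r(1)[rule_format, OF that] \<open>c \<le> c'\<close> by (auto split: if_splits)
      then show "x \<in> A (Suc n) (b(n := c'))" unfolding A_def using r(2) by blast
    qed
    moreover have "A (Suc n) (b(n := c)) \<subseteq> space M" for c unfolding A_def using P_space by blast
    moreover have "(\<Union>c. A (Suc n) (b(n := c))) = A n b"
    proof (intro equalityI subsetI)
      fix x assume "x \<in> A n b"
      then obtain r where r: "\<forall>i<n. r i \<le> b i" "\<forall>m. x \<in> P m r" unfolding A_def by blast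
      then have "x \<in> A (Suc n) (b(n := r n))" unfolding A_def by (auto simp: less_Suc_eq)
      then show "x \<in> (\<Union>c. A (Suc n) (b(n := c)))" by blast
    next
      fix x assume "x \<in> (\<Union>c. A (Suc n) (b(n := c)))"
      then obtain c r where r: "\<forall>i<Suc n. r i \<le> (b(n := c)) i" "\<forall>m. x \<in> P m r" unfolding A_def by blast
      have "r i \<le> b i" if "i < n" for i using r(1)[rule_format, of i] that by auto
      then show "x \<in> A n b" unfolding A_def using r(2) by blast
    qed
    ultimately have "(SUP c. outer_measure_of M (A (Suc n) (b(n := c)))) = outer_measure_of M (A n b)"
      using SUP_outer_measure_of_incseq[of "\<lambda>c. A (Suc n) (b(n := c))" M] by auto
    then show ?thesis using that by (metis less_SUP_iff)
  qed
  define h where "h = rec_nat (\<lambda>_. 0) (\<lambda>n b. b(n := SOME c. t < outer_measure_of M (A (Suc n) (b(n := c)))))"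
  have h: "h 0 = (\<lambda>_. 0)" "h (Suc n) = (h n)(n := SOME c. t < outer_measure_of M (A (Suc n) ((h n)(n := c))))"
      for n
    by (simp_all add: h_def)
  have ht: "t < outer_measure_of M (A n (h n))" for n
  proof (induction n)
    case (Suc n) show ?case unfolding h using step[OF Suc.IH] by (rule someI_ex)
  qed (simp add: A0 t)
  define b where "b i = h (Suc i) i" for i
  have hb: "i < n \<Longrightarrow> h n i = b i" for n i
    by (induction n) (auto simp: b_def h less_Suc_eq)
  let ?C = "\<lambda>N. bounded_level b N 0 (\<lambda>_. 0)"
  have "t \<le> emeasure M (?C N)" for N
  proof -
    have "A N (h N) \<subseteq> ?C N" unfolding A_def bounded_level_def by (auto simp: hb)
    then have "outer_measure_of M (A N (h N)) \<le> outer_measure_of M (?C N)"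
      by (rule outer_measure_of_mono)
    then show ?thesis using ht[of N] sets_bounded_level by (simp add: less_imp_le order.strict_trans2)
  qed
  moreover have "(INF N. emeasure M (?C N)) = emeasure M (\<Inter>N. ?C N)"
    by (intro INF_emeasure_decseq) (auto simp: sets_bounded_level decseq_def bounded_level_antimono subsetD[OF
        bounded_level_antimono])
  ultimately have "t \<le> emeasure M (\<Inter>N. ?C N)" by (metis INF_greatest)
  then show thesis by (rule that)
qed

text \<open>
  A measurable hull \<open>E\<close> of the domain is exhausted up to a null set by countably many of the sets
  of the two preceding lemmas, on each of which a selection exists.
\<close>

theorem AE_branch_selection:
  assumes "finite_measure M"
  obtains f where "f \<in> M \<rightarrow>\<^sub>M baire" "AE x in M. x \<in> branch_domain \<longrightarrow> (\<forall>n. x \<in> P n (f x))"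
proof -
  interpret finite_measure M by fact
  have dom: "branch_domain \<subseteq> space M"
    unfolding branch_domain_def using P_sets sets.sets_into_space by blast
  obtain E where E: "E \<in> sets M" "branch_domain \<subseteq> E" "outer_measure_of M branch_domain = emeasure M E"
    using outer_measure_of_attain[OF dom] by blast
  show thesis
  proof (cases "emeasure M E = 0")
    case True
    have "(\<lambda>_ _. 0) \<in> M \<rightarrow>\<^sub>M baire" unfolding baire_def by (auto simp: space_PiM)
    moreover have "AE x in M. x \<notin> E" using True E by (intro AE_not_in) (auto simp: null_sets_def)
    then have "AE x in M. x \<in> branch_domain \<longrightarrow> (\<forall>n. x \<in> P n (\<lambda>_. 0))"
      using E by (auto elim!: AE_mp)
    ultimately show ?thesis by (intro that)
  next
    case False
    have sel: "\<exists>C f. C \<in> sets M \<and> C \<subseteq> E \<and> t \<le> emeasure M C \<and> f \<in> M \<rightarrow>\<^sub>M baire \<and> (\<forall>x\<in>C. \<forall>n. x \<in> P n (f x))"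
      if tE: "t < emeasure M E" for t
    proof -
      obtain b where b: "t \<le> emeasure M (\<Inter>N. bounded_level b N 0 (\<lambda>_. 0))"
        using bounded_approximation[OF assms, of t] tE E(3) by metis
      obtain f where f: "f \<in> M \<rightarrow>\<^sub>M baire"
        "\<And>x n. (\<And>N. x \<in> bounded_level b N 0 (\<lambda>_. 0)) \<Longrightarrow> x \<in> P n (f x)"
        using bounded_branch_selection[of b] by metis
      let ?C = "\<Inter>N. bounded_level b N 0 (\<lambda>_. 0)"
      have "?C \<in> sets M" by (intro sets.countable_INT') (auto simp: sets_bounded_level)
      moreover have "?C \<subseteq> E"
      proof
        fix x assume "x \<in> ?C"
        then have "\<forall>n. x \<in> P n (f x)" using f(2) by blast
        then show "x \<in> E" using E(2) unfolding branch_domain_def by blast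
      qed
      ultimately show ?thesis using b f by (intro exI[of _ ?C] exI[of _ f]) auto
    qed
    obtain t :: "nat \<Rightarrow> ennreal" where t: "range t \<subseteq> {..<emeasure M E}" "Sup {..<emeasure M E} = (SUP i. t i)"
    proof -
      have "0 \<in> {..<emeasure M E}" using False by (simp add: zero_less_iff_neq_zero)
      then have "{..<emeasure M E} \<noteq> {}" by blast
      from ennreal_Sup_countable_SUP[OF this] show thesis using that by blast
    qed
    obtain C f where Cf: "\<And>i. C i \<in> sets M" "\<And>i. C i \<subseteq> E" "\<And>i. t i \<le> emeasure M (C i)"
      "\<And>i. f i \<in> M \<rightarrow>\<^sub>M baire" "\<And>i x n. x \<in> C i \<Longrightarrow> x \<in> P n (f i x)"
    proof -
      have "t i < emeasure M E" for i using t(1) by (auto simp: image_subset_iff)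
      then have "\<forall>i. \<exists>C f. C \<in> sets M \<and> C \<subseteq> E \<and> t i \<le> emeasure M C \<and> f \<in> M \<rightarrow>\<^sub>M baire \<and>
          (\<forall>x\<in>C. \<forall>n. x \<in> P n (f x))" using sel by blast
      then show thesis using that by (auto simp only: choice_iff) blast
    qed
    have "Sup {..<emeasure M E} = emeasure M E"
    proof (rule antisym)
      show "emeasure M E \<le> Sup {..<emeasure M E}"
        by (rule dense_le) (auto intro: Sup_upper)
    qed (auto intro!: Sup_least)
    then have "emeasure M E \<le> emeasure M (\<Union>i. C i)"
    proof -
      have "t i \<le> emeasure M (\<Union>i. C i)" for i
        using Cf(1) by (intro order_trans[OF Cf(3)[of i]] emeasure_mono) auto
      then show ?thesis using t(2) \<open>Sup {..<emeasure M E} = emeasure M E\<close> by (simp add: SUP_least)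
    qed
    moreover have "(\<Union>i. C i) \<subseteq> E" using Cf by blast
    ultimately have "emeasure M (E - (\<Union>i. C i)) = 0"
      using Cf(1) E(1) by (subst emeasure_Diff) (auto simp: diff_eq_0_iff_ennreal less_top[symmetric])
    then have AE: "AE x in M. x \<notin> E - (\<Union>i. C i)"
      using Cf(1) E(1) by (intro AE_not_in) (auto simp: null_sets_def)
    define g where "g x = f (LEAST i. x \<in> C i) x" for x
    have [measurable]: "Measurable.pred M (\<lambda>x. x \<in> C i)" for i
      using Cf(1) by measurable
    have "g \<in> M \<rightarrow>\<^sub>M baire"
      unfolding g_def by (rule measurable_compose_countable[OF Cf(4)]) measurable
    moreover have g: "x \<in> P n (g x)" if "x \<in> (\<Union>i. C i)" for x n
      unfolding g_def using that by (intro Cf(5)) (auto intro: LeastI_ex)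
    have "AE x in M. x \<in> branch_domain \<longrightarrow> (\<forall>n. x \<in> P n (g x))"
      using AE by eventually_elim (use g E(2) in blast)
    ultimately show ?thesis by (intro that)
  qed
qed

end


section \<open>Measurable selection up to null sets\<close>

lemma space_baire [simp]: "space baire = UNIV"
  by (auto simp: baire_def space_PiM)

lemma measurable_baire_component [measurable]: "(\<lambda>r. r i) \<in> baire \<rightarrow>\<^sub>M count_space UNIV"
  unfolding baire_def by (rule measurable_component_singleton) simp

text \<open>
  The point \<open>(x, y)\<close> belongs to \<open>F\<close> when \<open>x\<close> has a branch \<open>s\<close> in a scheme that may also read \<open>y\<close>.
  Reading finitely many entries of \<open>y\<close> at a time turns the projection of \<open>F\<close> into a Souslin
  operation, with \<open>y\<close> and \<open>s\<close> interleaved as the branch.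
\<close>

definition souslin_scheme ::
    "'a measure \<Rightarrow> (nat \<Rightarrow> (nat \<Rightarrow> nat) \<Rightarrow> (nat \<Rightarrow> nat) \<Rightarrow> 'a set) \<Rightarrow> ('a \<times> (nat \<Rightarrow> nat)) set \<Rightarrow> bool" where
  "souslin_scheme M P F \<longleftrightarrow> (\<forall>n y s. P n y s \<in> sets M) \<and>
     (\<forall>n y y' s s'. (\<forall>i<n. y i = y' i \<and> s i = s' i) \<longrightarrow> P n y s = P n y' s') \<and>
     F = {(x, y). x \<in> space M \<and> (\<exists>s. \<forall>n. x \<in> P n y s)}"

definition souslin_over :: "'a measure \<Rightarrow> ('a \<times> (nat \<Rightarrow> nat)) set \<Rightarrow> bool" where
  "souslin_over M F \<longleftrightarrow> (\<exists>P. souslin_scheme M P F)"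

lemma souslin_schemeD:
  assumes "souslin_scheme M P F"
  shows "P n y s \<in> sets M"
    and "(\<forall>i<n. y i = y' i \<and> s i = s' i) \<Longrightarrow> P n y s = P n y' s'"
    and "F = {(x, y). x \<in> space M \<and> (\<exists>s. \<forall>n. x \<in> P n y s)}"
  using assms unfolding souslin_scheme_def by blast+

lemma souslin_over_fst:
  assumes A: "A \<in> sets M" shows "souslin_over M (A \<times> UNIV)"
  unfolding souslin_over_def souslin_scheme_def
  by (rule exI[of _ "\<lambda>_ _ _. A"]) (use A sets.sets_into_space[OF A] in auto)

lemma souslin_over_snd: "souslin_over M (space M \<times> {y. Q (y i)})"
  unfolding souslin_over_def souslin_scheme_def
proof (intro exI[of _ "\<lambda>n y s. if n = Suc i \<and> \<not> Q (y i) then {} else space M"] conjI allI impI)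
  show "space M \<times> {y. Q (y i)} =
    {(x, y). x \<in> space M \<and> (\<exists>s::nat \<Rightarrow> nat. \<forall>n. x \<in> (if n = Suc i \<and> \<not> Q (y i) then {} else space M))}"
    by auto
qed auto

text \<open>
  The first entry of the witness names the set of the union to which the remaining entries apply.
\<close>

lemma souslin_over_UN:
  fixes M :: "'a measure" and F :: "nat \<Rightarrow> ('a \<times> (nat \<Rightarrow> nat)) set"
  assumes "\<And>k. souslin_over M (F k)"
  shows "souslin_over M (\<Union>k. F k)"
proof -
  obtain P where "\<And>k. souslin_scheme M (P k) (F k)"
    using assms unfolding souslin_over_def by metis
  note P = souslin_schemeD[OF this]
  define Q where "Q n y s = (if n = 0 then space M else P (s 0) (n - 1) y (\<lambda>i. s (Suc i)))" for n y s
  have iff: "(\<exists>s. \<forall>n. x \<in> Q n y s) \<longleftrightarrow> (\<exists>k s. \<forall>n. x \<in> P k n y s)" if "x \<in> space M" for x y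
  proof
    assume "\<exists>s. \<forall>n. x \<in> Q n y s"
    then obtain s where s: "\<And>n. x \<in> Q n y s" by blast
    have "x \<in> P (s 0) n y (\<lambda>i. s (Suc i))" for n using s[of "Suc n"] by (simp add: Q_def)
    then show "\<exists>k s. \<forall>n. x \<in> P k n y s" by blast
  next
    assume "\<exists>k s. \<forall>n. x \<in> P k n y s"
    then obtain k s where "\<And>n. x \<in> P k n y s" by blast
    then have "x \<in> Q n y (\<lambda>i. case i of 0 \<Rightarrow> k | Suc j \<Rightarrow> s j)" for n
      using that by (simp add: Q_def)
    then show "\<exists>s. \<forall>n. x \<in> Q n y s" by blast
  qed
  have "(\<Union>k. F k) = {(x, y). x \<in> space M \<and> (\<exists>k s. \<forall>n. x \<in> P k n y s)}"
    unfolding P(3) by blast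
  also have "\<dots> = {(x, y). x \<in> space M \<and> (\<exists>s. \<forall>n. x \<in> Q n y s)}"
    using iff by (simp cong: conj_cong)
  finally have "(\<Union>k. F k) = {(x, y). x \<in> space M \<and> (\<exists>s. \<forall>n. x \<in> Q n y s)}" .
  moreover have "Q n y s = Q n y' s'" if "\<forall>i<n. y i = y' i \<and> s i = s' i" for n y y' s s'
  proof (cases n)
    case (Suc m)
    then have "P (s' 0) m y (\<lambda>i. s (Suc i)) = P (s' 0) m y' (\<lambda>i. s' (Suc i))"
      using that by (intro P(2)) auto
    then show ?thesis using Suc that by (simp add: Q_def)
  qed (simp add: Q_def)
  moreover have "Q n y s \<in> sets M" for n y s by (simp add: Q_def P(1))
  ultimately show ?thesis unfolding souslin_over_def souslin_scheme_def by blast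
qed

text \<open>
  One witness codes a sequence of witnesses through a pairing function. Condition number \<open>m\<close>, the
  \<open>n\<close>-th condition on the \<open>k\<close>-th witness with \<open>m = (k, n)\<close> in code, reads only entries of code
  below \<open>m\<close>.
\<close>

lemma souslin_over_INT:
  fixes M :: "'a measure" and F :: "nat \<Rightarrow> ('a \<times> (nat \<Rightarrow> nat)) set"
  assumes "\<And>k. souslin_over M (F k)"
  shows "souslin_over M (\<Inter>k. F k)"
proof -
  obtain P where "\<And>k. souslin_scheme M (P k) (F k)"
    using assms unfolding souslin_over_def by metis
  note P = souslin_schemeD[OF this]
  define Q where "Q m y s = (case prod_decode m of (k, n) \<Rightarrow> P k n y (\<lambda>i. s (prod_encode (k, i))))" for m y s
  have iff: "(\<exists>s. \<forall>m. x \<in> Q m y s) \<longleftrightarrow> (\<forall>k. \<exists>s. \<forall>n. x \<in> P k n y s)" for x y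
  proof
    assume "\<exists>s. \<forall>m. x \<in> Q m y s"
    then obtain s where s: "\<And>m. x \<in> Q m y s" by blast
    have "x \<in> P k n y (\<lambda>i. s (prod_encode (k, i)))" for k n
      using s[of "prod_encode (k, n)"] by (simp add: Q_def)
    then show "\<forall>k. \<exists>s. \<forall>n. x \<in> P k n y s" by blast
  next
    assume "\<forall>k. \<exists>s. \<forall>n. x \<in> P k n y s"
    then obtain s where "\<And>k n. x \<in> P k n y (s k)" by metis
    then have "x \<in> Q m y (\<lambda>j. case prod_decode j of (k, i) \<Rightarrow> s k i)" for m
      by (simp add: Q_def split: prod.split)
    then show "\<exists>s. \<forall>m. x \<in> Q m y s" by blast
  qed
  have "(\<Inter>k. F k) = {(x, y). x \<in> space M \<and> (\<forall>k. \<exists>s. \<forall>n. x \<in> P k n y s)}"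
    unfolding P(3) by blast
  also have "\<dots> = {(x, y). x \<in> space M \<and> (\<exists>s. \<forall>n. x \<in> Q n y s)}"
    using iff by simp
  finally have "(\<Inter>k. F k) = {(x, y). x \<in> space M \<and> (\<exists>s. \<forall>n. x \<in> Q n y s)}" .
  moreover have "Q m y s = Q m y' s'" if eq: "\<forall>i<m. y i = y' i \<and> s i = s' i" for m y y' s s'
  proof -
    obtain k n where kn: "prod_decode m = (k, n)" by fastforce
    then have m: "m = prod_encode (k, n)" by (metis prod_decode_inverse)
    have "i < m \<and> prod_encode (k, i) < m" if "i < n" for i
    proof -
      have "triangle (k + i) < triangle (k + n)"
        by (rule lift_Suc_mono_less[of triangle]) (use that in simp_all)
      then have "prod_encode (k, i) < m" by (simp add: m prod_encode_def)
      then show ?thesis using le_prod_encode_2[of i k] by simp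
    qed
    then have "P k n y (\<lambda>i. s (prod_encode (k, i))) = P k n y' (\<lambda>i. s' (prod_encode (k, i)))"
      using eq by (intro P(2)) auto
    then show ?thesis by (simp add: Q_def kn)
  qed
  moreover have "Q n y s \<in> sets M" for n y s by (simp add: Q_def P(1) split: prod.split)
  ultimately show ?thesis unfolding souslin_over_def souslin_scheme_def by blast
qed

text \<open>
  The sets that are Souslin over \<open>M\<close> together with their complements form a \<open>\<sigma>\<close>-algebra that makes
  both projections measurable.
\<close>

lemma souslin_over_measurable:
  assumes "F \<in> sets (M \<Otimes>\<^sub>M baire)"
  shows "souslin_over M F"
proof -
  let ?\<Omega> = "space M \<times> (UNIV :: (nat \<Rightarrow> nat) set)"
  define \<A> where "\<A> = {F. F \<subseteq> ?\<Omega> \<and> souslin_over M F \<and> souslin_over M (?\<Omega> - F)}"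
  have fst_in: "A \<times> UNIV \<in> \<A>" if "A \<in> sets M" for A
  proof -
    have "?\<Omega> - A \<times> UNIV = (space M - A) \<times> UNIV" by auto
    then show ?thesis unfolding \<A>_def
      using souslin_over_fst[OF that] souslin_over_fst[of "space M - A" M] that sets.sets_into_space[OF that]
          by auto
  qed
  have snd_in: "space M \<times> {y. y i \<in> B} \<in> \<A>" for i B
  proof -
    have "?\<Omega> - space M \<times> {y. y i \<in> B} = space M \<times> {y. y i \<notin> B}" by auto
    then show ?thesis unfolding \<A>_def
      using souslin_over_snd[of M "\<lambda>v. v \<in> B" i] souslin_over_snd[of M "\<lambda>v. v \<notin> B" i] by auto
  qed
  have "sigma_algebra ?\<Omega> \<A>"
    unfolding sigma_algebra_iff2
  proof (intro conjI ballI allI impI)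
    show "{} \<in> \<A>" using fst_in[of "{}"] by simp
    show "\<A> \<subseteq> Pow ?\<Omega>" unfolding \<A>_def by auto
    show "?\<Omega> - F \<in> \<A>" if "F \<in> \<A>" for F using that unfolding \<A>_def by (auto simp: double_diff)
    show "(\<Union>i::nat. F i) \<in> \<A>" if "range F \<subseteq> \<A>" for F
    proof -
      have eq: "?\<Omega> - (\<Union>i. F i) = (\<Inter>i. ?\<Omega> - F i)" by auto
      have F: "F i \<subseteq> ?\<Omega>" "souslin_over M (F i)" "souslin_over M (?\<Omega> - F i)" for i
        using that unfolding \<A>_def by auto
      have "souslin_over M (?\<Omega> - (\<Union>i. F i))"
        unfolding eq by (rule souslin_over_INT) (rule F(3))
      moreover have "souslin_over M (\<Union>i. F i)" by (rule souslin_over_UN) (rule F(2))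
      ultimately show ?thesis unfolding \<A>_def using F(1) by blast
    qed
  qed
  then have sets: "sets (sigma ?\<Omega> \<A>) = \<A>" and space: "space (sigma ?\<Omega> \<A>) = ?\<Omega>"
    by (auto simp: sigma_algebra.sets_measure_of_eq \<A>_def intro!: space_measure_of)
  have "fst \<in> sigma ?\<Omega> \<A> \<rightarrow>\<^sub>M M"
  proof (rule measurableI)
    fix A assume A: "A \<in> sets M"
    have "fst -` A \<inter> space (sigma ?\<Omega> \<A>) = A \<times> UNIV"
      using sets.sets_into_space[OF A] unfolding space by auto
    then show "fst -` A \<inter> space (sigma ?\<Omega> \<A>) \<in> sets (sigma ?\<Omega> \<A>)"
      using fst_in[OF A] by (simp add: sets)
  qed (auto simp: space)
  moreover have "snd \<in> sigma ?\<Omega> \<A> \<rightarrow>\<^sub>M baire"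
  proof -
    have "(\<lambda>z i. snd z i) \<in> sigma ?\<Omega> \<A> \<rightarrow>\<^sub>M baire"
      unfolding baire_def
    proof (rule measurable_PiM_single')
      fix i
      show "(\<lambda>z. snd z i) \<in> sigma ?\<Omega> \<A> \<rightarrow>\<^sub>M count_space UNIV"
      proof (rule measurableI)
        fix B :: "nat set"
        have "(\<lambda>z. snd z i) -` B \<inter> space (sigma ?\<Omega> \<A>) = space M \<times> {y. y i \<in> B}"
          unfolding space by auto
        then show "(\<lambda>z. snd z i) -` B \<inter> space (sigma ?\<Omega> \<A>) \<in> sets (sigma ?\<Omega> \<A>)"
          using snd_in by (simp add: sets)
      qed simp
    qed auto
    then show ?thesis by simp
  qed
  ultimately have "(\<lambda>z. (fst z, snd z)) \<in> sigma ?\<Omega> \<A> \<rightarrow>\<^sub>M M \<Otimes>\<^sub>M baire"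
    by (rule measurable_Pair)
  then have "(\<lambda>z. z) -` F \<inter> space (sigma ?\<Omega> \<A>) \<in> sets (sigma ?\<Omega> \<A>)"
    using assms by (intro measurable_sets) auto
  moreover have "F \<subseteq> ?\<Omega>" using sets.sets_into_space[OF assms] by (auto simp: space_pair_measure)
  then have "(\<lambda>z. z) -` F \<inter> space (sigma ?\<Omega> \<A>) = F" unfolding space by auto
  ultimately show ?thesis unfolding sets by (simp add: \<A>_def)
qed

lemma AE_measurable_selection_baire:
  fixes M :: "'a measure"
  assumes "finite_measure M" and F: "F \<in> sets (M \<Otimes>\<^sub>M baire)"
  obtains f where "f \<in> M \<rightarrow>\<^sub>M baire" "AE x in M. \<forall>y. (x, y) \<in> F \<longrightarrow> (x, f x) \<in> F"
proof -
  obtain P where "souslin_scheme M P F"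
    using souslin_over_measurable[OF F] unfolding souslin_over_def by blast
  note P = souslin_schemeD[OF this]
  \<comment> \<open>even entries of \<open>r\<close> code \<open>y\<close>, odd entries code its witness\<close>
  define Q where "Q n r = P (n div 2) (\<lambda>i. r (2 * i)) (\<lambda>i. r (Suc (2 * i)))" for n r
  interpret measurable_scheme M Q
  proof
    show "prefix_dependent Q" unfolding prefix_dependent_def Q_def
      by (intro allI impI P(2)) auto
  qed (simp add: Q_def P(1))
  obtain f where f: "f \<in> M \<rightarrow>\<^sub>M baire" "AE x in M. x \<in> branch_domain \<longrightarrow> (\<forall>n. x \<in> Q n (f x))"
    using AE_branch_selection[OF assms(1)] by blast
  have "(\<lambda>x i. f x (2 * i)) \<in> M \<rightarrow>\<^sub>M baire"
    using measurable_compose[OF f(1) measurable_baire_component]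
    unfolding baire_def by (intro measurable_PiM_single') auto
  moreover have "AE x in M. \<forall>y. (x, y) \<in> F \<longrightarrow> (x, \<lambda>i. f x (2 * i)) \<in> F"
    using f(2) AE_space
  proof eventually_elim
    case (elim x)
    show ?case
    proof (intro allI impI)
      fix y assume "(x, y) \<in> F"
      then obtain s where s: "\<And>n. x \<in> P n y s" unfolding P(3) by blast
      have "x \<in> Q n (\<lambda>i. if even i then y (i div 2) else s (i div 2))" for n
        unfolding Q_def using s by simp
      then have "x \<in> branch_domain" unfolding branch_domain_def by blast
      then have "x \<in> Q (2 * n) (f x)" for n using elim by blast
      then have "\<forall>n. x \<in> P n (\<lambda>i. f x (2 * i)) (\<lambda>i. f x (Suc (2 * i)))"
        by (simp add: Q_def)
      then show "(x, \<lambda>i. f x (2 * i)) \<in> F" unfolding P(3) using elim by blast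
    qed
  qed
  ultimately show thesis by (rule that)
qed

lemma sets_borel_of: "sets (borel_of T) = sigma_sets (topspace T) {U. openin T U}"
  unfolding borel_of_def by (rule sets_measure_of) (auto dest: openin_subset)

lemma space_borel_of [simp]: "space (borel_of T) = topspace T"
  unfolding borel_of_def by (rule space_measure_of) (auto dest: openin_subset)

text \<open>
  A sequence of indices into a countable dense set is forced to be Cauchy: an entry that would
  jump too far is ignored. The limit is then a continuous function of the sequence, and a sequence
  that converges fast enough is not altered, so every point is a limit.
\<close>

lemma standard_borel_image_of_baire:
  assumes "standard_borel N" "space N \<noteq> {}"
  obtains g where "g \<in> baire \<rightarrow>\<^sub>M N" "range g = space N"
proof -
  obtain T where T: "completely_metrizable_space T" "second_countable T" "sets N = sets (borel_of T)"
    using assms(1) unfolding standard_borel_def polish_topology_def by blast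
  obtain S d where "Metric_space S d" and mc: "Metric_space.mcomplete S d"
      and T_eq: "T = Metric_space.mtopology S d"
    using T(1) unfolding completely_metrizable_space_def by blast
  interpret Metric_space S d by fact
  have sets_N: "sets N = sigma_sets S {U. openin T U}"
    using T(3) unfolding sets_borel_of by (simp add: T_eq)
  have space_N: "space N = S" using sets_eq_imp_space_eq[OF T(3)] by (simp add: T_eq)
  obtain C where C: "countable C" "C \<subseteq> S" "T closure_of C = S"
    using second_countable_imp_separable_space[OF T(2)] unfolding separable_space_def T_eq by auto
  have "C \<noteq> {}" using C(3) assms(2) space_N by auto
  define c where "c = from_nat_into C"
  have cS: "c i \<in> S" for i
    unfolding c_def by (rule subsetD[OF C(2) from_nat_into[OF \<open>C \<noteq> {}\<close>]])
  have dense: "\<exists>i. d x (c i) < e" if "x \<in> S" "e > 0" for x e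
  proof -
    have "x \<in> T closure_of C" using C(3) that by simp
    then obtain y where "y \<in> C" "d x y < e"
      using \<open>e > 0\<close> unfolding T_eq metric_closure_of by (force simp: in_mball)
    then show ?thesis using from_nat_into_surj[OF C(1) \<open>y \<in> C\<close>] unfolding c_def by auto
  qed
  define k where "k s = rec_nat (s 0) (\<lambda>n i. if d (c i) (c (s (Suc n))) \<le> (1/2) ^ n then s (Suc n) else i)"
    for s :: "nat \<Rightarrow> nat"
  have k: "k s 0 = s 0" "k s (Suc n) = (if d (c (k s n)) (c (s (Suc n))) \<le> (1/2) ^ n then s (Suc n) else k s
      n)"
    for s n by (simp_all add: k_def)
  have k_meas: "(\<lambda>s. k s n) \<in> baire \<rightarrow>\<^sub>M count_space UNIV" for n
  proof (induction n)
    case (Suc n)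
    note [measurable] = Suc
    show ?case unfolding k by measurable
  qed (simp add: k(1))
  have step: "d (c (k s n)) (c (k s (Suc n))) \<le> (1/2) ^ n" for s n
    unfolding k by (auto simp: cS)
  have far: "d (c (k s n)) (c (k s (n + m))) \<le> 2 * (1/2) ^ n - 2 * (1/2) ^ (n + m)" for s n m
  proof (induction m)
    case (Suc m)
    have "d (c (k s n)) (c (k s (n + Suc m))) \<le> d (c (k s n)) (c (k s (n + m))) + d (c (k s (n + m))) (c (k s
        (Suc (n + m))))"
      using triangle[OF cS cS cS] by simp
    also have "\<dots> \<le> (2 * (1/2) ^ n - 2 * (1/2) ^ (n + m)) + (1/2) ^ (n + m)"
      using Suc step[of s "n + m"] by (intro add_mono)
    finally show ?case by simp
  qed (simp add: cS)
  have close: "d (c (k s n)) (c (k s m)) \<le> 2 * (1/2) ^ n" if "n \<le> m" for s n m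
  proof -
    have "d (c (k s n)) (c (k s m)) \<le> 2 * (1/2) ^ n - 2 * (1/2) ^ m"
      using far[of s n "m - n"] that by simp
    moreover have "0 \<le> 2 * (1/2::real) ^ m" by (intro mult_nonneg_nonneg zero_le_power) auto
    ultimately show ?thesis by linarith
  qed
  have small: "\<exists>n. a * (1/2::real) ^ n < e" if ea: "e > 0" "a > 0" for e a :: real
  proof -
    obtain n where "(1/2::real) ^ n < e / a" using real_arch_pow_inv[of "e / a" "1/2"] divide_pos_pos[OF ea]
        by auto
    then show ?thesis using ea by (auto simp: field_simps)
  qed
  have "\<exists>y. limitin T (\<lambda>n. c (k s n)) y sequentially" for s
  proof -
    have "MCauchy (\<lambda>n. c (k s n))"
      unfolding MCauchy_def
    proof (intro conjI allI impI)
      fix e :: real assume "e > 0"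
      then obtain K where K: "4 * (1/2::real) ^ K < e" using small[of e 4] by auto
      have "d (c (k s n)) (c (k s m)) < e" if "K \<le> n" "K \<le> m" for n m
      proof -
        have "d (c (k s n)) (c (k s m)) \<le> d (c (k s n)) (c (k s K)) + d (c (k s K)) (c (k s m))"
          by (rule triangle) (rule cS)+
        also have "\<dots> \<le> 2 * (1/2) ^ K + 2 * (1/2) ^ K"
          using close[OF that(1), of s] close[OF that(2), of s] by (simp add: commute)
        finally show ?thesis using K by simp
      qed
      then show "\<exists>K. \<forall>n n'. K \<le> n \<longrightarrow> K \<le> n' \<longrightarrow> d (c (k s n)) (c (k s n')) < e" by blast
    qed (use cS in auto)
    then show ?thesis using mc unfolding mcomplete_def T_eq by blast
  qed
  then obtain g where g: "\<And>s. limitin T (\<lambda>n. c (k s n)) (g s) sequentially" by metis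
  have gS: "g s \<in> S" for s using g limitin_mspace unfolding T_eq by blast
  have g_close: "d (c (k s n)) (g s) \<le> 2 * (1/2) ^ n" for s n
  proof (rule ccontr)
    assume "\<not> ?thesis"
    then have pos: "d (c (k s n)) (g s) - 2 * (1/2) ^ n > 0" by simp
    obtain K where K: "\<And>m. m \<ge> K \<Longrightarrow> d (c (k s m)) (g s) < d (c (k s n)) (g s) - 2 * (1/2) ^ n"
      using g[of s] pos unfolding T_eq limit_metric_sequentially by blast
    have "d (c (k s n)) (g s) \<le> d (c (k s n)) (c (k s (max K n))) + d (c (k s (max K n))) (g s)"
      by (rule triangle) (rule cS gS)+
    then show False using K[of "max K n"] close[of n "max K n" s] by simp
  qed
  have "g \<in> baire \<rightarrow>\<^sub>M N"
  proof (rule measurable_sigma_sets[OF sets_N])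
    show "{U. openin T U} \<subseteq> Pow S" unfolding T_eq using openin_subset by fastforce
    show "g \<in> space baire \<rightarrow> S" using gS by auto
    fix U assume "U \<in> {U. openin T U}"
    then have U: "openin T U" by simp
    have "g s \<in> U \<longleftrightarrow> (\<exists>n. mball (c (k s n)) (3 * (1/2) ^ n) \<subseteq> U)" for s
    proof
      assume "g s \<in> U"
      then obtain e where e: "e > 0" "mball (g s) e \<subseteq> U" using U unfolding T_eq openin_mtopology by blast
      obtain n where n: "5 * (1/2::real) ^ n < e" using small[of e 5] e by auto
      have "mball (c (k s n)) (3 * (1/2) ^ n) \<subseteq> mball (g s) e"
      proof
        fix z assume z: "z \<in> mball (c (k s n)) (3 * (1/2) ^ n)"
        then have "d (g s) z \<le> d (g s) (c (k s n)) + d (c (k s n)) z" using triangle[of "g s" "c (k s n)"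
            z] gS cS by auto
        also have "\<dots> \<le> 2 * (1/2) ^ n + 3 * (1/2) ^ n"
          using z g_close[of s n] by (simp add: commute)
        finally show "z \<in> mball (g s) e" using z n gS by simp
      qed
      then show "\<exists>n. mball (c (k s n)) (3 * (1/2) ^ n) \<subseteq> U" using e by blast
    next
      assume "\<exists>n. mball (c (k s n)) (3 * (1/2) ^ n) \<subseteq> U"
      then obtain n where n: "mball (c (k s n)) (3 * (1/2) ^ n) \<subseteq> U" by blast
      have "g s \<in> mball (c (k s n)) (3 * (1/2) ^ n)"
        using g_close[of s n] cS gS by (simp add: order.strict_trans1)
      then show "g s \<in> U" using n by blast
    qed
    then have "g -` U \<inter> space baire =
        (\<Union>n. (\<lambda>s. k s n) -` {i. mball (c i) (3 * (1/2) ^ n) \<subseteq> U} \<inter> space baire)" by auto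
    also have "\<dots> \<in> sets baire"
      by (rule sets.countable_UN'') (use measurable_sets[OF k_meas] in \<open>auto simp del: vimage_Collect_eq\<close>)
    finally show "g -` U \<inter> space baire \<in> sets baire" .
  qed
  moreover have "range g = space N"
  proof
    show "space N \<subseteq> range g"
    proof
      fix y assume "y \<in> space N"
      then have y: "y \<in> S" by (simp add: space_N)
      have "\<exists>i. d y (c i) < (1/2) ^ n / 4" for n :: nat using dense[OF y, of "(1/2) ^ n / 4"] by auto
      then obtain s where s: "\<And>n. d y (c (s n)) < (1/2) ^ n / 4" by metis
      have ks: "k s n = s n" for n
      proof (induction n)
        case (Suc n)
        have "d (c (s n)) (c (s (Suc n))) \<le> d y (c (s n)) + d y (c (s (Suc n)))"
          by (rule triangle'') (rule y cS)+
        also have "\<dots> \<le> (1/2) ^ n / 4 + (1/2) ^ Suc n / 4" using s[of n] s[of "Suc n"] by linarith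
        also have "\<dots> \<le> (1/2) ^ n" by simp
        finally show ?case using Suc by (simp add: k)
      qed (simp add: k)
      have "d y (g s) = 0"
      proof (rule ccontr)
        assume "d y (g s) \<noteq> 0"
        then have "d y (g s) > 0" using nonneg[of y "g s"] by linarith
        then obtain n where n: "3 * (1/2::real) ^ n < d y (g s)" using small[of _ 3] by auto
        have "d y (g s) \<le> d y (c (s n)) + d (c (s n)) (g s)" by (rule triangle) (rule y cS gS)+
        moreover have "0 \<le> (1/2::real) ^ n" by simp
        ultimately show False using s[of n] g_close[of s n] n unfolding ks by linarith
      qed
      then show "y \<in> range g" using zero[OF y gS] by blast
    qed
  qed (use gS space_N in auto)
  ultimately show thesis by (rule that)
qed

text \<open>
  A Borel surjection from the Baire space onto \<open>N\<close> reduces this to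
  \<open>AE_measurable_selection_baire\<close>. In particular the projection of a Borel set is measurable up to
  null sets. Besides selections, this yields that a function with a Borel graph agrees almost
  everywhere with a measurable function.
\<close>

theorem AE_measurable_selection:
  assumes "finite_measure M" "standard_borel N" "space N \<noteq> {}" and F: "F \<in> sets (M \<Otimes>\<^sub>M N)"
  obtains f where "f \<in> M \<rightarrow>\<^sub>M N" "AE x in M. \<forall>y. (x, y) \<in> F \<longrightarrow> (x, f x) \<in> F"
proof -
  obtain g where [measurable]: "g \<in> baire \<rightarrow>\<^sub>M N" and g: "range g = space N"
    using standard_borel_image_of_baire assms(2,3) by blast
  define F' where "F' = (\<lambda>(x, r). (x, g r)) -` F \<inter> space (M \<Otimes>\<^sub>M baire)"
  have "F' \<in> sets (M \<Otimes>\<^sub>M baire)"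
    unfolding F'_def by (rule measurable_sets[OF _ F]) measurable
  then obtain f where f[measurable]: "f \<in> M \<rightarrow>\<^sub>M baire" and sel: "AE x in M. \<forall>r. (x, r) \<in> F' \<longrightarrow> (x, f x) \<in> F'"
    using AE_measurable_selection_baire[OF assms(1)] by blast
  have "AE x in M. \<forall>y. (x, y) \<in> F \<longrightarrow> (x, g (f x)) \<in> F"
    using sel
  proof eventually_elim
    case (elim x)
    show ?case
    proof (intro allI impI)
      fix y assume xy: "(x, y) \<in> F"
      then have "x \<in> space M" "y \<in> space N" using sets.sets_into_space[OF F]
          by (auto simp: space_pair_measure)
      then obtain r where "y = g r" using g by blast
      then have "(x, r) \<in> F'" using xy \<open>x \<in> space M\<close> by (simp add: F'_def space_pair_measure)
      then show "(x, g (f x)) \<in> F" using elim by (auto simp: F'_def)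
    qed
  qed
  moreover have "(\<lambda>x. g (f x)) \<in> M \<rightarrow>\<^sub>M N" by measurable
  ultimately show thesis by (rule that[rotated])
qed


section \<open>Covering a hyperfinite relation by automorphisms\<close>

lemma standard_borel_separating_sets:
  assumes "standard_borel M"
  obtains U :: "nat \<Rightarrow> 'a set" where "\<And>k. U k \<in> sets M"
    and "\<And>F x. finite F \<Longrightarrow> x \<in> space M - F \<Longrightarrow> F \<subseteq> space M \<Longrightarrow> \<exists>k. x \<in> U k \<and> U k \<inter> F = {}"
proof -
  obtain T where T: "completely_metrizable_space T" "second_countable T" "sets M = sets (borel_of T)"
    using assms(1) unfolding standard_borel_def polish_topology_def by blast
  have space: "space M = topspace T" using sets_eq_imp_space_eq[OF T(3)] by simp
  obtain B where B: "countable B" "\<And>V. V \<in> B \<Longrightarrow> openin T V"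
    "\<And>U x. openin T U \<Longrightarrow> x \<in> U \<Longrightarrow> \<exists>V\<in>B. x \<in> V \<and> V \<subseteq> U"
    using T(2) unfolding second_countable_def by metis
  define U where "U = from_nat_into (insert {} B)"
  have U: "U k \<in> insert {} B" for k unfolding U_def by (rule from_nat_into) simp
  have "openin T (U k)" for k using U[of k] B(2) by auto
  then have "U k \<in> sets M" for k unfolding T(3) sets_borel_of by (simp add: sigma_sets.Basic)
  moreover have "\<exists>k. x \<in> U k \<and> U k \<inter> F = {}"
    if F: "finite F" "x \<in> space M - F" "F \<subseteq> space M" for F x
  proof -
    have "t1_space T" using T(1) by (simp add: completely_metrizable_imp_metrizable_space
      Hausdorff_imp_t1_space metrizable_imp_Hausdorff_space)
    then have "closedin T F" using F space by (simp add: t1_space_closedin_finite)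
    then have "openin T (topspace T - F)" by auto
    then obtain V where V: "V \<in> B" "x \<in> V" "V \<subseteq> topspace T - F" using B(3) F space by blast
    then obtain k where "U k = V"
      using from_nat_into_surj[of "insert {} B" V] B(1) unfolding U_def by auto
    then show ?thesis using V by blast
  qed
  ultimately show thesis by (rule that)
qed

lemma sets_equaliser:
  assumes M: "standard_borel M" and f[measurable]: "f \<in> N \<rightarrow>\<^sub>M M" and g[measurable]: "g \<in> N \<rightarrow>\<^sub>M M"
  shows "{x \<in> space N. f x = g x} \<in> sets N"
proof -
  obtain U :: "nat \<Rightarrow> 'a set" where U[measurable]: "\<And>k. U k \<in> sets M"
    and sep: "\<And>F x. finite F \<Longrightarrow> x \<in> space M - F \<Longrightarrow> F \<subseteq> space M \<Longrightarrow> \<exists>k. x \<in> U k \<and> U k \<inter> F = {}"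
    using standard_borel_separating_sets[OF M] by metis
  have "f x = g x \<longleftrightarrow> (\<forall>k. f x \<in> U k \<longrightarrow> g x \<in> U k)" if x: "x \<in> space N" for x
  proof -
    have "f x \<in> space M" "g x \<in> space M" using measurable_space[OF f x] measurable_space[OF g x] by auto
    then show ?thesis using sep[of "{g x}" "f x"] by auto
  qed
  then have "{x \<in> space N. f x = g x} = {x \<in> space N. \<forall>k. f x \<in> U k \<longrightarrow> g x \<in> U k}" by blast
  also have "\<dots> \<in> sets N" by measurable
  finally show ?thesis .
qed

locale pmp_relation = prob_space M for M :: "'a measure" and R :: "('a \<times> 'a) set" +
  assumes standard: "standard_borel M"
    and relation: "discrete_borel_equiv M R"
    and invariant: "invariant_measure M R"
begin

lemma R_sets [measurable]: "R \<in> sets (M \<Otimes>\<^sub>M M)"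
  and R_equiv: "equiv (space M) R"
  using relation unfolding discrete_borel_equiv_def by auto

lemma R_refl: "x \<in> space M \<Longrightarrow> (x, x) \<in> R"
  using R_equiv by (auto simp: equiv_def refl_on_def)
lemma R_sym: "(x, y) \<in> R \<Longrightarrow> (y, x) \<in> R"
  using R_equiv by (auto simp: equiv_def sym_def)
lemma R_trans: "(x, y) \<in> R \<Longrightarrow> (y, z) \<in> R \<Longrightarrow> (x, z) \<in> R"
  using R_equiv by (auto simp: equiv_def dest: transD)
lemma R_space: "(x, y) \<in> R \<Longrightarrow> x \<in> space M \<and> y \<in> space M"
  using sets.sets_into_space[OF R_sets] by (auto simp: space_pair_measure)

lemma equaliser_pred:
  assumes "f \<in> N \<rightarrow>\<^sub>M M" "g \<in> N \<rightarrow>\<^sub>M M" shows "Measurable.pred N (\<lambda>x. f x = g x)"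
  using sets_equaliser[OF standard assms] by (simp add: pred_def)

definition full_group :: "('a \<Rightarrow> 'a) set" where
  "full_group = {\<phi>. borel_automorphism M \<phi> \<and> (\<forall>x\<in>space M. (x, \<phi> x) \<in> R)}"

lemma full_groupD:
  assumes "\<phi> \<in> full_group"
  shows "\<phi> \<in> M \<rightarrow>\<^sub>M M" "distr M M \<phi> = M" "x \<in> space M \<Longrightarrow> (x, \<phi> x) \<in> R" "inj_on \<phi> (space M)"
  using assms invariant unfolding full_group_def borel_automorphism_def invariant_measure_def bij_betw_def
  by auto

lemma full_group_image:
  assumes \<phi>: "\<phi> \<in> full_group" and A: "A \<in> sets M"
  shows "\<phi> ` A \<in> sets M" "emeasure M (\<phi> ` A) = emeasure M A"
proof -
  have A': "A \<subseteq> space M" using sets.sets_into_space[OF A] .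
  have bij: "bij_betw \<phi> (space M) (space M)" and inv: "inv_into (space M) \<phi> \<in> M \<rightarrow>\<^sub>M M"
    using \<phi> unfolding full_group_def borel_automorphism_def by auto
  have "\<phi> ` A = inv_into (space M) \<phi> -` A \<inter> space M"
    using bij A' by (auto simp: bij_betw_def inv_into_f_f f_inv_into_f intro!: image_eqI)
  then show img: "\<phi> ` A \<in> sets M" using measurable_sets[OF inv A] by simp
  have "\<phi> -` (\<phi> ` A) \<inter> space M = A"
    using A' full_groupD(4)[OF \<phi>] by (auto simp: inj_on_def)
  then show "emeasure M (\<phi> ` A) = emeasure M A"
    using emeasure_distr[OF full_groupD(1)[OF \<phi>] img] full_groupD(2)[OF \<phi>] by simp
qed

text \<open>
  A Borel bijection between disjoint Borel sets extends to an involution. Given the inverse \<open>g\<close> as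
  a Borel map, the image \<open>f ` A\<close> is seen to be Borel without any theorem on injective images.
\<close>

lemma swap_partial_isomorphism:
  assumes A[measurable]: "A \<in> sets M" and f[measurable]: "f \<in> M \<rightarrow>\<^sub>M M" and g[measurable]: "g \<in> M \<rightarrow>\<^sub>M M"
    and fR: "\<And>x. x \<in> A \<Longrightarrow> (x, f x) \<in> R" and gf: "\<And>x. x \<in> A \<Longrightarrow> g (f x) = x"
    and disj: "f ` A \<inter> A = {}"
  obtains \<phi> where "\<phi> \<in> full_group" "\<And>x. x \<in> A \<Longrightarrow> \<phi> x = f x"
proof -
  have As: "A \<subseteq> space M" using sets.sets_into_space[OF A] .
  define B where "B = {z \<in> space M. g z \<in> A \<and> f (g z) = z}"
  have [measurable]: "B \<in> sets M"
  proof -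
    have "{z \<in> space M. f (g z) = z} \<in> sets M" by (rule sets_equaliser[OF standard]) measurable
    moreover have "B = {z \<in> space M. g z \<in> A} \<inter> {z \<in> space M. f (g z) = z}" unfolding B_def by auto
    ultimately show ?thesis by simp
  qed
  have B_eq: "B = f ` A"
    unfolding B_def using gf As measurable_space[OF f] by force
  define \<phi> where "\<phi> x = (if x \<in> A then f x else if x \<in> B then g x else x)" for x
  have \<phi>_meas: "\<phi> \<in> M \<rightarrow>\<^sub>M M" unfolding \<phi>_def by measurable
  have inv: "\<phi> (\<phi> x) = x" for x
    using gf disj unfolding \<phi>_def B_eq by auto
  have \<phi>_space: "x \<in> space M \<Longrightarrow> \<phi> x \<in> space M" for x using measurable_space[OF \<phi>_meas] .
  have bij: "bij_betw \<phi> (space M) (space M)"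
    by (rule bij_betw_byWitness[of _ \<phi>]) (auto simp: inv \<phi>_space)
  have "inv_into (space M) \<phi> x = \<phi> x" if "x \<in> space M" for x
    using that bij by (metis bij_betw_inv_into_left inv \<phi>_space)
  then have "inv_into (space M) \<phi> \<in> M \<rightarrow>\<^sub>M M"
    using \<phi>_meas by (subst measurable_cong[of M _ \<phi>]) auto
  moreover have "(x, \<phi> x) \<in> R" if "x \<in> space M" for x
    using that fR gf R_refl R_sym unfolding \<phi>_def B_eq by auto
  ultimately have "\<phi> \<in> full_group"
    unfolding full_group_def borel_automorphism_def using \<phi>_meas bij by blast
  then show thesis by (rule that) (simp add: \<phi>_def)
qed

end

text \<open>
  Finiteness of the classes of \<open>Rn n\<close> is what makes selections suffice: each point of a finite set
  is isolated by one of countably many sets, so it is found by selecting inside that set.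
\<close>

locale hyperfinite_pmp_relation = pmp_relation +
  fixes X0 and Rn :: "nat \<Rightarrow> ('a \<times> 'a) set"
  assumes X0[measurable]: "X0 \<in> sets M" and X0_conull: "emeasure M (space M - X0) = 0"
    and Rn_sets[measurable]: "\<And>n. Rn n \<in> sets (M \<Otimes>\<^sub>M M)"
    and Rn_finite: "\<And>n x. x \<in> X0 \<Longrightarrow> finite (Rn n `` {x})"
    and Rn_Un: "(\<Union>n. Rn n) = R \<inter> X0 \<times> X0"
begin

definition AE_covers :: "'a measure \<Rightarrow> (nat \<Rightarrow> 'a \<Rightarrow> 'a) \<Rightarrow> bool" where
  "AE_covers L h \<longleftrightarrow> (\<forall>i. h i \<in> M \<rightarrow>\<^sub>M M) \<and> (\<forall>i. \<forall>x\<in>space M. (x, h i x) \<in> R) \<and>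
    (AE x in L. \<forall>y. (x, y) \<in> R \<inter> X0 \<times> X0 \<longrightarrow> (\<exists>i. h i x = y))"

lemma AE_cover_by_functions:
  assumes "finite_measure L" and sets: "sets L = sets M"
  shows "\<exists>h. AE_covers L h"
proof -
  obtain U :: "nat \<Rightarrow> 'a set" where U[measurable]: "\<And>k. U k \<in> sets M"
    and sep: "\<And>F x. finite F \<Longrightarrow> x \<in> space M - F \<Longrightarrow> F \<subseteq> space M \<Longrightarrow> \<exists>k. x \<in> U k \<and> U k \<inter> F = {}"
    using standard_borel_separating_sets[OF standard] by metis
  define selects where "selects n k f \<longleftrightarrow> f \<in> M \<rightarrow>\<^sub>M M \<and>
    (AE x in L. \<forall>y. (x, y) \<in> Rn n \<inter> space M \<times> U k \<longrightarrow> (x, f x) \<in> Rn n \<inter> space M \<times> U k)" for n k f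
  have "\<exists>f. selects n k f" for n k
  proof -
    have "Rn n \<inter> space M \<times> U k \<in> sets (M \<Otimes>\<^sub>M M)" by measurable
    also have "\<dots> = sets (L \<Otimes>\<^sub>M M)" by (rule sets_pair_measure_cong) (auto simp: sets)
    finally have F: "Rn n \<inter> space M \<times> U k \<in> sets (L \<Otimes>\<^sub>M M)" .
    obtain f where "f \<in> L \<rightarrow>\<^sub>M M" "AE x in L. \<forall>y. (x, y) \<in> Rn n \<inter> space M \<times> U k
        \<longrightarrow> (x, f x) \<in> Rn n \<inter> space M \<times> U k"
      using AE_measurable_selection[OF assms(1) standard not_empty F] by blast
    moreover have "(L \<rightarrow>\<^sub>M M) = (M \<rightarrow>\<^sub>M M)" by (rule measurable_cong_sets[OF sets refl])
    ultimately show ?thesis unfolding selects_def by blast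
  qed
  then obtain f where "\<And>n k. selects n k (f n k)" by metis
  then have f[measurable]: "\<And>n k. f n k \<in> M \<rightarrow>\<^sub>M M"
    and sel: "\<And>n k. AE x in L. \<forall>y. (x, y) \<in> Rn n \<inter> space M \<times> U k \<longrightarrow> (x, f n k x) \<in> Rn n \<inter> space M \<times> U k"
    unfolding selects_def by blast+
  define h where "h i x = (case prod_decode i of (n, k) \<Rightarrow> if (x, f n k x) \<in> R then f n k x else x)" for i x
  have "h i \<in> M \<rightarrow>\<^sub>M M" for i
    unfolding h_def by (cases "prod_decode i") (simp, measurable)
  moreover have "(x, h i x) \<in> R" if "x \<in> space M" for i x
    unfolding h_def using R_refl[OF that] by (auto split: prod.split)
  moreover have "AE x in L. \<forall>n k. \<forall>y. (x, y) \<in> Rn n \<inter> space M \<times> U k \<longrightarrow> (x, f n k x) \<in> Rn n \<inter> space M \<times> U k"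
    using sel by (simp add: AE_all_countable)
  then have "AE x in L. \<forall>y. (x, y) \<in> R \<inter> X0 \<times> X0 \<longrightarrow> (\<exists>i. h i x = y)"
  proof eventually_elim
    case (elim x)
    show ?case
    proof (intro allI impI)
      fix y assume xy: "(x, y) \<in> R \<inter> X0 \<times> X0"
      then obtain n where n: "(x, y) \<in> Rn n" using Rn_Un by blast
      have Rsub: "Rn n \<subseteq> R" using Rn_Un by blast
      let ?F = "Rn n `` {x} - {y}"
      have "finite ?F" using Rn_finite xy by auto
      moreover have "?F \<subseteq> space M" using Rsub R_space by blast
      moreover have "y \<in> space M - ?F" using xy R_space by blast
      ultimately obtain k where k: "y \<in> U k" "U k \<inter> ?F = {}" using sep by blast
      have "(x, y) \<in> Rn n \<inter> space M \<times> U k" using n k xy R_space by blast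
      then have s: "(x, f n k x) \<in> Rn n \<inter> space M \<times> U k" using elim by blast
      then have "f n k x = y" using k by blast
      then have "h (prod_encode (n, k)) x = y" using s Rsub by (auto simp: h_def)
      then show "\<exists>i. h i x = y" by blast
    qed
  qed
  ultimately show ?thesis unfolding AE_covers_def by blast
qed

text \<open>
  A single application of the previous lemma to \<open>M\<close> covers the class from almost every point, but
  another point of the class could lie in the exceptional null set. Applying the lemma again to
  the images of \<open>M\<close> under the functions \<open>f i\<close> covers the class from each of its points.
\<close>

lemma AE_orbit_cover_by_functions:
  obtains h :: "nat \<Rightarrow> 'a \<Rightarrow> 'a" where "\<And>i. h i \<in> M \<rightarrow>\<^sub>M M" "\<And>i x. x \<in> space M \<Longrightarrow> (x, h i x) \<in> R"
    "AE x in M. \<forall>y z. (x, y) \<in> R \<inter> X0 \<times> X0 \<longrightarrow> (y, z) \<in> R \<inter> X0 \<times> X0 \<longrightarrow> (\<exists>i. h i y = z)"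
proof -
  obtain f where "AE_covers M f"
    using AE_cover_by_functions[OF finite_measure_axioms refl] by blast
  then have f[measurable]: "\<And>i. f i \<in> M \<rightarrow>\<^sub>M M"
    and fAE: "AE x in M. \<forall>y. (x, y) \<in> R \<inter> X0 \<times> X0 \<longrightarrow> (\<exists>i. f i x = y)"
    unfolding AE_covers_def by auto
  have fin: "finite_measure (distr M M (f i))" for i by (intro finite_measure_distr f)
  have "\<forall>i. \<exists>h. AE_covers (distr M M (f i)) h"
    by (intro allI AE_cover_by_functions fin) simp
  then obtain h where "\<And>i. AE_covers (distr M M (f i)) (h i)" by metis
  then have h: "\<And>i j. h i j \<in> M \<rightarrow>\<^sub>M M" "\<And>i j x. x \<in> space M \<Longrightarrow> (x, h i j x) \<in> R"
    and hAE: "\<And>i. AE x in distr M M (f i). \<forall>y. (x, y) \<in> R \<inter> X0 \<times> X0 \<longrightarrow> (\<exists>j. h i j x = y)"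
    unfolding AE_covers_def by blast+
  have "AE x in M. \<forall>y. (f i x, y) \<in> R \<inter> X0 \<times> X0 \<longrightarrow> (\<exists>j. h i j (f i x) = y)" for i
    using AE_distrD[OF f hAE] .
  then have "AE x in M. \<forall>i y. (f i x, y) \<in> R \<inter> X0 \<times> X0 \<longrightarrow> (\<exists>j. h i j (f i x) = y)"
    by (simp add: AE_all_countable)
  with fAE have AE: "AE x in M. \<forall>y z. (x, y) \<in> R \<inter> X0 \<times> X0 \<longrightarrow> (y, z) \<in> R \<inter> X0 \<times> X0 \<longrightarrow> (\<exists>i j. h i j y = z)"
    by eventually_elim metis
  show thesis
  proof (rule that[of "\<lambda>m. h (fst (prod_decode m)) (snd (prod_decode m))"])
    show "AE x in M. \<forall>y z. (x, y) \<in> R \<inter> X0 \<times> X0 \<longrightarrow> (y, z) \<in> R \<inter> X0 \<times> X0 \<longrightarrow>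
        (\<exists>i. h (fst (prod_decode i)) (snd (prod_decode i)) y = z)"
      using AE by eventually_elim (metis fst_conv snd_conv prod_encode_inverse)
  qed (use h in auto)
qed

text \<open>
  If \<open>h i\<close> takes \<open>y\<close> to \<open>z\<close> and \<open>h j\<close> takes \<open>z\<close> back to \<open>y\<close>, then \<open>h i\<close> is a Borel bijection near
  \<open>y\<close>; cutting down by a set that contains \<open>y\<close> but not \<open>z\<close> makes domain and range disjoint, so
  that they can be swapped.
\<close>

lemma AE_cover_by_full_group_within:
  obtains \<phi> :: "nat \<Rightarrow> 'a \<Rightarrow> 'a" where "\<And>m. \<phi> m \<in> full_group"
    "AE x in M. \<forall>y z. (x, y) \<in> R \<inter> X0 \<times> X0 \<longrightarrow> (y, z) \<in> R \<inter> X0 \<times> X0 \<longrightarrow> (\<exists>m. \<phi> m y = z)"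
proof -
  obtain h :: "nat \<Rightarrow> 'a \<Rightarrow> 'a" where h[measurable]: "\<And>i. h i \<in> M \<rightarrow>\<^sub>M M"
    and hR: "\<And>i x. x \<in> space M \<Longrightarrow> (x, h i x) \<in> R"
    and hAE: "AE x in M. \<forall>y z. (x, y) \<in> R \<inter> X0 \<times> X0 \<longrightarrow> (y, z) \<in> R \<inter> X0 \<times> X0 \<longrightarrow> (\<exists>i. h i y = z)"
  proof (rule AE_orbit_cover_by_functions, goal_cases)
    case (1 h)
    show ?case by (rule 1(1)[OF 1(2-4)])
  qed
  obtain U :: "nat \<Rightarrow> 'a set" where U[measurable]: "\<And>k. U k \<in> sets M"
    and sep: "\<And>F x. finite F \<Longrightarrow> x \<in> space M - F \<Longrightarrow> F \<subseteq> space M \<Longrightarrow> \<exists>k. x \<in> U k \<and> U k \<inter> F = {}"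
    using standard_borel_separating_sets[OF standard] by metis
  define A where "A i j k = {x \<in> space M. x \<in> U k \<and> h i x \<notin> U k \<and> h j (h i x) = x}" for i j k
  have "\<exists>\<phi>. \<phi> \<in> full_group \<and> (\<forall>x\<in>A i j k. \<phi> x = h i x)" for i j k
  proof -
    have "A i j k \<in> sets M"
    proof -
      have "{x \<in> space M. h j (h i x) = x} \<in> sets M" by (rule sets_equaliser[OF standard]) measurable
      moreover have "A i j k = {x \<in> space M. x \<in> U k \<and> h i x \<notin> U k} \<inter> {x \<in> space M. h j (h i x) = x}"
        unfolding A_def by auto
      ultimately show ?thesis by simp
    qed
    note A = this
    obtain \<phi> where "\<phi> \<in> full_group" "\<And>x. x \<in> A i j k \<Longrightarrow> \<phi> x = h i x"
    proof (rule swap_partial_isomorphism[OF A h[of i] h[of j]], goal_cases)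
      case (4 \<phi>) show ?case by (rule 4(1)[OF 4(2,3)])
    qed (auto simp: A_def hR)
    then show ?thesis by blast
  qed
  then obtain \<phi> where \<phi>: "\<And>i j k. \<phi> i j k \<in> full_group" "\<And>i j k x. x \<in> A i j k \<Longrightarrow> \<phi> i j k x = h i x"
    by metis
  have id: "(\<lambda>x. x) \<in> full_group"
  proof -
    have "bij_betw (\<lambda>x. x) (space M) (space M)" by (simp add: bij_betw_def)
    moreover have "inv_into (space M) (\<lambda>x. x) \<in> M \<rightarrow>\<^sub>M M"
      by (subst measurable_cong[of M _ "\<lambda>x. x"]) (auto intro!: inv_into_f_eq)
    ultimately show ?thesis unfolding full_group_def borel_automorphism_def using R_refl by auto
  qed
  define \<psi> where "\<psi> m = (case prod_decode m of (i, l) \<Rightarrow> case prod_decode l of (j, k) \<Rightarrow>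
      if k = 0 then (\<lambda>x. x) else \<phi> i j (k - 1))" for m
  have \<psi>1: "\<psi> m \<in> full_group" for m unfolding \<psi>_def using \<phi>(1) id by (auto split: prod.split)
  have \<psi>2: "\<exists>m. \<psi> m = \<phi> i j k" for i j k
    by (rule exI[of _ "prod_encode (i, prod_encode (j, Suc k))"]) (simp add: \<psi>_def)
  have \<psi>3: "\<exists>m. \<psi> m = (\<lambda>x. x)"
    by (rule exI[of _ "prod_encode (0, prod_encode (0, 0))"]) (simp add: \<psi>_def)
  have "AE x in M. \<forall>y z. (x, y) \<in> R \<inter> X0 \<times> X0 \<longrightarrow> (y, z) \<in> R \<inter> X0 \<times> X0 \<longrightarrow> (\<exists>m. \<psi> m y = z)"
    using hAE
  proof eventually_elim
    case (elim x)
    show ?case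
    proof (intro allI impI)
      fix y z assume xy: "(x, y) \<in> R \<inter> X0 \<times> X0" and yz: "(y, z) \<in> R \<inter> X0 \<times> X0"
      show "\<exists>m. \<psi> m y = z"
      proof (cases "y = z")
        case True then show ?thesis using \<psi>3 by metis
      next
        case False
        have xz: "(x, z) \<in> R \<inter> X0 \<times> X0" "(z, y) \<in> R \<inter> X0 \<times> X0" using xy yz R_trans R_sym by blast+
        obtain i where i: "h i y = z" using elim xy yz by blast
        obtain j where j: "h j z = y" using elim xz by blast
        have "y \<in> space M" "z \<in> space M" using yz R_space by auto
        then obtain k where k: "y \<in> U k" "z \<notin> U k" using sep[of "{z}" y] False by auto
        have "y \<in> A i j k" unfolding A_def using i j k \<open>y \<in> space M\<close> by simp
        then have "\<phi> i j k y = z" using \<phi>(2) i by simp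
        then show ?thesis using \<psi>2 by metis
      qed
    qed
  qed
  with \<psi>1 show thesis by (rule that)
qed

text \<open>
  Otherwise some positive amount of \<open>X0\<close> is related to the null complement of \<open>X0\<close>. Select \<open>f\<close>
  from there into the complement and \<open>g\<close> back. Each fibre of \<open>f\<close> lies in one class, so the
  automorphisms \<open>\<phi> m\<close> enumerate it starting from the point chosen by \<open>g\<close>; the points with a given
  number \<open>m\<close> form a set on which \<open>f\<close> is injective, and swapping this set with its image in the
  complement shows that it is null.
\<close>

lemma AE_class_within: "AE x in M. R `` {x} \<subseteq> X0"
proof -
  obtain \<phi> :: "nat \<Rightarrow> 'a \<Rightarrow> 'a" where \<phi>: "\<And>m. \<phi> m \<in> full_group"
    and AE: "AE x in M. \<forall>y z. (x, y) \<in> R \<inter> X0 \<times> X0 \<longrightarrow> (y, z) \<in> R \<inter> X0 \<times> X0 \<longrightarrow> (\<exists>m. \<phi> m y = z)"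
  proof (rule AE_cover_by_full_group_within, goal_cases)
    case (1 \<phi>)
    show ?case by (rule 1(1)[OF 1(2,3)])
  qed
  note [measurable] = full_groupD(1)[OF \<phi>]
  obtain N where N: "N \<in> null_sets M"
    "{x \<in> space M. \<not> (\<forall>y z. (x, y) \<in> R \<inter> X0 \<times> X0 \<longrightarrow> (y, z) \<in> R \<inter> X0 \<times> X0 \<longrightarrow> (\<exists>m. \<phi> m y = z))} \<subseteq> N"
    using AE by (auto simp: eventually_ae_filter)
  have [measurable]: "N \<in> sets M" using N(1) by auto
  have cover: "\<exists>m. \<phi> m x = y" if "x \<in> X0 - N" "y \<in> X0" "(x, y) \<in> R" for x y
  proof -
    have "x \<in> space M" using that R_space by blast
    then show ?thesis using N(2) that R_refl by blast
  qed
  define F where "F = R \<inter> (X0 - N) \<times> (space M - X0)"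
  have F[measurable]: "F \<in> sets (M \<Otimes>\<^sub>M M)" unfolding F_def by measurable
  obtain f where f[measurable]: "f \<in> M \<rightarrow>\<^sub>M M" and fAE: "AE x in M. \<forall>y. (x, y) \<in> F \<longrightarrow> (x, f x) \<in> F"
    using AE_measurable_selection[OF finite_measure_axioms standard not_empty F] by blast
  define A where "A = {x \<in> space M. (x, f x) \<in> F}"
  have A[measurable]: "A \<in> sets M" unfolding A_def by measurable
  \<comment> \<open>the inverse relation of \<open>f\<close>, selected from with respect to the image measure of \<open>f\<close>\<close>
  define G where "G = {(z, x). z \<in> space M \<and> x \<in> A \<and> f x = z}"
  have "G \<in> sets (M \<Otimes>\<^sub>M M)"
  proof -
    have "{w \<in> space (M \<Otimes>\<^sub>M M). f (snd w) = fst w} \<in> sets (M \<Otimes>\<^sub>M M)"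
      by (rule sets_equaliser[OF standard]) measurable
    moreover have "G = {w \<in> space (M \<Otimes>\<^sub>M M). snd w \<in> A} \<inter> {w \<in> space (M \<Otimes>\<^sub>M M). f (snd w) = fst w}"
      using sets.sets_into_space[OF A] unfolding G_def by (auto simp: space_pair_measure)
    moreover have "{w \<in> space (M \<Otimes>\<^sub>M M). snd w \<in> A} \<in> sets (M \<Otimes>\<^sub>M M)" by measurable
    ultimately show ?thesis by simp
  qed
  also have "sets (M \<Otimes>\<^sub>M M) = sets (distr M M f \<Otimes>\<^sub>M M)" by (rule sets_pair_measure_cong) auto
  finally have G: "G \<in> sets (distr M M f \<Otimes>\<^sub>M M)" .
  have "finite_measure (distr M M f)" by (intro finite_measure_distr f)
  from AE_measurable_selection[OF this standard not_empty G]
  obtain g where g[measurable]: "g \<in> M \<rightarrow>\<^sub>M M"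
    and gAE: "AE z in distr M M f. \<forall>x. (z, x) \<in> G \<longrightarrow> (z, g z) \<in> G"
    by (auto simp: measurable_distr_eq1)
  have gAE: "AE x in M. \<forall>y. (f x, y) \<in> G \<longrightarrow> (f x, g (f x)) \<in> G"
    using AE_distrD[OF f gAE] .
  define B where "B m = {x \<in> A. g (f x) \<in> A \<and> f (g (f x)) = f x \<and> \<phi> m (g (f x)) = x}" for m
  have B[measurable]: "B m \<in> sets M" for m
  proof -
    have "{x \<in> space M. f (g (f x)) = f x} \<in> sets M" "{x \<in> space M. \<phi> m (g (f x)) = x} \<in> sets M"
      by (rule sets_equaliser[OF standard]; measurable)+
    moreover have "B m = {x \<in> space M. x \<in> A \<and> g (f x) \<in> A} \<inter> {x \<in> space M. f (g (f x))
        = f x} \<inter> {x \<in> space M. \<phi> m (g (f x)) = x}"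
      using sets.sets_into_space[OF A] unfolding B_def by auto
    moreover have "{x \<in> space M. x \<in> A \<and> g (f x) \<in> A} \<in> sets M" by measurable
    ultimately show ?thesis by simp
  qed
  have AF: "x \<in> X0 - N \<and> f x \<in> space M - X0 \<and> (x, f x) \<in> R" if "x \<in> A" for x
    using that unfolding A_def F_def by auto
  have "emeasure M (B m) = 0" for m
  proof -
    have \<phi>g: "(\<lambda>z. \<phi> m (g z)) \<in> M \<rightarrow>\<^sub>M M" by measurable
    obtain \<psi> where \<psi>: "\<psi> \<in> full_group" "\<And>x. x \<in> B m \<Longrightarrow> \<psi> x = f x"
    proof (rule swap_partial_isomorphism[OF B[of m] f \<phi>g], goal_cases)
      case (4 \<psi>) show ?case by (rule 4(1)[OF 4(2,3)])
    qed (use AF in \<open>auto simp: B_def\<close>)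
    have "emeasure M (B m) = emeasure M (\<psi> ` B m)" using full_group_image(2)[OF \<psi>(1) B] by simp
    also have "\<dots> \<le> emeasure M (space M - X0)"
      using \<psi>(2) AF unfolding B_def by (intro emeasure_mono) auto
    finally show ?thesis using X0_conull by simp
  qed
  then have "AE x in M. x \<notin> B m" for m by (intro AE_not_in) (simp add: null_sets_def)
  then have BAE: "AE x in M. \<forall>m. x \<notin> B m" by (simp add: AE_all_countable)
  have "space M - X0 \<in> null_sets M" using X0_conull by (simp add: null_sets_def)
  then have XAE: "AE x in M. x \<notin> space M - X0" "AE x in M. x \<notin> N"
    using N(1) by (simp_all only: AE_not_in)
  show ?thesis
    using BAE XAE fAE gAE AE_space
  proof eventually_elim
    case (elim x)
    show ?case
    proof (rule ccontr)
      assume "\<not> ?thesis"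
      then obtain y where "(x, y) \<in> R" "y \<notin> X0" by blast
      then have "(x, y) \<in> F" using elim R_space unfolding F_def by blast
      then have "x \<in> A" using elim unfolding A_def by blast
      then have "(f x, x) \<in> G" using measurable_space[OF f] elim unfolding G_def by blast
      then have "(f x, g (f x)) \<in> G" using elim by blast
      then have gx: "g (f x) \<in> A" "f (g (f x)) = f x" unfolding G_def by auto
      have "(g (f x), x) \<in> R" using AF[OF \<open>x \<in> A\<close>] AF[OF gx(1)] gx(2) R_sym R_trans by metis
      then obtain m where "\<phi> m (g (f x)) = x" using cover AF[OF gx(1)] AF[OF \<open>x \<in> A\<close>] by blast
      then have "x \<in> B m" unfolding B_def using \<open>x \<in> A\<close> gx by blast
      then show False using elim by blast
    qed
  qed
qed

theorem AE_cover_by_full_group: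
  obtains \<phi> :: "nat \<Rightarrow> 'a \<Rightarrow> 'a" where "\<And>m. \<phi> m \<in> full_group" "AE x in M. \<forall>y. (x, y) \<in> R \<longrightarrow> (\<exists>m. \<phi> m x = y)"
proof -
  obtain \<phi> :: "nat \<Rightarrow> 'a \<Rightarrow> 'a" where \<phi>: "\<And>m. \<phi> m \<in> full_group"
    and AE: "AE x in M. \<forall>y z. (x, y) \<in> R \<inter> X0 \<times> X0 \<longrightarrow> (y, z) \<in> R \<inter> X0 \<times> X0 \<longrightarrow> (\<exists>m. \<phi> m y = z)"
  proof (rule AE_cover_by_full_group_within, goal_cases)
    case (1 \<phi>)
    show ?case by (rule 1(1)[OF 1(2,3)])
  qed
  have "AE x in M. \<forall>y. (x, y) \<in> R \<longrightarrow> (\<exists>m. \<phi> m x = y)"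
    using AE AE_class_within AE_space by eventually_elim (use R_refl in blast)
  with \<phi> show thesis by (rule that)
qed

end


section \<open>Mass transport\<close>

locale orbit_enumeration = pmp_relation +
  fixes \<phi> :: "nat \<Rightarrow> 'a \<Rightarrow> 'a"
  assumes \<phi>: "\<And>m. \<phi> m \<in> full_group"
    and \<phi>_AE: "AE x in M. \<forall>y. (x, y) \<in> R \<longrightarrow> (\<exists>m. \<phi> m x = y)"
begin

lemmas \<phi>_measurable[measurable] = full_groupD(1)[OF \<phi>]

text \<open>
  Each automorphism preserves null sets, and countably many of them fill almost every class.
\<close>

lemma AE_class:
  assumes "AE x in M. P x"
  shows "AE x in M. \<forall>y. (x, y) \<in> R \<longrightarrow> P y"
proof -
  have "AE x in M. P (\<phi> m x)" for m
    using assms by (intro AE_distrD[OF \<phi>_measurable]) (subst full_groupD(2)[OF \<phi>])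
  then have "AE x in M. \<forall>m. P (\<phi> m x)" by (simp add: AE_all_countable)
  then show ?thesis using \<phi>_AE by eventually_elim metis
qed

lemma AE_class2:
  assumes "AE x in M. \<forall>y. (x, y) \<in> R \<longrightarrow> P x y"
  shows "AE x in M. \<forall>y z. (x, y) \<in> R \<longrightarrow> (x, z) \<in> R \<longrightarrow> P y z"
  using AE_class[OF assms] by eventually_elim (use R_sym R_trans in blast)

text \<open>
  The counting function in \<open>rel_measure\<close> need not be measurable, but it dominates the indicators
  of the measurable sets \<open>{x. (x, \<phi> m x) \<in> N}\<close>, and these determine the exceptional set.
\<close>

lemma rel_ae_imp_AE:
  assumes "rel_ae M R P"
  shows "AE x in M. \<forall>y. (x, y) \<in> R \<longrightarrow> P x y"
proof -
  obtain N where N: "N \<in> sets (M \<Otimes>\<^sub>M M)" "rel_measure M N = 0"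
    "\<And>x y. (x, y) \<in> R - N \<Longrightarrow> P x y"
    using assms unfolding rel_ae_def by blast
  note [measurable] = N(1)
  have "AE x in M. (x, \<phi> m x) \<notin> N" for m
  proof -
    let ?A = "{x \<in> space M. (x, \<phi> m x) \<in> N}"
    have A: "?A \<in> sets M" by measurable
    have "emeasure M ?A = (\<integral>\<^sup>+ x. indicator ?A x \<partial>M)" using A by simp
    also have "\<dots> \<le> rel_measure M N"
      unfolding rel_measure_def
    proof (rule nn_integral_mono)
      fix x assume "x \<in> space M"
      show "indicator ?A x \<le> emeasure (count_space UNIV) {y. (x, y) \<in> N}"
      proof (cases "(x, \<phi> m x) \<in> N")
        case True
        have "emeasure (count_space UNIV) {\<phi> m x} \<le> emeasure (count_space UNIV) {y. (x, y) \<in> N}"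
          using True by (intro emeasure_mono) auto
        then show ?thesis by (auto simp: indicator_def)
      qed (simp add: indicator_def)
    qed
    finally have "?A \<in> null_sets M" using A N(2) by (simp add: null_sets_def)
    from AE_not_in[OF this] AE_space show ?thesis by eventually_elim auto
  qed
  then have "AE x in M. \<forall>m. (x, \<phi> m x) \<notin> N" by (simp add: AE_all_countable)
  then show ?thesis using \<phi>_AE by eventually_elim (metis Diff_iff N(3))
qed

text \<open>
  The mass received by almost every \<open>w\<close> is the number of indices \<open>m\<close> with \<open>w \<in> E m\<close>. The sets
  \<open>\<phi> m ` E m\<close> consist of the points that send their mass along \<open>\<phi> m\<close>; they are disjoint and have
  the measures of the sets \<open>E m\<close>, which are therefore summable, and the Borel--Cantelli lemma
  applies.
\<close>

theorem AE_finite_fibres: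
  assumes t[measurable]: "t \<in> M \<rightarrow>\<^sub>M M"
  shows "AE w in M. finite {y. (w, y) \<in> R \<and> t y = w}"
proof -
  \<comment> \<open>minimality of \<open>m\<close> avoids counting a point twice that is reached by several automorphisms\<close>
  define E where "E m = {w \<in> space M. t (\<phi> m w) = w \<and> (\<forall>j<m. \<phi> j w \<noteq> \<phi> m w)}" for m
  have E[measurable]: "E m \<in> sets M" for m
  proof -
    have [measurable]: "Measurable.pred M (\<lambda>w. t (\<phi> m w) = w)" "\<And>j. Measurable.pred M (\<lambda>w. \<phi> j w = \<phi> m w)"
      by (rule equaliser_pred; measurable)+
    show ?thesis unfolding E_def by measurable
  qed
  have disj: "disjoint_family (\<lambda>m. \<phi> m ` E m)"
    unfolding disjoint_family_on_def
  proof (intro ballI impI equals0I)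
    fix m n y assume "m \<noteq> n" "y \<in> \<phi> m ` E m \<inter> \<phi> n ` E n"
    then obtain w w' where w: "w \<in> E m" "y = \<phi> m w" "w' \<in> E n" "y = \<phi> n w'" by blast
    then have "w = w'" unfolding E_def by auto
    then show False using w \<open>m \<noteq> n\<close> unfolding E_def
        by (metis (mono_tags, lifting) linorder_neqE_nat mem_Collect_eq)
  qed
  have "summable (\<lambda>m. measure M (\<phi> m ` E m))"
    using finite_measure_UNION[OF _ disj] full_group_image(1)[OF \<phi> E] by (auto simp: sums_iff)
  moreover have "measure M (\<phi> m ` E m) = measure M (E m)" for m
    using full_group_image(2)[OF \<phi> E] by (simp add: measure_def)
  ultimately have "AE w in M. eventually (\<lambda>m. w \<in> space M - E m) sequentially"
    by (intro borel_cantelli_AE1) (auto simp: less_top[symmetric])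
  then show ?thesis using \<phi>_AE AE_space
  proof eventually_elim
    case (elim w)
    have "finite {m. w \<in> E m}"
    proof -
      obtain N where "\<And>m. m \<ge> N \<Longrightarrow> w \<notin> E m" using elim(1) unfolding eventually_sequentially by blast
      then have "{m. w \<in> E m} \<subseteq> {..<N}" by (force simp: not_le[symmetric])
      then show ?thesis by (rule finite_subset) simp
    qed
    moreover have "{y. (w, y) \<in> R \<and> t y = w} \<subseteq> (\<lambda>m. \<phi> m w) ` {m. w \<in> E m}"
    proof
      fix y assume y: "y \<in> {y. (w, y) \<in> R \<and> t y = w}"
      then have ex: "\<exists>m. \<phi> m w = y" using elim(2) by blast
      define m where "m = (LEAST m. \<phi> m w = y)"
      have m: "\<phi> m w = y" unfolding m_def using ex by (rule LeastI_ex)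
      have "\<phi> j w \<noteq> y" if "j < m" for j using not_less_Least[of j "\<lambda>m. \<phi> m w = y"] that unfolding m_def
          by blast
      then have "w \<in> E m" unfolding E_def using m y elim(3) by auto
      then show "y \<in> (\<lambda>m. \<phi> m w) ` {m. w \<in> E m}" using m by blast
    qed
    ultimately show ?case by (rule finite_surj)
  qed
qed

end


section \<open>Gromov products and the Gromov boundary\<close>

lemma ereal_less_of_le: "ereal s \<le> x \<Longrightarrow> t < s \<Longrightarrow> ereal t < x"
  using order.strict_trans2[of "ereal t" "ereal s" x] by simp

locale hyperbolic_space = Metric_space S d for S :: "'b set" and d +
  fixes \<delta> :: real
  assumes \<delta>_nonneg: "0 \<le> \<delta>"
    and hyp: "\<And>x y z w. x \<in> S \<Longrightarrow> y \<in> S \<Longrightarrow> z \<in> S \<Longrightarrow> w \<in> S \<Longrightarrow>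
      gromov_product d z x y \<ge> min (gromov_product d z x w) (gromov_product d z w y) - \<delta>"
begin

abbreviation "gp \<equiv> gromov_product d"
abbreviation "ext \<equiv> ext_gromov_product d"
abbreviation "bdry \<equiv> gromov_boundary S d"
abbreviation "compl \<equiv> gromov_completion S d"

lemma gp_commute: "gp z x y = gp z y x"
  by (simp add: gromov_product_def commute)

lemma gp_nonneg: "x \<in> S \<Longrightarrow> y \<in> S \<Longrightarrow> z \<in> S \<Longrightarrow> 0 \<le> gp z x y"
  using triangle'[of x z y] by (simp add: gromov_product_def)

lemma gp_le: "x \<in> S \<Longrightarrow> y \<in> S \<Longrightarrow> z \<in> S \<Longrightarrow> gp z x y \<le> d x z"
  using triangle[of y x z] by (simp add: gromov_product_def commute)

lemma gp_Lipschitz: "x \<in> S \<Longrightarrow> x' \<in> S \<Longrightarrow> y \<in> S \<Longrightarrow> z \<in> S \<Longrightarrow> gp z x y \<le> gp z x' y + d x x'"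
  using triangle[of x x' z] triangle[of x' x y] by (simp add: gromov_product_def commute field_simps)

lemma gp_base_change: "x \<in> S \<Longrightarrow> y \<in> S \<Longrightarrow> z \<in> S \<Longrightarrow> z' \<in> S \<Longrightarrow> gp z x y \<le> gp z' x y + d z z'"
  using triangle[of x z' z] triangle[of y z' z] by (simp add: gromov_product_def commute field_simps)

lemma hyp_less:
  assumes "x \<in> S" "y \<in> S" "z \<in> S" "w \<in> S" "t < gp z x w" "t < gp z w y"
  shows "t - \<delta> < gp z x y"
  using hyp[OF assms(1-4)] assms(5,6) by linarith

lemma diverge_together_iff:
  "diverge_together S d u v \<longleftrightarrow> (\<forall>z\<in>S. \<forall>t. \<exists>N. \<forall>i\<ge>N. \<forall>j\<ge>N. t < gp z (u i) (v j))"
  unfolding diverge_together_def filterlim_at_top_dense eventually_prod_sequentially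
  by (auto; blast)

lemma diverge_together_commute: "diverge_together S d u v \<Longrightarrow> diverge_together S d v u"
  unfolding diverge_together_iff by (metis gp_commute)

lemma diverge_together_trans:
  assumes "range u \<subseteq> S" "range v \<subseteq> S" "range w \<subseteq> S"
    and uv: "diverge_together S d u v" and vw: "diverge_together S d v w"
  shows "diverge_together S d u w"
  unfolding diverge_together_iff
proof (intro ballI allI)
  fix z t assume z: "z \<in> S"
  obtain N where N: "\<And>i j. i \<ge> N \<Longrightarrow> j \<ge> N \<Longrightarrow> t + \<delta> < gp z (u i) (v j)"
    using uv z unfolding diverge_together_iff by metis
  obtain N' where N': "\<And>i j. i \<ge> N' \<Longrightarrow> j \<ge> N' \<Longrightarrow> t + \<delta> < gp z (v i) (w j)"
    using vw z unfolding diverge_together_iff by metis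
  have "t < gp z (u i) (w j)" if "i \<ge> max N N'" "j \<ge> max N N'" for i j
  proof -
    have "t + \<delta> - \<delta> < gp z (u i) (w j)"
      by (rule hyp_less[where w = "v (max N N')"]) (use assms(1-3) z N N' that in auto)
    then show ?thesis by simp
  qed
  then show "\<exists>N. \<forall>i\<ge>N. \<forall>j\<ge>N. t < gp z (u i) (w j)" by blast
qed

lemma equiv_boundary_rel: "equiv (gromov_sequences S d) (boundary_rel S d)"
proof (rule equivI)
  show "boundary_rel S d \<subseteq> gromov_sequences S d \<times> gromov_sequences S d"
    by (auto simp: boundary_rel_def)
  show "refl_on (gromov_sequences S d) (boundary_rel S d)"
    by (auto simp: refl_on_def boundary_rel_def gromov_sequences_def)
  show "sym (boundary_rel S d)"
    by (auto simp: sym_def boundary_rel_def diverge_together_commute)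
  show "trans (boundary_rel S d)"
    by (rule transI) (auto simp: boundary_rel_def gromov_sequences_def intro: diverge_together_trans)
qed

lemma boundary_representatives:
  assumes "\<xi> \<in> bdry"
  shows "representatives \<xi> \<in> gromov_sequences S d // boundary_rel S d" "\<xi> = Inr (representatives \<xi>)"
  using assms by (auto simp: gromov_boundary_def)

lemma representatives_nonempty: "\<xi> \<in> compl \<Longrightarrow> representatives \<xi> \<noteq> {}"
  using in_quotient_imp_non_empty[OF equiv_boundary_rel]
  by (auto simp: gromov_completion_def gromov_boundary_def)

lemma representatives_in: "\<xi> \<in> compl \<Longrightarrow> u \<in> representatives \<xi> \<Longrightarrow> u i \<in> S"
  using in_quotient_imp_subset[OF equiv_boundary_rel]
  by (fastforce simp: gromov_completion_def gromov_boundary_def gromov_sequences_def)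

lemma boundary_in_completion: "\<xi> \<in> bdry \<Longrightarrow> \<xi> \<in> compl" "a \<in> S \<Longrightarrow> Inl a \<in> compl"
  by (auto simp: gromov_completion_def)

lemma boundary_representatives_diverge:
  assumes "\<xi> \<in> bdry" "u \<in> representatives \<xi>" "v \<in> representatives \<xi>"
  shows "diverge_together S d u v"
  using quotient_eq_iff[OF equiv_boundary_rel boundary_representatives(1)[OF assms(1)]
      boundary_representatives(1)[OF assms(1)] assms(2,3)] by (auto simp: boundary_rel_def)

lemma boundary_eqI:
  assumes "\<xi> \<in> bdry" "\<eta> \<in> bdry" "u \<in> representatives \<xi>" "v \<in> representatives \<eta>" "diverge_together S d u v"
  shows "\<xi> = \<eta>"
proof -
  have "u \<in> gromov_sequences S d" "v \<in> gromov_sequences S d"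
    using in_quotient_imp_subset[OF equiv_boundary_rel boundary_representatives(1)] assms by blast+
  then have "(u, v) \<in> boundary_rel S d" using assms(5) by (simp add: boundary_rel_def)
  then have "representatives \<xi> = representatives \<eta>"
    using quotient_eq_iff[OF equiv_boundary_rel boundary_representatives(1)[OF assms(1)]
      boundary_representatives(1)[OF assms(2)] assms(3,4)] by blast
  then show ?thesis using boundary_representatives(2)[OF assms(1)] boundary_representatives(2)[OF assms(2)]
      by simp
qed

text \<open>
  The extended product is only handled through this lemma and the next: it exceeds \<open>t\<close> essentially
  when the products of all representing sequences eventually do.
\<close>

lemma ext_lessD:
  assumes "ereal t < ext z \<xi> \<eta>" "u \<in> representatives \<xi>" "v \<in> representatives \<eta>"
  shows "\<exists>N. \<forall>i\<ge>N. \<forall>j\<ge>N. t < gp z (u i) (v j)"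
proof -
  let ?L = "Liminf (sequentially \<times>\<^sub>F sequentially) (\<lambda>(i, j). ereal (gp z (u i) (v j)))"
  have "ereal t < ?L"
    using less_INF_D[OF less_INF_D[OF assms(1)[unfolded ext_gromov_product_def] assms(2)] assms(3)] .
  then have "eventually (\<lambda>p. ereal t < (case p of (i, j) \<Rightarrow> ereal (gp z (u i) (v j)))) (sequentially \<times>\<^sub>F
      sequentially)"
    using le_Liminf_iff[of ?L] by blast
  then show ?thesis unfolding eventually_prod_sequentially by auto
qed

lemma le_extI:
  assumes "\<And>u v. u \<in> representatives \<xi> \<Longrightarrow> v \<in> representatives \<eta> \<Longrightarrow>
    \<exists>N. \<forall>i\<ge>N. \<forall>j\<ge>N. t \<le> gp z (u i) (v j)"
  shows "ereal t \<le> ext z \<xi> \<eta>"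
  unfolding ext_gromov_product_def
proof (intro INF_greatest Liminf_bounded)
  fix u v assume "u \<in> representatives \<xi>" "v \<in> representatives \<eta>"
  then obtain N where "\<forall>i\<ge>N. \<forall>j\<ge>N. t \<le> gp z (u i) (v j)" using assms by blast
  then show "eventually (\<lambda>p. ereal t \<le> (case p of (i, j) \<Rightarrow> ereal (gp z (u i) (v j)))) (sequentially \<times>\<^sub>F
      sequentially)"
    unfolding eventually_prod_sequentially by (intro exI[of _ N]) auto
qed

lemma ext_less_cases:
  assumes "\<And>t. ereal t < a \<Longrightarrow> ereal t \<le> b" shows "a \<le> b"
proof (rule dense_le)
  fix x assume "x < a" then show "x \<le> b" using assms by (cases x) auto
qed

lemma ext_commute: "ext z \<xi> \<eta> = ext z \<eta> \<xi>"
proof -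
  have "ext z \<xi> \<eta> \<le> ext z \<eta> \<xi>" for \<xi> \<eta>
  proof (rule ext_less_cases)
    fix t assume t: "ereal t < ext z \<xi> \<eta>"
    show "ereal t \<le> ext z \<eta> \<xi>"
    proof (rule le_extI)
      fix u v assume "u \<in> representatives \<eta>" "v \<in> representatives \<xi>"
      then obtain N where "\<forall>i\<ge>N. \<forall>j\<ge>N. t < gp z (v i) (u j)" using ext_lessD[OF t] by blast
      then show "\<exists>N. \<forall>i\<ge>N. \<forall>j\<ge>N. t \<le> gp z (u i) (v j)" by (metis gp_commute less_imp_le)
    qed
  qed
  then show ?thesis by (simp add: antisym)
qed

lemma ext_Inl_Inl [simp]: "ext z (Inl a) (Inl b) = ereal (gp z a b)"
  by (simp add: ext_gromov_product_def Liminf_const prod_filter_eq_bot)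

text \<open>
  The extension takes an infimum over representatives, so lower bounds on extended products obey
  the hyperbolic inequality with the same constant.
\<close>

lemma ext_hyp:
  assumes "\<xi> \<in> compl" "\<eta> \<in> compl" "\<zeta> \<in> compl" "z \<in> S" "ereal t < ext z \<xi> \<eta>" "ereal t < ext z \<eta> \<zeta>"
  shows "ereal (t - \<delta>) \<le> ext z \<xi> \<zeta>"
proof (rule le_extI)
  fix u w assume uw: "u \<in> representatives \<xi>" "w \<in> representatives \<zeta>"
  obtain v where v: "v \<in> representatives \<eta>" using representatives_nonempty[OF assms(2)] by blast
  obtain N where N: "\<And>i j. i \<ge> N \<Longrightarrow> j \<ge> N \<Longrightarrow> t < gp z (u i) (v j)" using ext_lessD[OF assms(5) uw(1) v] by blast
  obtain N' where N': "\<And>i j. i \<ge> N' \<Longrightarrow> j \<ge> N' \<Longrightarrow> t < gp z (v i) (w j)" using ext_lessD[OF assms(6) v uw(2)]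
      by blast
  have "t - \<delta> < gp z (u i) (w j)" if "i \<ge> max N N'" "j \<ge> max N N'" for i j
    by (rule hyp_less[where w = "v (max N N')"])
      (use assms(4) N N' that representatives_in[OF assms(1) uw(1)] representatives_in[OF assms(2) v]
        representatives_in[OF assms(3) uw(2)] in auto)
  then show "\<exists>N. \<forall>i\<ge>N. \<forall>j\<ge>N. t - \<delta> \<le> gp z (u i) (w j)" by (meson less_imp_le)
qed

lemma ext_Inl_le: "a \<in> S \<Longrightarrow> \<xi> \<in> compl \<Longrightarrow> z \<in> S \<Longrightarrow> ext z (Inl a) \<xi> \<le> ereal (d a z)"
proof (rule ext_less_cases)
  fix t assume a: "a \<in> S" "\<xi> \<in> compl" "z \<in> S" and t: "ereal t < ext z (Inl a) \<xi>"
  obtain u where u: "u \<in> representatives \<xi>" using representatives_nonempty a by blast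
  obtain N where "t < gp z a (u N)" using ext_lessD[OF t _ u, of "\<lambda>_. a"] by auto
  also have "\<dots> \<le> d a z" using a representatives_in[OF a(2) u] by (intro gp_le)
  finally show "ereal t \<le> ereal (d a z)" by simp
qed

lemma ext_Lipschitz:
  assumes "a \<in> S" "b \<in> S" "\<xi> \<in> compl" "z \<in> S" "ereal t < ext z (Inl a) \<xi>"
  shows "ereal (t - d a b) \<le> ext z (Inl b) \<xi>"
proof (rule le_extI)
  fix u v assume "u \<in> representatives (Inl b)" and v: "v \<in> representatives \<xi>"
  then have u: "u = (\<lambda>_. b)" by simp
  obtain N where N: "\<And>j. j \<ge> N \<Longrightarrow> t < gp z a (v j)"
    using ext_lessD[OF assms(5) _ v, of "\<lambda>_. a"] by auto
  have "t - d a b \<le> gp z b (v j)" if "j \<ge> N" for j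
    using gp_Lipschitz[OF assms(1,2) representatives_in[OF assms(3) v, of j] assms(4)] N[OF that] by linarith
  then show "\<exists>N. \<forall>i\<ge>N. \<forall>j\<ge>N. t - d a b \<le> gp z (u i) (v j)" unfolding u by blast
qed

lemma ext_base_change:
  assumes "\<xi> \<in> compl" "\<eta> \<in> compl" "z \<in> S" "z' \<in> S" "ereal t < ext z \<xi> \<eta>"
  shows "ereal (t - d z z') \<le> ext z' \<xi> \<eta>"
proof (rule le_extI)
  fix u v assume uv: "u \<in> representatives \<xi>" "v \<in> representatives \<eta>"
  obtain N where N: "\<And>i j. i \<ge> N \<Longrightarrow> j \<ge> N \<Longrightarrow> t < gp z (u i) (v j)" using ext_lessD[OF assms(5) uv] by blast
  have "t - d z z' \<le> gp z' (u i) (v j)" if "i \<ge> N" "j \<ge> N" for i j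
    using gp_base_change[OF representatives_in[OF assms(1) uv(1), of i] representatives_in[OF assms(2) uv(2),
        of j] assms(3,4)]
      N[OF that] by linarith
  then show "\<exists>N. \<forall>i\<ge>N. \<forall>j\<ge>N. t - d z z' \<le> gp z' (u i) (v j)" by blast
qed

lemma ext_self: "\<xi> \<in> bdry \<Longrightarrow> z \<in> S \<Longrightarrow> ereal t < ext z \<xi> \<xi>"
proof -
  assume \<xi>: "\<xi> \<in> bdry" and z: "z \<in> S"
  have "ereal (t + 1) \<le> ext z \<xi> \<xi>"
  proof (rule le_extI)
    fix u v assume "u \<in> representatives \<xi>" "v \<in> representatives \<xi>"
    then show "\<exists>N. \<forall>i\<ge>N. \<forall>j\<ge>N. t + 1 \<le> gp z (u i) (v j)"
      using boundary_representatives_diverge[OF \<xi>] z unfolding diverge_together_iff by (meson less_imp_le)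
  qed
  then show ?thesis by (meson ereal_less_eq(3) less_add_one less_ereal.simps(1) order_less_le_trans)
qed

lemma ext_bounded:
  assumes "\<xi> \<in> bdry" "\<eta> \<in> bdry" "\<xi> \<noteq> \<eta>" "z \<in> S"
  obtains T where "0 \<le> T" "ext z \<xi> \<eta> \<le> ereal T"
proof -
  have "\<exists>T. ext z \<xi> \<eta> \<le> ereal T"
  proof (rule ccontr)
    assume "\<not> ?thesis"
    then have big: "ereal t < ext z \<xi> \<eta>" for t by (meson not_le)
    obtain u v where uv: "u \<in> representatives \<xi>" "v \<in> representatives \<eta>"
      using representatives_nonempty[OF boundary_in_completion(1)[OF assms(1)]]
        representatives_nonempty[OF boundary_in_completion(1)[OF assms(2)]] by blast
    have "diverge_together S d u v"
      unfolding diverge_together_iff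
    proof (intro ballI allI)
      fix z' t assume z': "z' \<in> S"
      have "ereal (t + d z z' + 1 - d z z') \<le> ext z' \<xi> \<eta>"
        by (rule ext_base_change[OF boundary_in_completion(1)[OF assms(1)] boundary_in_completion(1)[OF
            assms(2)] assms(4) z' big])
      then have "ereal t < ext z' \<xi> \<eta>" by (simp add: order.strict_trans2[of "ereal t" "ereal (t + 1)"])
      from ext_lessD[OF this uv] show "\<exists>N. \<forall>i\<ge>N. \<forall>j\<ge>N. t < gp z' (u i) (v j)" .
    qed
    then show False using boundary_eqI[OF assms(1,2) uv] assms(3) by blast
  qed
  then obtain T where "ext z \<xi> \<eta> \<le> ereal T" by blast
  then have "ext z \<xi> \<eta> \<le> ereal (max 0 T)" by (meson ereal_less_eq(3) max.cobounded2 order_trans)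
  then show thesis using that[of "max 0 T"] by simp
qed

lemma representatives_upper_transfer:
  assumes "\<xi> \<in> compl" "u \<in> representatives \<xi>" "u' \<in> representatives \<xi>" "z \<in> S"
  shows "\<exists>N. \<forall>i\<ge>N. \<forall>i'\<ge>N. \<forall>x\<in>S. gp z (u' i') x < K \<longrightarrow> gp z (u i) x < K + \<delta>"
proof (cases "\<xi> \<in> bdry")
  case True
  then obtain N where N: "\<And>i i'. i \<ge> N \<Longrightarrow> i' \<ge> N \<Longrightarrow> K + \<delta> < gp z (u' i') (u i)"
    using boundary_representatives_diverge[OF True assms(3,2)] assms(4) unfolding diverge_together_iff
        by metis
  have "gp z (u i) x < K + \<delta>" if "i \<ge> N" "i' \<ge> N" "x \<in> S" "gp z (u' i') x < K" for i i' x
    using hyp[OF representatives_in[OF assms(1,3), of i'] that(3) assms(4) representatives_in[OF assms(1,2),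
        of i]]
      N[OF that(1,2)] that(4) by linarith
  then show ?thesis by blast
next
  case False
  then obtain a where "\<xi> = Inl a" using assms(1) by (auto simp: gromov_completion_def)
  then show ?thesis using assms(2,3) \<delta>_nonneg by auto
qed

text \<open>
  Upper bounds lose \<open>2 * \<delta>\<close>: an upper bound on the infimum is witnessed by one pair of
  representatives, and passing to another pair uses the hyperbolic inequality twice.
\<close>

lemma ext_le_representatives:
  assumes "\<xi> \<in> compl" "\<eta> \<in> compl" "z \<in> S" "ext z \<xi> \<eta> \<le> ereal t" "u \<in> representatives \<xi>"
      "v \<in> representatives \<eta>"
  shows "\<exists>N. \<forall>i\<ge>N. \<forall>j\<ge>N. gp z (u i) (v j) < t + 1 + 2 * \<delta>"
proof -
  have "\<not> ereal (t + 1) \<le> ext z \<xi> \<eta>"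
    using assms(4) by (meson ereal_less_eq(3) less_add_one not_le order_trans)
  then obtain u' v' where uv': "u' \<in> representatives \<xi>" "v' \<in> representatives \<eta>"
    and fr: "\<And>N. \<exists>i\<ge>N. \<exists>j\<ge>N. gp z (u' i) (v' j) < t + 1"
    using le_extI[of \<xi> \<eta> "t + 1" z] by (meson not_le)
  obtain N where N: "\<And>i i' x. i \<ge> N \<Longrightarrow> i' \<ge> N \<Longrightarrow> x \<in> S \<Longrightarrow> gp z (u' i') x < t + 1 \<Longrightarrow> gp z (u i) x < t + 1 + \<delta>"
    using representatives_upper_transfer[OF assms(1,5) uv'(1) assms(3)] by blast
  obtain N' where N': "\<And>j j' x. j \<ge> N' \<Longrightarrow> j' \<ge> N' \<Longrightarrow> x \<in> S \<Longrightarrow> gp z (v' j') x < t + 1 + \<delta>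
      \<Longrightarrow> gp z (v j) x < t + 1 + \<delta> + \<delta>"
    using representatives_upper_transfer[OF assms(2,6) uv'(2) assms(3)] by blast
  obtain i' j' where ij: "i' \<ge> max N N'" "j' \<ge> max N N'" "gp z (u' i') (v' j') < t + 1" using fr by blast
  have "gp z (u i) (v j) < t + 1 + 2 * \<delta>" if "i \<ge> max N N'" "j \<ge> max N N'" for i j
  proof -
    have "gp z (u i) (v' j') < t + 1 + \<delta>"
      by (rule N[of i i']) (use that ij representatives_in[OF assms(2) uv'(2)] in auto)
    then have "gp z (v j) (u i) < t + 1 + \<delta> + \<delta>"
      by (intro N'[of j j']) (use that ij representatives_in[OF assms(1,5)] in \<open>auto simp: gp_commute\<close>)
    then show ?thesis by (simp add: gp_commute)
  qed
  then show ?thesis by blast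
qed

text \<open>
  If \<open>(w|\<xi>)\<close> were large at \<open>q\<close>, then \<open>(w|a)\<close> and \<open>(w|b)\<close> would be bounded there in terms of
  \<open>(\<xi>|a)\<close> and \<open>(\<xi>|b)\<close>. Changing the base point from \<open>q\<close> to \<open>w\<close> turns this into
  \<open>(a|b) \<ge> d w q - const\<close> at \<open>w\<close>, so \<open>d w q\<close> is bounded, and with it \<open>(w|\<xi>)\<close>.
\<close>

lemma near_line_bounded_product:
  assumes q: "q \<in> S" and bd: "\<xi> \<in> bdry" "a \<in> bdry" "b \<in> bdry" and ne: "\<xi> \<noteq> a" "\<xi> \<noteq> b"
  obtains t where "\<And>w. w \<in> S \<Longrightarrow> ext w a b \<le> ereal D \<Longrightarrow> ext q (Inl w) \<xi> \<le> ereal t"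
proof -
  note cm = boundary_in_completion(1)[OF bd(1)] boundary_in_completion(1)[OF bd(2)]
      boundary_in_completion(1)[OF bd(3)]
  obtain T1 where T1: "ext q \<xi> a \<le> ereal T1" using ext_bounded[OF bd(1,2) ne(1) q] by blast
  obtain T2 where T2: "ext q \<xi> b \<le> ereal T2" using ext_bounded[OF bd(1,3) ne(2) q] by blast
  define T where "T = max T1 T2 + 1"
  have T: "ext q a \<xi> < ereal T" "ext q b \<xi> < ereal T"
    using T1 T2 unfolding T_def ext_commute[of q _ \<xi>]
    by (auto intro: order.strict_trans1 simp: less_ereal.simps(1))
  define C where "C = T + 3 * \<delta> + 1"
  have "ext q (Inl w) \<xi> \<le> ereal (max (T + \<delta>) (D + 2 * C))" if w: "w \<in> S" and D: "ext w a b \<le> ereal D" for w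
  proof (rule ccontr)
    note wc = boundary_in_completion(2)[OF w]
    assume "\<not> ?thesis"
    then have big: "ereal (T + \<delta>) < ext q (Inl w) \<xi>" "ereal (D + 2 * C) < ext q (Inl w) \<xi>"
      by (auto simp: not_le max_def split: if_splits intro: order.strict_trans1[rotated])
    have le: "ext q c (Inl w) \<le> ereal (T + \<delta>)" if c: "c \<in> compl" "ext q c \<xi> < ereal T" for c
    proof (rule ccontr)
      assume "\<not> ?thesis"
      then have "ereal (T + \<delta> - \<delta>) \<le> ext q c \<xi>"
        using ext_hyp[OF c(1) wc cm(1) q _ big(1)] by simp
      then show False using c(2) by simp
    qed
    have "ereal (d w q - 2 * C) \<le> ext w a b"
    proof (rule le_extI)
      fix u v assume uv: "u \<in> representatives a" "v \<in> representatives b"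
      obtain N where "\<forall>i\<ge>N. \<forall>j\<ge>N. gp q (u i) ((\<lambda>_. w) j) < T + \<delta> + 1 + 2 * \<delta>"
        using ext_le_representatives[OF cm(2) wc q le[OF cm(2) T(1)] uv(1), of "\<lambda>_. w"] by auto
      then have N: "gp q (u i) w < C" if "i \<ge> N" for i using that by (fastforce simp: C_def)
      obtain N' where "\<forall>i\<ge>N'. \<forall>j\<ge>N'. gp q (v i) ((\<lambda>_. w) j) < T + \<delta> + 1 + 2 * \<delta>"
        using ext_le_representatives[OF cm(3) wc q le[OF cm(3) T(2)] uv(2), of "\<lambda>_. w"] by auto
      then have N': "gp q (v i) w < C" if "i \<ge> N'" for i using that by (fastforce simp: C_def)
      have "d w q - 2 * C \<le> gp w (u i) (v j)" if "i \<ge> max N N'" "j \<ge> max N N'" for i j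
      proof -
        have "gp w (u i) (v j) = gp q (u i) (v j) + d w q - gp q (u i) w - gp q (v j) w"
          by (simp add: gromov_product_def commute field_simps)
        moreover have "0 \<le> gp q (u i) (v j)"
          using representatives_in[OF cm(2) uv(1)] representatives_in[OF cm(3) uv(2)] q by (intro gp_nonneg)
        ultimately show ?thesis using N[of i] N'[of j] that by simp
      qed
      then show "\<exists>N. \<forall>i\<ge>N. \<forall>j\<ge>N. d w q - 2 * C \<le> gp w (u i) (v j)" by blast
    qed
    then have "d w q \<le> D + 2 * C" using order_trans[OF _ D] by fastforce
    moreover have "ext q (Inl w) \<xi> \<le> ereal (d w q)" using ext_Inl_le[OF w cm(1) q] .
    ultimately show False using big(2) by (meson ereal_less_eq(3) leD order_trans)
  qed
  then show thesis by (rule that)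
qed

text \<open>
  The point \<open>y\<close> is close to \<open>\<xi>\<close> and \<open>w\<close> is not, so \<open>(y|w)\<close> is bounded at \<open>q\<close>. Hence a path from
  \<open>y\<close> to \<open>w\<close> comes close to \<open>q\<close>, and \<open>w\<close> can be as close to \<open>y\<close> as \<open>q\<close> is only if it is close to
  \<open>q\<close>.
\<close>

lemma nearest_point_bound:
  assumes S: "q \<in> S" "y \<in> S" "w \<in> S" and \<xi>: "\<xi> \<in> bdry"
    and y: "ereal (t + \<delta> + 1) < ext q (Inl y) \<xi>" and w: "ext q (Inl w) \<xi> \<le> ereal t"
    and near: "d y w \<le> d y q"
  shows "d w q \<le> 2 * (t + \<delta> + 1)"
proof -
  have "gp q w y \<le> t + \<delta> + 1"
  proof (rule ccontr)
    assume "\<not> ?thesis"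
    then have "ereal (t + \<delta> + 1 - \<delta>) \<le> ext q (Inl w) \<xi>"
      using S(2,3) by (intro ext_hyp[OF boundary_in_completion(2) boundary_in_completion(2)
          boundary_in_completion(1)[OF \<xi>] S(1) _ y]) auto
    then have "ereal (t + 1) \<le> ext q (Inl w) \<xi>" by simp
    from order_trans[OF this w] show False by simp
  qed
  then show ?thesis using near by (simp add: gromov_product_def commute)
qed

text \<open>
  The sets \<open>{\<eta>. (\<eta>|\<xi>) > t}\<close> need not be open. By the hyperbolic inequality such a set for a larger
  \<open>t\<close> lies in the interior \<open>V\<close> of the one for the given \<open>t\<close>, which is all that is needed for \<open>V\<close>
  to be open.
\<close>

lemma boundary_neighbourhood:
  assumes \<xi>: "\<xi> \<in> bdry" and z: "z \<in> S"
  obtains V where "openin (gromov_topology S d) V" "\<xi> \<in> V" "\<And>\<eta>. \<eta> \<in> V \<Longrightarrow> \<eta> \<in> compl \<and> ereal t < ext z \<eta> \<xi>"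
proof -
  define N where "N \<eta> s = {\<zeta> \<in> compl. ereal s < ext z \<zeta> \<eta>}" for \<eta> s
  define V where "V = {\<eta> \<in> N \<xi> t. (\<forall>a. \<eta> = Inl a \<longrightarrow> (\<exists>r>0. \<forall>b\<in>mball a r. Inl b \<in> N \<xi> t)) \<and>
     (\<eta> \<in> bdry \<longrightarrow> (\<exists>s. N \<eta> s \<subseteq> N \<xi> t))}"
  have Inl_bdry: "Inl a \<notin> bdry" for a by (auto simp: gromov_boundary_def)
  have "gromov_open S d V"
    unfolding gromov_open_def
  proof (intro conjI ballI)
    show "V \<subseteq> compl" unfolding V_def N_def by auto
    show "openin mtopology {a. Inl a \<in> V}"
      unfolding openin_mtopology
    proof (intro conjI allI impI)
      show "{a. Inl a \<in> V} \<subseteq> S" unfolding V_def N_def using Inl_bdry by (auto simp: gromov_completion_def)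
      fix a assume "a \<in> {a. Inl a \<in> V}"
      then obtain r where r: "r > 0" "\<And>b. b \<in> mball a r \<Longrightarrow> Inl b \<in> N \<xi> t" unfolding V_def by blast
      have "mball a (r/2) \<subseteq> {a. Inl a \<in> V}"
      proof
        fix b assume b: "b \<in> mball a (r/2)"
        have "Inl b' \<in> N \<xi> t" if b': "b' \<in> mball b (r/2)" for b'
        proof -
          have "d a b' \<le> d a b + d b b'" using b b' by (intro triangle) auto
          then show ?thesis using b b' by (intro r(2)) auto
        qed
        moreover have "Inl b \<in> N \<xi> t" using b r by (intro r(2)) auto
        moreover have "r / 2 > 0" using r by simp
        ultimately show "b \<in> {a. Inl a \<in> V}" unfolding V_def using Inl_bdry by blast
      qed
      then show "\<exists>r>0. mball a r \<subseteq> {a. Inl a \<in> V}" using r by (intro exI[of _ "r/2"]) auto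
    qed
    fix \<eta> z' assume \<eta>: "\<eta> \<in> V \<inter> bdry" and z': "z' \<in> S"
    then obtain s where s: "N \<eta> s \<subseteq> N \<xi> t" unfolding V_def by blast
    have \<eta>c: "\<eta> \<in> compl" using \<eta> boundary_in_completion by blast
    define s' where "s' = s + \<delta> + 1"
    have s': "s < s'" "s < s' - \<delta>" "s < s' - 1/2" using \<delta>_nonneg unfolding s'_def by auto
    have "N \<eta> s' \<subseteq> V"
    proof
      fix \<zeta> assume \<zeta>: "\<zeta> \<in> N \<eta> s'"
      then have \<zeta>c: "\<zeta> \<in> compl" and \<zeta>s: "ereal s' < ext z \<zeta> \<eta>" unfolding N_def by auto
      have "\<zeta> \<in> N \<eta> s" unfolding N_def using \<zeta>c \<zeta>s s'(1) by (auto intro: order.strict_trans[rotated])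
      then have "\<zeta> \<in> N \<xi> t" using s by blast
      moreover have "\<exists>r>0. \<forall>b\<in>mball a r. Inl b \<in> N \<xi> t" if "\<zeta> = Inl a" for a
      proof (intro exI[of _ "1/2"] conjI ballI)
        fix b assume b: "b \<in> mball a (1/2)"
        then have "ereal (s' - d a b) \<le> ext z (Inl b) \<eta>"
          using \<zeta>s that \<eta>c z by (intro ext_Lipschitz) auto
        moreover have "s < s' - d a b" using b s'(3) by simp
        ultimately have "ereal s < ext z (Inl b) \<eta>" by (metis less_ereal.simps(1) order_less_le_trans)
        then have "Inl b \<in> N \<eta> s" unfolding N_def using b boundary_in_completion by simp
        then show "Inl b \<in> N \<xi> t" using s by blast
      qed simp
      moreover have "\<exists>s. N \<zeta> s \<subseteq> N \<xi> t"
      proof (intro exI[of _ s'] order_trans[OF _ s] subsetI)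
        fix x assume "x \<in> N \<zeta> s'"
        then have "x \<in> compl" "ereal (s' - \<delta>) \<le> ext z x \<eta>"
          using ext_hyp[OF _ \<zeta>c \<eta>c z _ \<zeta>s] unfolding N_def by auto
        then show "x \<in> N \<eta> s" unfolding N_def using s'(2)
            by (auto intro: order.strict_trans2[of "ereal s" "ereal (s' - \<delta>)"])
      qed
      ultimately show "\<zeta> \<in> V" unfolding V_def by blast
    qed
    moreover have "{x \<in> compl. ereal (s' + 1 + d z' z) < ext z' x \<eta>} \<subseteq> N \<eta> s'"
    proof
      fix x assume x: "x \<in> {x \<in> compl. ereal (s' + 1 + d z' z) < ext z' x \<eta>}"
      then have "ereal (s' + 1 + d z' z - d z' z) \<le> ext z x \<eta>"
        by (intro ext_base_change) (use \<eta>c z z' in auto)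
      then show "x \<in> N \<eta> s'" unfolding N_def using x
          by (auto intro: order.strict_trans2[of "ereal s'" "ereal (s' + 1)"])
    qed
    ultimately show "\<exists>t. {x \<in> compl. ereal t < ext z' x \<eta>} \<subseteq> V" by blast
  qed
  then have "openin (gromov_topology S d) V" by (simp add: openin_gromov_topology)
  moreover have "\<xi> \<in> V" unfolding V_def N_def
    using ext_self[OF \<xi> z] boundary_in_completion(1)[OF \<xi>] \<xi> Inl_bdry by blast
  moreover have "\<eta> \<in> compl \<and> ereal t < ext z \<eta> \<xi>" if "\<eta> \<in> V" for \<eta> using that unfolding V_def N_def by blast
  ultimately show thesis by (rule that)
qed

lemma closure_of_orbit_boundary:
  assumes \<xi>: "\<xi> \<in> bdry" "\<xi> \<in> gromov_topology S d closure_of (Inl ` Q)" and z: "z \<in> S"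
  shows "\<exists>y\<in>Q. ereal t < ext z (Inl y) \<xi>"
proof -
  obtain V where V: "openin (gromov_topology S d) V" "\<xi> \<in> V" "\<And>\<eta>. \<eta> \<in> V \<Longrightarrow> \<eta> \<in> compl \<and> ereal t < ext z \<eta> \<xi>"
    using boundary_neighbourhood[OF \<xi>(1) z, where t = t] by metis
  then obtain \<eta> where "\<eta> \<in> Inl ` Q" "\<eta> \<in> V" using \<xi>(2) unfolding in_closure_of by blast
  then show ?thesis using V(3) by blast
qed

lemma dense_points_near_boundary:
  assumes \<xi>: "\<xi> \<in> bdry" and z: "z \<in> S" and sS: "\<And>i. s i \<in> S"
    and dense: "\<And>x e. x \<in> S \<Longrightarrow> e > 0 \<Longrightarrow> \<exists>i::nat. d x (s i) < e"
  shows "\<exists>i. ereal t < ext z (Inl (s i)) \<xi>"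
proof -
  note \<xi>c = boundary_in_completion(1)[OF \<xi>]
  obtain u where u: "u \<in> representatives \<xi>" using representatives_nonempty[OF \<xi>c] by blast
  let ?T = "t + 3 + \<delta>"
  obtain N where N: "\<And>i j. i \<ge> N \<Longrightarrow> j \<ge> N \<Longrightarrow> ?T < gp z (u i) (u j)"
    using boundary_representatives_diverge[OF \<xi> u u] z unfolding diverge_together_iff by metis
  have uS: "u N \<in> S" using representatives_in[OF \<xi>c u] .
  have "ereal (?T - \<delta>) \<le> ext z (Inl (u N)) \<xi>"
  proof (rule le_extI)
    fix c v assume "c \<in> representatives (Inl (u N))" and v: "v \<in> representatives \<xi>"
    then have c: "c = (\<lambda>_. u N)" by simp
    obtain N' where N': "\<And>i j. i \<ge> N' \<Longrightarrow> j \<ge> N' \<Longrightarrow> ?T < gp z (u i) (v j)"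
      using boundary_representatives_diverge[OF \<xi> u v] z unfolding diverge_together_iff by metis
    have "?T - \<delta> < gp z (u N) (v j)" if "j \<ge> N'" for j
      by (rule hyp_less[where w = "u (max N N')"])
        (use N N' that z representatives_in[OF \<xi>c u] representatives_in[OF \<xi>c v] in auto)
    then show "\<exists>N. \<forall>i\<ge>N. \<forall>j\<ge>N. ?T - \<delta> \<le> gp z (c i) (v j)" unfolding c by (meson less_imp_le)
  qed
  then have big: "ereal (t + 2) < ext z (Inl (u N)) \<xi>"
      by (auto intro: order.strict_trans2[of _ "ereal (t + 3)"])
  obtain i where i: "d (u N) (s i) < 1" using dense[OF uS, of 1] by auto
  have "ereal (t + 2 - d (u N) (s i)) \<le> ext z (Inl (s i)) \<xi>" by (rule ext_Lipschitz[OF uS sS \<xi>c z big])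
  then have "ereal t < ext z (Inl (s i)) \<xi>"
    by (rule ereal_less_of_le) (use i in simp)
  then show ?thesis ..
qed

end


section \<open>The chain metric and its extension to the boundary\<close>

fun chain_cost :: "('i \<Rightarrow> 'i \<Rightarrow> real) \<Rightarrow> 'i \<Rightarrow> 'i list \<Rightarrow> 'i \<Rightarrow> real" where
  "chain_cost w i [] k = w i k"
| "chain_cost w i (j # js) k = w i j + chain_cost w j js k"

text \<open>
  Frink's chain construction: for nonnegative \<open>w\<close>, the largest function below \<open>w\<close> that satisfies
  the triangle inequality.
\<close>

definition chain_dist :: "('i \<Rightarrow> 'i \<Rightarrow> real) \<Rightarrow> 'i \<Rightarrow> 'i \<Rightarrow> real" where
  "chain_dist w i k = (INF js. chain_cost w i js k)"

lemma chain_cost_append: "chain_cost w i (js @ [j]) k = chain_cost w i js j + w j k"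
  by (induction js arbitrary: i) auto

text \<open>
  The link \<open>(x, y)\<close> is the first one after which the rest of the chain costs at most \<open>b\<close>; then
  what comes before it costs at most \<open>a\<close>. Either part may be absent.
\<close>

lemma chain_cost_split:
  assumes w0: "\<And>i j. 0 \<le> w i j"
  shows "0 \<le> a \<Longrightarrow> 0 \<le> b \<Longrightarrow> chain_cost w i js k \<le> a + b \<Longrightarrow>
    \<exists>x y. w x y \<le> chain_cost w i js k \<and>
      (i = x \<or> (\<exists>js'. length js' < length js \<and> chain_cost w i js' x \<le> a)) \<and>
      (y = k \<or> (\<exists>js'. length js' < length js \<and> chain_cost w y js' k \<le> b))"
proof (induction js arbitrary: i a)
  case (Cons j js)
  have nonneg: "0 \<le> chain_cost w i js k" for i js by (induction js arbitrary: i) (auto simp: w0)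
  show ?case
  proof (cases "chain_cost w j js k \<le> b")
    case True
    then show ?thesis using nonneg[of j js] by (intro exI[of _ i] exI[of _ j]) auto
  next
    case False
    then have "0 \<le> a - w i j" "chain_cost w j js k \<le> (a - w i j) + b" using Cons.prems by auto
    from Cons.IH[OF this(1) Cons.prems(2) this(2)] obtain x y where xy: "w x y \<le> chain_cost w j js k"
      "j = x \<or> (\<exists>js'. length js' < length js \<and> chain_cost w j js' x \<le> a - w i j)"
      "y = k \<or> (\<exists>js'. length js' < length js \<and> chain_cost w y js' k \<le> b)" by blast
    have "\<exists>js'. length js' < length (j # js) \<and> chain_cost w i js' x \<le> a"
      using xy(2)
    proof
      assume "j = x"
      then show ?thesis using \<open>0 \<le> a - w i j\<close> by (intro exI[of _ "[]"]) auto
    next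
      assume "\<exists>js'. length js' < length js \<and> chain_cost w j js' x \<le> a - w i j"
      then obtain js' where "length js' < length js" "chain_cost w j js' x \<le> a - w i j" by blast
      then show ?thesis by (intro exI[of _ "j # js'"]) auto
    qed
    moreover have "y = k \<or> (\<exists>js'. length js' < length (j # js) \<and> chain_cost w y js' k \<le> b)"
      using xy(3) by (auto intro: less_SucI)
    moreover have "w x y \<le> chain_cost w i (j # js) k" using xy(1) w0[of i j] by simp
    ultimately show ?thesis by blast
  qed
qed auto

text \<open>
  Split a chain of cost \<open>c\<close> into two shorter chains of cost at most \<open>c / 2\<close> and one link of cost
  at most \<open>c\<close>. By induction all three pieces have \<open>w\<close>-distance at most \<open>c\<close>, and joining them costs
  the factor \<open>K * K\<close>.
\<close>

lemma Frink_chain_bound: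
  assumes w0: "\<And>i j. 0 \<le> w i j" and K: "1 \<le> K" "K * K \<le> 2"
    and quasi: "\<And>i j k. w i k \<le> K * max (w i j) (w j k)"
  shows "w i k \<le> 2 * chain_cost w i js k"
proof (induction js arbitrary: i k rule: length_induct)
  case (1 js)
  let ?c = "chain_cost w i js k"
  have c0: "0 \<le> chain_cost w i js k" for i k js by (induction js arbitrary: i) (auto simp: w0)
  obtain x y where xy: "w x y \<le> ?c"
    "i = x \<or> (\<exists>js'. length js' < length js \<and> chain_cost w i js' x \<le> ?c / 2)"
    "y = k \<or> (\<exists>js'. length js' < length js \<and> chain_cost w y js' k \<le> ?c / 2)"
    using chain_cost_split[where w = w, OF w0, of "?c/2" "?c/2" i js k] c0 by auto
  have Kc: "?c \<le> K * ?c" using K(1) c0[of i js k] by (simp add: mult_le_cancel_right1)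
  have iy: "w i y \<le> K * ?c"
  proof (cases "i = x")
    case False
    then obtain js' where js': "length js' < length js" "chain_cost w i js' x \<le> ?c / 2" using xy(2) by blast
    have "w i x \<le> 2 * chain_cost w i js' x" using 1 js'(1) by blast
    then have "w i x \<le> ?c" using js'(2) by linarith
    then have "max (w i x) (w x y) \<le> ?c" using xy(1) by simp
    then have "K * max (w i x) (w x y) \<le> K * ?c" using K(1) by (intro mult_left_mono) auto
    with quasi[of i y x] show ?thesis by (rule order_trans)
  qed (use xy(1) Kc in auto)
  have "w i k \<le> K * (K * ?c)"
  proof (cases "y = k")
    case True
    then have "w i k \<le> K * ?c" using iy by simp
    also have "\<dots> \<le> K * (K * ?c)" using K(1) by (intro mult_left_mono[OF Kc]) auto
    finally show ?thesis .
  next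
    case False
    then obtain js' where js': "length js' < length js" "chain_cost w y js' k \<le> ?c / 2" using xy(3) by blast
    have "w y k \<le> 2 * chain_cost w y js' k" using 1 js'(1) by blast
    then have "w y k \<le> ?c" using js'(2) by linarith
    then have "max (w i y) (w y k) \<le> K * ?c" using iy Kc by simp
    then have "K * max (w i y) (w y k) \<le> K * (K * ?c)" using K(1) by (intro mult_left_mono) auto
    with quasi[of i k y] show ?thesis by (rule order_trans)
  qed
  also have "\<dots> \<le> 2 * ?c" using mult_right_mono[OF K(2) c0[of i js k]] by (simp add: mult.assoc)
  finally show ?case .
qed

lemma chain_dist_properties:
  assumes w0: "\<And>i j. 0 \<le> w i j"
  shows "bdd_below (range (\<lambda>js. chain_cost w i js k))" "chain_dist w i k \<le> w i k" "0 \<le> chain_dist w i k"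
    "chain_dist w i k \<le> chain_dist w i j + w j k"
proof -
  have c0: "0 \<le> chain_cost w i js k" for i js k by (induction js arbitrary: i) (auto simp: w0)
  show bdd: "bdd_below (range (\<lambda>js. chain_cost w i js k))" for i k
    by (rule bdd_belowI[of _ 0]) (auto simp: c0)
  show "chain_dist w i k \<le> w i k"
    unfolding chain_dist_def using cINF_lower[OF bdd, of "[]" i k] by simp
  show "0 \<le> chain_dist w i k"
    unfolding chain_dist_def by (rule cINF_greatest) (auto simp: c0)
  have "chain_dist w i k - w j k \<le> chain_dist w i j"
    unfolding chain_dist_def[of w i j]
  proof (rule cINF_greatest)
    fix js
    have "chain_dist w i k \<le> chain_cost w i (js @ [j]) k"
      unfolding chain_dist_def by (rule cINF_lower[OF bdd]) simp
    then show "chain_dist w i k - w j k \<le> chain_cost w i js j" by (simp add: chain_cost_append)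
  qed simp
  then show "chain_dist w i k \<le> chain_dist w i j + w j k" by simp
qed

text \<open>
  The usual visual quasi-metric with parameter \<open>\<epsilon>\<close> and base point \<open>q\<close>, on the points \<open>s i\<close>.
\<close>

definition visual_weight :: "('b \<Rightarrow> 'b \<Rightarrow> real) \<Rightarrow> real \<Rightarrow> 'b \<Rightarrow> (nat \<Rightarrow> 'b) \<Rightarrow> nat \<Rightarrow> nat \<Rightarrow> real" where
  "visual_weight d \<epsilon> q s i j = exp (- \<epsilon> * gromov_product d q (s i) (s j))"

text \<open>
  For \<open>u\<close> with values in \<open>[0, 1]\<close>, the lower limit of \<open>u i\<close> as \<open>s i\<close> tends to the boundary point
  \<open>\<xi>\<close>. In this form it involves \<open>\<xi>\<close> only through its products with the countably many points
  \<open>s i\<close>, which keeps it Borel.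
\<close>

definition boundary_limit :: "('b \<Rightarrow> 'b \<Rightarrow> real) \<Rightarrow> 'b \<Rightarrow> (nat \<Rightarrow> 'b) \<Rightarrow> (nat \<Rightarrow> real) \<Rightarrow> 'b gpoint \<Rightarrow> real" where
  "boundary_limit d q s u \<xi> =
     (SUP n::nat. INF i. if ereal (real n) < ext_gromov_product d q \<xi> (Inl (s i)) then u i else 1)"

locale dense_hyperbolic_space = hyperbolic_space +
  fixes q and s :: "nat \<Rightarrow> 'a"
  assumes \<delta>_pos: "0 < \<delta>" and q: "q \<in> S" and s: "\<And>i. s i \<in> S"
    and dense: "\<And>x e. x \<in> S \<Longrightarrow> e > 0 \<Longrightarrow> \<exists>i. d x (s i) < e"
begin

text \<open>
  The largest parameter for which the constant \<open>K = exp (\<epsilon> * \<delta>)\<close> of the quasi-metric below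
  satisfies \<open>K * K \<le> 2\<close>, as Frink's bound requires.
\<close>

definition \<epsilon> where "\<epsilon> = ln 2 / (2 * \<delta>)"
abbreviation "w \<equiv> visual_weight d \<epsilon> q s"
definition "dist_to k = boundary_limit d q s (chain_dist w k)"

lemma \<epsilon>_pos: "0 < \<epsilon>" using \<delta>_pos by (simp add: \<epsilon>_def)

lemma w_nonneg: "0 \<le> w i j" by (simp add: visual_weight_def)
lemma w_le_1: "w i j \<le> 1"
  using gp_nonneg[OF s s q] \<epsilon>_pos by (simp add: visual_weight_def)
lemma w_commute: "w i j = w j i" by (simp add: visual_weight_def gp_commute)

lemma w_le: "t \<le> gp q (s i) (s j) \<Longrightarrow> w i j \<le> exp (- \<epsilon> * t)"
  using \<epsilon>_pos by (simp add: visual_weight_def)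
lemma le_w: "gp q (s i) (s j) \<le> t \<Longrightarrow> exp (- \<epsilon> * t) \<le> w i j"
  using \<epsilon>_pos by (simp add: visual_weight_def)

lemma w_quasi: "w i k \<le> exp (\<epsilon> * \<delta>) * max (w i j) (w j k)"
proof -
  let ?m = "min (gp q (s i) (s j)) (gp q (s j) (s k))"
  have "?m - \<delta> \<le> gp q (s i) (s k)" by (rule hyp[OF s s q s])
  then have "w i k \<le> exp (- \<epsilon> * (?m - \<delta>))" by (rule w_le)
  also have "\<dots> = exp (\<epsilon> * \<delta>) * exp (- \<epsilon> * ?m)" by (simp add: exp_add[symmetric] algebra_simps)
  also have "exp (- \<epsilon> * ?m) \<le> max (w i j) (w j k)" by (auto simp: visual_weight_def min_def)
  finally show ?thesis by simp
qed

lemma chain_dist_lower: "w i k / 2 \<le> chain_dist w i k"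
  unfolding chain_dist_def
proof (rule cINF_greatest)
  fix js
  have "exp (\<epsilon> * \<delta>) * exp (\<epsilon> * \<delta>) = 2"
    using \<delta>_pos by (simp add: exp_add[symmetric] \<epsilon>_def)
  then have "w i k \<le> 2 * chain_cost w i js k"
    using \<epsilon>_pos \<delta>_pos by (intro Frink_chain_bound[OF w_nonneg _ _ w_quasi]) auto
  then show "w i k / 2 \<le> chain_cost w i js k" by simp
qed simp

lemma chain_dist_bounds: "0 \<le> chain_dist w k i" "chain_dist w k i \<le> 1"
  using chain_dist_properties(2,3)[where w = w, OF w_nonneg, of k i] w_le_1[of k i] by linarith+

lemma chain_dist_diff: "\<bar>chain_dist w k i - chain_dist w k j\<bar> \<le> w i j"
  using chain_dist_properties(4)[where w = w, OF w_nonneg, of k i j] chain_dist_properties(4)[where w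
      = w, OF w_nonneg, of k j i]
    w_commute[of i j] by linarith

lemma exists_near: "\<xi> \<in> bdry \<Longrightarrow> \<exists>i. ereal t < ext q (Inl (s i)) \<xi>"
  by (rule dense_points_near_boundary[OF _ q s dense])

lemma boundary_limit_bounds:
  assumes u: "\<And>i. 0 \<le> u i" "\<And>i. u i \<le> (1::real)"
  shows "0 \<le> boundary_limit d q s u \<xi>" "boundary_limit d q s u \<xi> \<le> 1"
proof -
  define f where "f n i = (if ereal (real n) < ext q \<xi> (Inl (s i)) then u i else 1)" for n i
  have f: "0 \<le> f n i" "f n i \<le> 1" for n i unfolding f_def using u by auto
  have bdd: "bdd_below (range (f n))" for n by (rule bdd_belowI[of _ 0]) (auto simp: f)
  have g: "0 \<le> (INF i. f n i)" "(INF i. f n i) \<le> 1" for n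
    using cINF_greatest[of UNIV 0 "f n"] order_trans[OF cINF_lower[OF bdd, of 0 n] f(2)[of n 0]] f by auto
  have bdd': "bdd_above (range (\<lambda>n. INF i. f n i))" by (rule bdd_aboveI[of _ 1]) (auto simp: g)
  have L: "boundary_limit d q s u \<xi> = (SUP n. INF i. f n i)" by (simp add: boundary_limit_def f_def)
  show "0 \<le> boundary_limit d q s u \<xi>" unfolding L using cSUP_upper[OF _ bdd', of 0] g(1)[of 0] by auto
  show "boundary_limit d q s u \<xi> \<le> 1" unfolding L by (rule cSUP_least) (auto simp: g)
qed

text \<open>
  Points \<open>s i\<close> and \<open>s j\<close> close to \<open>\<xi>\<close> have large product with each other, hence small weight, so
  all values \<open>u j\<close> that enter the limit are close to \<open>u i\<close>.
\<close>

lemma boundary_limit_approx: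
  assumes \<xi>: "\<xi> \<in> bdry" and u: "\<And>i. 0 \<le> u i" "\<And>i. u i \<le> (1::real)" "\<And>i j. \<bar>u i - u j\<bar> \<le> w i j"
    and i: "ereal t < ext q (Inl (s i)) \<xi>"
  shows "\<bar>boundary_limit d q s u \<xi> - u i\<bar> \<le> exp (- \<epsilon> * (t - \<delta>))"
proof -
  define f where "f n j = (if ereal (real n) < ext q \<xi> (Inl (s j)) then u j else 1)" for n j
  let ?e = "exp (- \<epsilon> * (t - \<delta>))"
  have f: "0 \<le> f n i" "f n i \<le> 1" for n i unfolding f_def using u by auto
  have bdd: "bdd_below (range (f n))" for n by (rule bdd_belowI[of _ 0]) (auto simp: f)
  have g: "(INF i. f n i) \<le> 1" for n using order_trans[OF cINF_lower[OF bdd, of 0 n] f(2)[of n 0]] by simp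
  have bdd': "bdd_above (range (\<lambda>n. INF i. f n i))" by (rule bdd_aboveI[of _ 1]) (auto simp: g)
  have L: "boundary_limit d q s u \<xi> = (SUP n. INF i. f n i)" by (simp add: boundary_limit_def f_def)
  have close: "\<bar>u i - u j\<bar> \<le> ?e" if j: "ereal t < ext q (Inl (s j)) \<xi>" for j
  proof -
    have "ereal (t - \<delta>) \<le> ext q (Inl (s i)) (Inl (s j))"
      using j by (intro ext_hyp[OF boundary_in_completion(2)[OF s] boundary_in_completion(1)[OF \<xi>]
          boundary_in_completion(2)[OF s] q i]) (subst ext_commute)
    then have "w i j \<le> ?e" by (intro w_le) simp
    then show ?thesis using u(3)[of i j] by simp
  qed
  obtain m :: nat where m: "t \<le> real m" using real_arch_simple by blast
  have big: "\<bar>u i - u j\<bar> \<le> ?e" if "ereal (real n) < ext q \<xi> (Inl (s j))" "m \<le> n" for n j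
  proof (rule close)
    have "ereal t \<le> ereal (real n)" using m that(2) by simp
    then show "ereal t < ext q (Inl (s j)) \<xi>" using that(1) by (metis ext_commute order.strict_trans1)
  qed
  have upper: "(INF j. f n j) \<le> u i + ?e" if n: "m \<le> n" for n
  proof -
    obtain j where j: "ereal (real n) < ext q (Inl (s j)) \<xi>" using exists_near[OF \<xi>] by blast
    then have "(INF j. f n j) \<le> u j" using cINF_lower[OF bdd, of j n] by (simp add: f_def ext_commute)
    then show ?thesis using big[of n j] j n by (simp add: ext_commute)
  qed
  have lower: "u i - ?e \<le> (INF j. f m j)"
  proof (rule cINF_greatest)
    fix j show "u i - ?e \<le> f m j"
      using big[of m j] u(2)[of i] exp_gt_zero[of "- \<epsilon> * (t - \<delta>)"] unfolding f_def
      by (smt (verit) order_refl)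
  qed simp
  have mono: "(INF j. f n j) \<le> (INF j. f (max n m) j)" for n
  proof (rule cINF_mono[OF _ bdd])
    fix j
    have le: "ereal (real n) \<le> ereal (real (max n m))" by simp
    have "f n j \<le> f (max n m) j"
    proof (cases "ereal (real (max n m)) < ext q \<xi> (Inl (s j))")
      case True
      with le have "ereal (real n) < ext q \<xi> (Inl (s j))" by (rule order.strict_trans1)
      with True show ?thesis by (simp only: f_def if_True order_refl)
    next
      case False
      then have "f (max n m) j = 1" by (simp only: f_def if_False)
      then show ?thesis using f(2)[of n j] by simp
    qed
    then show "\<exists>j'\<in>UNIV. f n j' \<le> f (max n m) j" by blast
  qed simp
  have "boundary_limit d q s u \<xi> \<le> u i + ?e"
    unfolding L by (rule cSUP_least, simp, rule order_trans[OF mono upper], simp)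
  moreover have "u i - ?e \<le> boundary_limit d q s u \<xi>"
    unfolding L using order_trans[OF lower cSUP_upper[OF _ bdd', of m]] by simp
  ultimately show ?thesis by linarith
qed

lemma dist_to_bounds: "0 \<le> dist_to k \<xi>" "dist_to k \<xi> \<le> 1"
  unfolding dist_to_def by (rule boundary_limit_bounds; rule chain_dist_bounds)+

lemma dist_to_approx:
  assumes "\<xi> \<in> bdry" "ereal t < ext q (Inl (s i)) \<xi>"
  shows "\<bar>dist_to k \<xi> - chain_dist w k i\<bar> \<le> exp (- \<epsilon> * (t - \<delta>))"
  unfolding dist_to_def
  by (rule boundary_limit_approx[OF assms(1) chain_dist_bounds chain_dist_diff assms(2)])

lemma dist_to_Lipschitz:
  assumes \<xi>: "\<xi> \<in> bdry" and \<eta>: "\<eta> \<in> bdry" and t: "ereal t < ext q \<xi> \<eta>"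
  shows "\<bar>dist_to k \<xi> - dist_to k \<eta>\<bar> \<le> 2 * exp (- \<epsilon> * (t - 2 * \<delta> - 1))"
proof -
  obtain i where i: "ereal t < ext q (Inl (s i)) \<xi>" using exists_near[OF \<xi>] by blast
  have "ereal (t - \<delta>) \<le> ext q (Inl (s i)) \<eta>"
    by (rule ext_hyp[OF boundary_in_completion(2)[OF s] boundary_in_completion(1)[OF \<xi>]
        boundary_in_completion(1)[OF \<eta>] q i t])
  then have i': "ereal (t - \<delta> - 1) < ext q (Inl (s i)) \<eta>" by (rule ereal_less_of_le) simp
  have "exp (- \<epsilon> * (t - \<delta>)) \<le> exp (- \<epsilon> * (t - 2 * \<delta> - 1))"
    using \<epsilon>_pos \<delta>_pos by simp
  moreover have "exp (- \<epsilon> * (t - \<delta> - 1 - \<delta>)) = exp (- \<epsilon> * (t - 2 * \<delta> - 1))" by (simp add: algebra_simps)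
  ultimately show ?thesis
    using dist_to_approx[OF \<xi> i, of k] dist_to_approx[OF \<eta> i', of k] by linarith
qed

lemma dist_to_near:
  assumes \<xi>: "\<xi> \<in> bdry" and k: "ereal t < ext q (Inl (s k)) \<xi>"
  shows "dist_to k \<xi> \<le> 2 * exp (- \<epsilon> * (t - \<delta>))"
proof -
  have "ereal t \<le> ereal (d (s k) q)"
    using ext_Inl_le[OF s boundary_in_completion(1)[OF \<xi>] q, of k] k
        by (meson less_imp_le order.strict_trans2)
  then have "t \<le> gp q (s k) (s k)" by (simp add: gromov_product_def s)
  then have "w k k \<le> exp (- \<epsilon> * t)" by (rule w_le)
  also have "\<dots> \<le> exp (- \<epsilon> * (t - \<delta>))" using \<epsilon>_pos \<delta>_pos by simp
  finally show ?thesis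
    using dist_to_approx[OF assms, of k] chain_dist_properties(2)[where w = w, OF w_nonneg, of k k]
        by linarith
qed

lemma exists_small_scale:
  assumes "0 < c" shows "\<exists>t\<ge>T. exp (- \<epsilon> * (t - \<delta>)) \<le> c"
proof -
  let ?t = "max T (\<delta> - ln c / \<epsilon>)"
  have "- ln c / \<epsilon> \<le> ?t - \<delta>" by simp
  then have "- ln c \<le> (?t - \<delta>) * \<epsilon>" using \<epsilon>_pos by (simp only: pos_divide_le_eq)
  then have "- \<epsilon> * (?t - \<delta>) \<le> ln c" by (simp add: mult.commute)
  then have "exp (- \<epsilon> * (?t - \<delta>)) \<le> exp (ln c)" by (simp only: exp_le_cancel_iff)
  also have "\<dots> = c" using assms by simp
  finally show ?thesis by (intro exI[of _ ?t]) simp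
qed

lemma dist_to_separates:
  assumes a: "a \<in> bdry" and b: "b \<in> bdry" and "a \<noteq> b"
  shows "\<exists>k. dist_to k a \<noteq> dist_to k b"
proof -
  note ac = boundary_in_completion(1)[OF a] and bc = boundary_in_completion(1)[OF b]
  obtain T where T: "ext q a b \<le> ereal T" using ext_bounded[OF assms q] by blast
  define c where "c = exp (- \<epsilon> * (T + 2 * \<delta> + 2)) / 2"
  have c: "0 < c" by (simp add: c_def)
  obtain t where t: "T + 2 * \<delta> + 2 \<le> t" "exp (- \<epsilon> * (t - \<delta>)) \<le> c / 4"
    using exists_small_scale[of "c / 4" "T + 2 * \<delta> + 2"] c by auto
  obtain k where k: "ereal t < ext q (Inl (s k)) a" using exists_near[OF a] by blast
  obtain i where i: "ereal t < ext q (Inl (s i)) b" using exists_near[OF b] by blast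
  note kc = boundary_in_completion(2)[OF s, of k] and ic = boundary_in_completion(2)[OF s, of i]
  have kb: "ext q (Inl (s k)) b \<le> ereal (T + \<delta> + 1)"
  proof (rule ccontr)
    assume "\<not> ?thesis"
    then have 1: "ereal (T + \<delta> + 1) < ext q (Inl (s k)) b" by simp
    have 2: "ereal (T + \<delta> + 1) < ext q a (Inl (s k))"
      using ereal_less_of_le[OF less_imp_le[OF k], of "T + \<delta> + 1"] t(1) \<delta>_pos by (simp add: ext_commute)
    have "ereal (T + \<delta> + 1 - \<delta>) \<le> ext q a b" by (rule ext_hyp[OF ac kc bc q 2 1])
    from order_trans[OF this T] show False by simp
  qed
  have "gp q (s k) (s i) \<le> T + 2 * \<delta> + 2"
  proof (rule ccontr)
    assume "\<not> ?thesis"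
    then have 1: "ereal (T + 2 * \<delta> + 2) < ext q (Inl (s k)) (Inl (s i))" by simp
    have 2: "ereal (T + 2 * \<delta> + 2) < ext q (Inl (s i)) b" using order.strict_trans1[OF _ i] t(1) by simp
    have "ereal (T + 2 * \<delta> + 2 - \<delta>) \<le> ext q (Inl (s k)) b" by (rule ext_hyp[OF kc ic bc q 1 2])
    from order_trans[OF this kb] show False by simp
  qed
  then have "c \<le> w k i / 2" unfolding c_def by (intro divide_right_mono le_w) auto
  then have "c \<le> chain_dist w k i" using chain_dist_lower[of k i] by linarith
  then have "c - c / 4 \<le> dist_to k b" using dist_to_approx[OF b i, of k] t(2) by linarith
  moreover have "dist_to k a \<le> 2 * (c / 4)" using dist_to_near[OF a k] t(2) by linarith
  ultimately have "dist_to k a \<noteq> dist_to k b" using c by linarith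
  then show ?thesis ..
qed

text \<open>
  The sets \<open>{dist_to k < inverse (Suc n)}\<close> form a countable neighbourhood base at the boundary
  points. This supplies the second countability that lets a measure be carried by its support.
\<close>

lemma dist_to_basis:
  assumes \<xi>: "\<xi> \<in> bdry" and V: "openin (gromov_topology S d) V" "\<xi> \<in> V"
  shows "\<exists>k n. dist_to k \<xi> < inverse (Suc n) \<and> (\<forall>\<eta>\<in>bdry. dist_to k \<eta> < inverse (Suc n) \<longrightarrow> \<eta> \<in> V)"
proof -
  note \<xi>c = boundary_in_completion(1)[OF \<xi>]
  obtain t0 where t0: "{\<eta> \<in> compl. ereal t0 < ext q \<eta> \<xi>} \<subseteq> V"
    using V \<xi> q unfolding openin_gromov_topology gromov_open_def by blast
  define t2 where "t2 = t0 + 2 * \<delta> + 2"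
  obtain n where n: "inverse (real (Suc n)) < exp (- \<epsilon> * t2) / 4"
    using reals_Archimedean[of "exp (- \<epsilon> * t2) / 4"] by auto
  define p where "p = inverse (real (Suc n))"
  have p: "0 < p" by (simp add: p_def)
  obtain t where t: "t2 \<le> t" "exp (- \<epsilon> * (t - \<delta>)) \<le> p / 3"
    using exists_small_scale[of "p / 3" t2] p by auto
  obtain k where k: "ereal t < ext q (Inl (s k)) \<xi>" using exists_near[OF \<xi>] by blast
  note kc = boundary_in_completion(2)[OF s, of k]
  have "dist_to k \<xi> < p" using dist_to_near[OF \<xi> k] t(2) p by linarith
  moreover have "\<eta> \<in> V" if \<eta>: "\<eta> \<in> bdry" "dist_to k \<eta> < p" for \<eta>
  proof -
    note \<eta>c = boundary_in_completion(1)[OF \<eta>(1)]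
    obtain i where i: "ereal t < ext q (Inl (s i)) \<eta>" using exists_near[OF \<eta>(1)] by blast
    note ic = boundary_in_completion(2)[OF s, of i]
    have "w k i / 2 \<le> p + p / 3"
      using chain_dist_lower[of k i] dist_to_approx[OF \<eta>(1) i, of k] \<eta>(2) t(2) by linarith
    then have "w k i < exp (- \<epsilon> * t2)" using n p unfolding p_def by linarith
    then have "t2 < gp q (s k) (s i)" using le_w[of k i t2] by (meson not_le)
    then have 1: "ereal t2 < ext q (Inl (s k)) (Inl (s i))" by simp
    have 2: "ereal t2 < ext q (Inl (s i)) \<eta>" using order.strict_trans1[OF _ i] t(1) by simp
    have "ereal (t2 - \<delta>) \<le> ext q (Inl (s k)) \<eta>" by (rule ext_hyp[OF kc ic \<eta>c q 1 2])
    then have 3: "ereal (t2 - \<delta> - 1) < ext q \<eta> (Inl (s k))"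
      unfolding ext_commute[of q \<eta>] by (rule ereal_less_of_le) simp
    have 4: "ereal (t2 - \<delta> - 1) < ext q (Inl (s k)) \<xi>"
      by (rule ereal_less_of_le[OF less_imp_le[OF k]]) (use t(1) \<delta>_pos in simp)
    have "ereal (t2 - \<delta> - 1 - \<delta>) \<le> ext q \<eta> \<xi>" by (rule ext_hyp[OF \<eta>c kc \<xi>c q 3 4])
    then have "ereal t0 < ext q \<eta> \<xi>" by (rule ereal_less_of_le) (simp add: t2_def)
    then show ?thesis using t0 \<eta>c by blast
  qed
  ultimately show ?thesis unfolding p_def by blast
qed

lemma dist_to_continuous:
  assumes L: "L \<subseteq> bdry"
  shows "continuous_map (subtopology (gromov_topology S d) L) euclideanreal (dist_to k)"
proof -
  have top: "topspace (subtopology (gromov_topology S d) L) = L"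
    using L boundary_in_completion(1) by (auto simp: topspace_gromov_topology[OF Metric_space_axioms])
  show ?thesis
    unfolding continuous_map_def top
  proof (intro conjI allI impI)
    fix U :: "real set" assume U: "openin euclideanreal U"
    show "openin (subtopology (gromov_topology S d) L) {\<xi> \<in> L. dist_to k \<xi> \<in> U}"
    proof (subst openin_subopen, intro ballI)
      fix \<xi> assume \<xi>: "\<xi> \<in> {\<xi> \<in> L. dist_to k \<xi> \<in> U}"
      then obtain e where e: "e > 0" "\<And>y. \<bar>y - dist_to k \<xi>\<bar> < e \<Longrightarrow> y \<in> U"
        using U by (auto simp: open_real)
      obtain t where t: "exp (- \<epsilon> * (t - \<delta>)) \<le> e / 4" using exists_small_scale[of "e / 4"] e by auto
      obtain V where V: "openin (gromov_topology S d) V" "\<xi> \<in> V"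
        "\<And>\<eta>. \<eta> \<in> V \<Longrightarrow> \<eta> \<in> compl \<and> ereal (t + \<delta> + 1) < ext q \<eta> \<xi>"
        using boundary_neighbourhood[of \<xi> q "t + \<delta> + 1"] \<xi> L q by blast
      have "dist_to k \<eta> \<in> U" if \<eta>: "\<eta> \<in> V" "\<eta> \<in> L" for \<eta>
      proof (rule e(2))
        have "\<bar>dist_to k \<eta> - dist_to k \<xi>\<bar> \<le> 2 * exp (- \<epsilon> * (t + \<delta> + 1 - 2 * \<delta> - 1))"
          using \<eta> \<xi> L V(3) by (intro dist_to_Lipschitz) auto
        also have "t + \<delta> + 1 - 2 * \<delta> - 1 = t - \<delta>" by simp
        finally show "\<bar>dist_to k \<eta> - dist_to k \<xi>\<bar> < e" using t e(1) by linarith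
      qed
      then show "\<exists>T. openin (subtopology (gromov_topology S d) L) T \<and> \<xi> \<in> T \<and> T \<subseteq> {\<xi> \<in> L. dist_to k \<xi> \<in> U}"
        using V(1,2) \<xi> by (intro exI[of _ "V \<inter> L"]) (auto simp: openin_subtopology)
    qed
  qed simp
qed

end


section \<open>Isometries, and measures on the boundary with two-point support\<close>

text \<open>
  The inverse \<open>g\<close> is part of the data, so that every statement about \<open>f\<close> holds for \<open>g\<close> by
  symmetry.
\<close>

locale isometric_pair =
  X: hyperbolic_space S d \<delta> + Y: hyperbolic_space S' d \<delta>' for S S' :: "'b set" and d \<delta> \<delta>' +
  fixes f g :: "'b \<Rightarrow> 'b"
  assumes f: "\<And>a. a \<in> S \<Longrightarrow> f a \<in> S'" and g: "\<And>b. b \<in> S' \<Longrightarrow> g b \<in> S"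
    and gf: "\<And>a. a \<in> S \<Longrightarrow> g (f a) = a" and fg: "\<And>b. b \<in> S' \<Longrightarrow> f (g b) = b"
    and isom: "\<And>a b. a \<in> S \<Longrightarrow> b \<in> S \<Longrightarrow> d (f a) (f b) = d a b"
begin

lemma gp_isometry: "z \<in> S \<Longrightarrow> a \<in> S \<Longrightarrow> b \<in> S \<Longrightarrow> gromov_product d (f z) (f a) (f b) = gromov_product d z a b"
  by (simp add: gromov_product_def isom)

lemma diverge_together_isometry:
  assumes "range u \<subseteq> S" "range v \<subseteq> S"
  shows "diverge_together S' d (f \<circ> u) (f \<circ> v) \<longleftrightarrow> diverge_together S d u v"
proof -
  have uS: "u i \<in> S" and vS: "v i \<in> S" for i using assms by auto
  have eq: "gromov_product d (f z) ((f \<circ> u) i) ((f \<circ> v) j) = gromov_product d z (u i) (v j)" if "z \<in> S"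
      for z i j
    using gp_isometry[OF that uS vS] by simp
  have ball: "(\<forall>z'\<in>S'. Q z') \<longleftrightarrow> (\<forall>z\<in>S. Q (f z))" for Q using f g fg by metis
  show ?thesis
    unfolding X.diverge_together_iff Y.diverge_together_iff ball using eq by simp
qed

lemma boundary_rel_isometry:
  assumes "(u, v) \<in> boundary_rel S d" shows "(f \<circ> u, f \<circ> v) \<in> boundary_rel S' d"
  using assms f by (auto simp: boundary_rel_def gromov_sequences_def diverge_together_isometry
      image_subset_iff)

lemma representatives_ext_isometry:
  "representatives (ext_isometry f \<xi>) = (\<lambda>u. f \<circ> u) ` representatives \<xi>"
  by (cases \<xi>) (auto simp: comp_def)

lemma ext_isometry_product:
  assumes "z \<in> S" "\<xi> \<in> gromov_completion S d" "\<eta> \<in> gromov_completion S d"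
  shows "ext_gromov_product d (f z) (ext_isometry f \<xi>) (ext_isometry f \<eta>) = ext_gromov_product d z \<xi> \<eta>"
proof -
  have eq: "gromov_product d (f z) (f (u i)) (f (v j)) = gromov_product d z (u i) (v j)"
    if "u \<in> representatives \<xi>" "v \<in> representatives \<eta>" for u v i j
    by (rule gp_isometry[OF assms(1) X.representatives_in[OF assms(2) that(1)] X.representatives_in[OF
        assms(3) that(2)]])
  show ?thesis
    unfolding ext_gromov_product_def representatives_ext_isometry INF_image
    by (intro INF_cong refl) (simp add: eq)
qed

lemma ext_isometry_inverse:
  assumes "\<xi> \<in> gromov_completion S d" shows "ext_isometry g (ext_isometry f \<xi>) = \<xi>"
proof (cases \<xi>)
  case (Inl a)
  then have "a \<in> S" using assms by (auto simp: gromov_completion_def gromov_boundary_def)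
  then show ?thesis using Inl gf by simp
next
  case (Inr C)
  have "g \<circ> (f \<circ> u) = u" if "u \<in> C" for u
    using X.representatives_in[OF assms, of u] that Inr gf by (auto simp: fun_eq_iff)
  then have "(\<lambda>u. g \<circ> u) ` (\<lambda>u. f \<circ> u) ` C = C" by (force simp: image_image)
  then show ?thesis using Inr by simp
qed

end

sublocale isometric_pair \<subseteq> inv: isometric_pair S' S d \<delta>' \<delta> g f
proof
  show "d (g a) (g b) = d a b" if "a \<in> S'" "b \<in> S'" for a b
    using isom[OF g[OF that(1)] g[OF that(2)]] fg that by simp
qed (auto simp: f g gf fg)

context isometric_pair
begin

lemma ext_isometry_boundary:
  assumes "\<xi> \<in> gromov_boundary S d" shows "ext_isometry f \<xi> \<in> gromov_boundary S' d"
proof -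
  obtain u where u: "u \<in> gromov_sequences S d" "\<xi> = Inr (boundary_rel S d `` {u})"
    using assms by (auto simp: gromov_boundary_def quotient_def)
  have "(\<lambda>v. f \<circ> v) ` (boundary_rel S d `` {u}) = boundary_rel S' d `` {f \<circ> u}"
  proof (intro equalityI subsetI)
    fix v assume "v \<in> boundary_rel S' d `` {f \<circ> u}"
    then have v: "(f \<circ> u, v) \<in> boundary_rel S' d" by simp
    then have "(g \<circ> (f \<circ> u), g \<circ> v) \<in> boundary_rel S d" by (rule inv.boundary_rel_isometry)
    moreover have "g \<circ> (f \<circ> u) = u"
      using u(1) gf by (auto simp: gromov_sequences_def fun_eq_iff)
    moreover have "v i \<in> S'" for i using v by (auto simp: boundary_rel_def gromov_sequences_def)
    then have "f \<circ> (g \<circ> v) = v" using fg by (simp add: fun_eq_iff)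
    ultimately show "v \<in> (\<lambda>v. f \<circ> v) ` (boundary_rel S d `` {u})" by (metis Image_singleton_iff image_eqI)
  qed (auto intro: boundary_rel_isometry)
  moreover have "f \<circ> u \<in> gromov_sequences S' d"
    using u(1) f by (auto simp: gromov_sequences_def diverge_together_isometry image_subset_iff)
  ultimately show ?thesis
    unfolding u(2) gromov_boundary_def by (auto simp: quotient_def)
qed

lemma ext_isometry_completion:
  assumes "\<xi> \<in> gromov_completion S d" shows "ext_isometry f \<xi> \<in> gromov_completion S' d"
  using assms ext_isometry_boundary f by (auto simp: gromov_completion_def)

lemma ext_isometry_continuous:
  "continuous_map (gromov_topology S d) (gromov_topology S' d) (ext_isometry f)"
  unfolding continuous_map_def topspace_gromov_topology[OF X.Metric_space_axioms]
    topspace_gromov_topology[OF Y.Metric_space_axioms]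
proof (intro conjI allI impI)
  show "ext_isometry f \<in> gromov_completion S d \<rightarrow> gromov_completion S' d"
    using ext_isometry_completion by blast
  fix U assume "openin (gromov_topology S' d) U"
  then have U: "openin Y.mtopology {a. Inl a \<in> U}"
    "\<And>\<xi> z. \<xi> \<in> U \<inter> gromov_boundary S' d \<Longrightarrow> z \<in> S' \<Longrightarrow>
      \<exists>t::real. {\<eta> \<in> gromov_completion S' d. ext_gromov_product d z \<eta> \<xi> > ereal t} \<subseteq> U"
    unfolding openin_gromov_topology gromov_open_def by blast+
  let ?V = "{\<xi> \<in> gromov_completion S d. ext_isometry f \<xi> \<in> U}"
  have inS: "Inl a \<in> gromov_completion S d \<longleftrightarrow> a \<in> S" for a
    by (auto simp: gromov_completion_def gromov_boundary_def)
  have "openin X.mtopology {a. Inl a \<in> ?V}"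
    unfolding X.openin_mtopology
  proof (intro conjI allI impI)
    show "{a. Inl a \<in> ?V} \<subseteq> S" by (auto simp: inS)
    fix a assume "a \<in> {a. Inl a \<in> ?V}"
    then have a: "a \<in> S" "f a \<in> {a. Inl a \<in> U}" by (auto simp: inS)
    then obtain r where r: "r > 0" "Y.mball (f a) r \<subseteq> {a. Inl a \<in> U}"
      using U(1) unfolding Y.openin_mtopology by blast
    have "X.mball a r \<subseteq> {a. Inl a \<in> ?V}"
    proof
      fix b assume b: "b \<in> X.mball a r"
      then have "f b \<in> Y.mball (f a) r" using f isom by auto
      then show "b \<in> {a. Inl a \<in> ?V}" using r(2) b by (auto simp: inS)
    qed
    then show "\<exists>r>0. X.mball a r \<subseteq> {a. Inl a \<in> ?V}" using r(1) by blast
  qed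
  moreover have "\<exists>t::real. {\<eta> \<in> gromov_completion S d. ext_gromov_product d z \<eta> \<xi> > ereal t} \<subseteq> ?V"
    if \<xi>: "\<xi> \<in> ?V \<inter> gromov_boundary S d" and z: "z \<in> S" for \<xi> z
  proof -
    obtain t where t: "{\<eta> \<in> gromov_completion S' d. ext_gromov_product d (f z) \<eta> (ext_isometry f \<xi>) > ereal t}
        \<subseteq> U"
      using U(2)[of "ext_isometry f \<xi>" "f z"] \<xi> z f ext_isometry_boundary by blast
    have "{\<eta> \<in> gromov_completion S d. ext_gromov_product d z \<eta> \<xi> > ereal t} \<subseteq> ?V"
      using t ext_isometry_product[OF z] ext_isometry_completion \<xi> by fastforce
    then show ?thesis ..
  qed
  ultimately show "openin (gromov_topology S d) ?V"
    unfolding openin_gromov_topology gromov_open_def by blast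
qed

lemma ext_isometry_inj: "inj_on (ext_isometry f) (gromov_completion S d)"
  by (rule inj_on_inverseI) (rule ext_isometry_inverse)

lemma ext_isometry_closure_boundary:
  assumes "f ` Q \<subseteq> Q'"
    and \<xi>: "\<xi> \<in> (gromov_topology S d closure_of (Inl ` Q)) \<inter> gromov_boundary S d"
  shows "ext_isometry f \<xi> \<in> (gromov_topology S' d closure_of (Inl ` Q')) \<inter> gromov_boundary S' d"
proof -
  have "ext_isometry f \<xi> \<in> gromov_topology S' d closure_of (ext_isometry f ` Inl ` Q)"
    using continuous_map_image_closure_subset[OF ext_isometry_continuous] \<xi> by blast
  also have "\<dots> \<subseteq> gromov_topology S' d closure_of (Inl ` Q')"
    using assms(1) by (intro closure_of_mono) auto
  finally show ?thesis using \<xi> ext_isometry_boundary by blast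
qed

end

lemma continuous_map_measurable_borel_of:
  assumes "continuous_map T T' f" shows "f \<in> borel_of T \<rightarrow>\<^sub>M borel_of T'"
proof (rule measurable_sigma_sets[OF sets_borel_of])
  show "{U. openin T' U} \<subseteq> Pow (topspace T')" by (auto dest: openin_subset)
  show "f \<in> space (borel_of T) \<rightarrow> topspace T'" using assms by (auto simp: continuous_map_def)
  fix U assume "U \<in> {U. openin T' U}"
  then have "openin T {x \<in> topspace T. f x \<in> U}" using assms by (auto simp: continuous_map_def)
  moreover have "f -` U \<inter> space (borel_of T) = {x \<in> topspace T. f x \<in> U}" by auto
  ultimately show "f -` U \<inter> space (borel_of T) \<in> sets (borel_of T)"
    by (simp add: sets_borel_of sigma_sets.Basic)
qed

lemma openin_sets_borel_of: "openin T U \<Longrightarrow> U \<in> sets (borel_of T)"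
  by (simp add: sets_borel_of sigma_sets.Basic)

lemma msupport_distr:
  assumes f: "continuous_map T T' f" and N: "sets N = sets (borel_of T)" and \<xi>: "\<xi> \<in> msupport T N"
  shows "f \<xi> \<in> msupport T' (distr N (borel_of T') f)"
  unfolding msupport_def
proof (intro CollectI conjI allI impI)
  have "\<xi> \<in> topspace T" using \<xi> by (simp add: msupport_def)
  then show "f \<xi> \<in> topspace T'" using f by (auto simp: continuous_map_def)
  fix U assume U: "openin T' U \<and> f \<xi> \<in> U"
  have space: "space N = topspace T" using sets_eq_imp_space_eq[OF N] by simp
  have fm: "f \<in> N \<rightarrow>\<^sub>M borel_of T'"
    using continuous_map_measurable_borel_of[OF f] measurable_cong_sets[OF N refl] by blast
  have "openin T {x \<in> topspace T. f x \<in> U}" using f U by (auto simp: continuous_map_def)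
  then have "0 < emeasure N {x \<in> topspace T. f x \<in> U}"
    using \<xi> U \<open>\<xi> \<in> topspace T\<close> unfolding msupport_def by blast
  also have "{x \<in> topspace T. f x \<in> U} = f -` U \<inter> space N" unfolding space by auto
  also have "emeasure N \<dots> = emeasure (distr N (borel_of T') f) U"
    using U by (intro emeasure_distr[symmetric, OF fm] openin_sets_borel_of) auto
  finally show "0 < emeasure (distr N (borel_of T') f) U" .
qed

context dense_hyperbolic_space
begin

context
  fixes L N
  assumes L: "L \<subseteq> gromov_boundary S d"
    and prob: "prob_space N" and sets_N: "sets N = sets (borel_of (subtopology (gromov_topology S d) L))"
begin

abbreviation (input) "TL \<equiv> subtopology (gromov_topology S d) L"

lemma topspace_TL: "topspace TL = L"
  using L boundary_in_completion(1) by (auto simp: topspace_gromov_topology[OF Metric_space_axioms])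

lemma space_N: "space N = L"
  using sets_eq_imp_space_eq[OF sets_N, unfolded space_borel_of topspace_TL] .

lemma dist_to_measurable: "dist_to k \<in> borel_measurable N"
proof -
  have "dist_to k \<in> borel_of TL \<rightarrow>\<^sub>M borel_of euclideanreal"
    by (rule continuous_map_measurable_borel_of[OF dist_to_continuous[OF L]])
  moreover have "sets (borel_of euclideanreal) = sets (borel :: real measure)"
    by (simp add: sets_borel_of borel_def)
  ultimately show ?thesis using measurable_cong_sets[OF sets_N] by blast
qed

text \<open>
  The complement of the support is covered by countably many null sets of the base above.
\<close>

lemma AE_msupport: "AE \<xi> in N. \<xi> \<in> msupport TL N"
proof -
  define W where "W k n = {\<eta> \<in> L. dist_to k \<eta> < inverse (Suc n)}" for k n
  note [measurable] = dist_to_measurable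
  have W: "W k n \<in> sets N" for k n
  proof -
    have "W k n = {\<eta> \<in> space N. dist_to k \<eta> < inverse (Suc n)}" by (simp add: W_def space_N)
    then show ?thesis by simp
  qed
  have "AE \<xi> in N. emeasure N (W k n) = 0 \<longrightarrow> \<xi> \<notin> W k n" for k n
    using W[of k n] by (cases "emeasure N (W k n) = 0") (auto intro!: AE_not_in simp: null_sets_def)
  then have "AE \<xi> in N. \<forall>k n. emeasure N (W k n) = 0 \<longrightarrow> \<xi> \<notin> W k n" by (simp add: AE_all_countable)
  then show ?thesis using AE_space
  proof eventually_elim
    case (elim \<xi>)
    then have \<xi>: "\<xi> \<in> L" by (simp add: space_N)
    show ?case
    proof (rule ccontr)
      assume "\<not> ?thesis"
      then obtain U where U: "openin TL U" "\<xi> \<in> U" "emeasure N U = 0"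
        using \<xi> unfolding msupport_def topspace_TL by auto
      then obtain V where V: "openin (gromov_topology S d) V" "U = V \<inter> L" by (auto simp: openin_subtopology)
      obtain k n where kn: "dist_to k \<xi> < inverse (Suc n)"
        "\<And>\<eta>. \<eta> \<in> bdry \<Longrightarrow> dist_to k \<eta> < inverse (Suc n) \<Longrightarrow> \<eta> \<in> V"
        using dist_to_basis[of \<xi> V] V U(2) \<xi> L by blast
      have "W k n \<subseteq> U" unfolding W_def V(2) using kn(2) L by blast
      moreover have "U \<in> sets N" using openin_sets_borel_of[OF U(1)] sets_N by simp
      ultimately have "emeasure N (W k n) = 0" using U(3) emeasure_mono[of "W k n" U N] by simp
      then show False using elim(1) kn(1) \<xi> unfolding W_def by blast
    qed
  qed
qed

definition "variance_of k = (\<integral>\<xi>. (dist_to k \<xi>)\<^sup>2 \<partial>N) - (\<integral>\<xi>. dist_to k \<xi> \<partial>N)\<^sup>2"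

lemma integral_square_deviation: "(\<integral>\<xi>. (dist_to k \<xi> - c)\<^sup>2 \<partial>N) = variance_of k + ((\<integral>\<xi>. dist_to k \<xi> \<partial>N) - c)\<^sup>2"
proof -
  interpret N: prob_space N by (rule prob)
  note [measurable] = dist_to_measurable
  have int1: "integrable N (dist_to k)"
    by (rule N.integrable_const_bound[of _ 1]) (use dist_to_bounds[of k] in \<open>auto simp: abs_le_iff intro:
        order_trans[of _ 0]\<close>)
  have int2: "integrable N (\<lambda>\<xi>. (dist_to k \<xi>)\<^sup>2)"
    by (rule N.integrable_const_bound[of _ 1])
      (use dist_to_bounds[of k] in \<open>auto simp: power_le_one\<close>)
  have "(\<integral>\<xi>. (dist_to k \<xi> - c)\<^sup>2 \<partial>N) = (\<integral>\<xi>. (dist_to k \<xi>)\<^sup>2 - 2 * c * dist_to k \<xi> + c\<^sup>2 \<partial>N)"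
    by (intro Bochner_Integration.integral_cong refl) (simp add: power2_diff)
  also have "\<dots> = (\<integral>\<xi>. (dist_to k \<xi>)\<^sup>2 \<partial>N) - 2 * c * (\<integral>\<xi>. dist_to k \<xi> \<partial>N) + c\<^sup>2"
    using int1 int2 by (simp add: N.prob_space)
  finally show ?thesis by (simp add: variance_of_def power2_diff)
qed

text \<open>
  Any constant approximates at least as badly as the mean does, in particular the value at \<open>a\<close>.
\<close>

lemma variance_le_of_two_point_support:
  assumes "msupport TL N = {a, b}"
  shows "variance_of k \<le> (dist_to k a - dist_to k b)\<^sup>2"
proof -
  interpret N: prob_space N by (rule prob)
  note [measurable] = dist_to_measurable
  have AE: "AE \<xi> in N. (dist_to k \<xi> - dist_to k a)\<^sup>2 \<le> (dist_to k a - dist_to k b)\<^sup>2"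
    using AE_msupport unfolding assms by eventually_elim (auto simp: power2_commute)
  have "variance_of k \<le> (\<integral>\<xi>. (dist_to k \<xi> - dist_to k a)\<^sup>2 \<partial>N)"
    unfolding integral_square_deviation by simp
  also have "\<dots> \<le> (\<integral>\<xi>. (dist_to k a - dist_to k b)\<^sup>2 \<partial>N)"
  proof (rule integral_mono_AE[OF _ _ AE])
    show "integrable N (\<lambda>\<xi>. (dist_to k \<xi> - dist_to k a)\<^sup>2)"
      by (rule N.integrable_const_bound[of _ "(dist_to k a - dist_to k b)\<^sup>2"]) (use AE in auto)
  qed simp
  also have "\<dots> = (dist_to k a - dist_to k b)\<^sup>2" by (simp add: N.prob_space)
  finally show ?thesis .
qed

text \<open>
  A continuous function of variance \<open>0\<close> is constant on the support, but some \<open>dist_to k\<close> separates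
  \<open>a\<close> from \<open>b\<close>.
\<close>

lemma exists_positive_variance:
  assumes ab: "a \<in> msupport TL N" "b \<in> msupport TL N" "a \<noteq> b"
  shows "\<exists>k. 0 < variance_of k"
proof (rule ccontr)
  assume "\<not> ?thesis"
  then have V: "variance_of k \<le> 0" for k by (meson not_le)
  interpret N: prob_space N by (rule prob)
  note [measurable] = dist_to_measurable
  have eq: "dist_to k c = (\<integral>\<xi>. dist_to k \<xi> \<partial>N)" if c: "c \<in> msupport TL N" for c k
  proof (rule ccontr)
    let ?m = "\<integral>\<xi>. dist_to k \<xi> \<partial>N"
    assume ne: "dist_to k c \<noteq> ?m"
    have "(\<integral>\<xi>. (dist_to k \<xi> - ?m)\<^sup>2 \<partial>N) \<le> 0" using V[of k] by (simp add: integral_square_deviation)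
    then have "(\<integral>\<xi>. (dist_to k \<xi> - ?m)\<^sup>2 \<partial>N) = 0" by (intro antisym integral_nonneg) auto
    moreover have "integrable N (\<lambda>\<xi>. (dist_to k \<xi> - ?m)\<^sup>2)"
    proof (rule N.integrable_const_bound[of _ "(1 + \<bar>?m\<bar>)\<^sup>2"])
      have "\<bar>dist_to k \<xi> - ?m\<bar> \<le> 1 + \<bar>?m\<bar>" for \<xi> using dist_to_bounds[of k \<xi>] by linarith
      then have "\<bar>dist_to k \<xi> - ?m\<bar>\<^sup>2 \<le> (1 + \<bar>?m\<bar>)\<^sup>2" for \<xi> by (intro power_mono) auto
      then show "AE \<xi> in N. norm ((dist_to k \<xi> - ?m)\<^sup>2) \<le> (1 + \<bar>?m\<bar>)\<^sup>2" by simp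
    qed simp
    ultimately have "AE \<xi> in N. (dist_to k \<xi> - ?m)\<^sup>2 = 0"
      by (subst (asm) integral_nonneg_eq_0_iff_AE) auto
    then have AE: "AE \<xi> in N. dist_to k \<xi> = ?m" by simp
    let ?U = "{\<xi> \<in> L. dist_to k \<xi> \<in> - {?m}}"
    have "openin TL ?U"
      using dist_to_continuous[OF L, of k] unfolding continuous_map_def topspace_TL
          by (auto simp del: Compl_iff)
    moreover have "c \<in> ?U" using c ne by (auto simp: msupport_def topspace_TL)
    ultimately have "0 < emeasure N ?U" using c by (auto simp: msupport_def simp del: Compl_iff)
    moreover have "emeasure N ?U = 0"
    proof -
      have "?U = {\<xi> \<in> space N. dist_to k \<xi> \<noteq> ?m}" by (auto simp: space_N)
      then show ?thesis using AE by (simp add: AE_iff_measurable[OF _ refl])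
    qed
    ultimately show False by simp
  qed
  have "a \<in> bdry" "b \<in> bdry" using ab L by (auto simp: msupport_def topspace_TL)
  then show False using dist_to_separates[OF _ _ ab(3)] eq[OF ab(1)] eq[OF ab(2)] by fastforce
qed

end

text \<open>
  If \<open>(a|b)\<close> were larger than this bound, the Lipschitz estimate would force the two values of
  \<open>dist_to k\<close> to be too close.
\<close>

lemma product_bound_of_dist_to_gap:
  assumes ab: "a \<in> bdry" "b \<in> bdry" and gap: "inverse (Suc m) < (dist_to k a - dist_to k b)\<^sup>2"
  shows "ext q a b \<le> ereal (2 * \<delta> + 1 + ln (2 * real (Suc m)) / \<epsilon>)"
proof (rule ccontr)
  define t where "t = 2 * \<delta> + 1 + ln (2 * real (Suc m)) / \<epsilon>"
  assume "\<not> ?thesis"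
  then have "ereal t < ext q a b" by (simp add: t_def)
  from dist_to_Lipschitz[OF ab this, of k]
  have "\<bar>dist_to k a - dist_to k b\<bar> \<le> 2 * exp (- \<epsilon> * (t - 2 * \<delta> - 1))" .
  also have "- \<epsilon> * (t - 2 * \<delta> - 1) = - ln (2 * real (Suc m))" using \<epsilon>_pos by (simp add: t_def)
  also have "2 * exp (- ln (2 * real (Suc m))) = inverse (Suc m)"
    by (simp add: exp_minus field_simps)
  finally have le: "\<bar>dist_to k a - dist_to k b\<bar> \<le> inverse (Suc m)" .
  have "(dist_to k a - dist_to k b)\<^sup>2 \<le> (inverse (real (Suc m)))\<^sup>2"
    using le by (metis abs_ge_zero power2_abs power_mono)
  also have "\<dots> \<le> inverse (real (Suc m))"
    unfolding power2_eq_square by (rule mult_left_le) (auto simp: field_simps)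
  finally show False using gap by simp
qed

end


section \<open>The bundle and its action\<close>

locale hyperbolic_orbit_bundle =
  fixes M :: "'a measure" and R and H :: "'b measure" and p d and \<alpha> :: "'a \<Rightarrow> 'a \<Rightarrow> 'b \<Rightarrow> 'b" and \<sigma>
  assumes main: "main_assumption M R H p d \<alpha> \<sigma>"

sublocale hyperbolic_orbit_bundle \<subseteq> pmp_relation M R
  using main unfolding main_assumption_def pmp_relation_def pmp_relation_axioms_def by blast

context hyperbolic_orbit_bundle
begin

abbreviation "S x \<equiv> fiber H p x"
abbreviation "TG x \<equiv> gromov_topology (S x) d"

lemma total_bundle: "metric_bundle M H p d" and H_standard: "standard_borel H"
    and p_measurable[measurable]: "p \<in> H \<rightarrow>\<^sub>M M"
  using main unfolding main_assumption_def hyperbolic_bundle_def metric_bundle_def borel_bundle_def by auto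

lemma metric_fiber: "x \<in> space M \<Longrightarrow> Metric_space (S x) d"
  using total_bundle unfolding metric_bundle_def by blast

lemma fiber_base: "b \<in> S x \<Longrightarrow> p b = x" by (simp add: fiber_def)

lemma sectionD:
  assumes "borel_section M H p s"
  shows "s \<in> M \<rightarrow>\<^sub>M H" "x \<in> space M \<Longrightarrow> s x \<in> S x"
  using assms by (auto simp: borel_section_def)

lemma \<sigma>: "borel_section M H p \<sigma>" using main unfolding main_assumption_def by blast

lemma section_dist_measurable:
  assumes s: "borel_section M H p s" and s': "borel_section M H p s'"
  shows "(\<lambda>x. d (s x) (s' x)) \<in> borel_measurable M"
proof -
  let ?E = "{(a, b). a \<in> space H \<and> b \<in> space H \<and> p a = p b}"
  have "(\<lambda>x. (s x, s' x)) \<in> M \<rightarrow>\<^sub>M restrict_space (H \<Otimes>\<^sub>M H) ?E"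
    using sectionD[OF s] sectionD[OF s'] by (intro measurable_restrict_space2 measurable_Pair) (auto simp:
        fiber_def)
  moreover have "(\<lambda>(a, b). d a b) \<in> borel_measurable (restrict_space (H \<Otimes>\<^sub>M H) ?E)"
    using total_bundle unfolding metric_bundle_def by blast
  ultimately have "(\<lambda>x. case (s x, s' x) of (a, b) \<Rightarrow> d a b) \<in> borel_measurable M"
    by (rule measurable_compose)
  then show ?thesis by simp
qed

lemma section_gp_measurable:
  assumes "borel_section M H p s1" "borel_section M H p s2" "borel_section M H p s3"
  shows "(\<lambda>x. gromov_product d (s1 x) (s2 x) (s3 x)) \<in> borel_measurable M"
  unfolding gromov_product_def
  using section_dist_measurable[OF assms(2,1)] section_dist_measurable[OF assms(3,1)]
      section_dist_measurable[OF assms(2,3)]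
  by measurable

lemma action:
  assumes "(x, y) \<in> R"
  shows "\<alpha> x y ` S y = S x" "a \<in> S y \<Longrightarrow> b \<in> S y \<Longrightarrow> d (\<alpha> x y a) (\<alpha> x y b) = d a b"
    "(y, z) \<in> R \<Longrightarrow> c \<in> S z \<Longrightarrow> \<alpha> x y (\<alpha> y z c) = \<alpha> x z c"
  using main assms unfolding main_assumption_def isometric_action_def by auto

lemma action_in: "(x, y) \<in> R \<Longrightarrow> a \<in> S y \<Longrightarrow> \<alpha> x y a \<in> S x"
  using action(1) by blast

lemma action_refl:
  assumes x: "x \<in> space M" and a: "a \<in> S x" shows "\<alpha> x x a = a"
proof -
  note xx = R_refl[OF x]
  have "a \<in> \<alpha> x x ` S x" using action(1)[OF xx] a by simp
  then obtain b where b: "b \<in> S x" "a = \<alpha> x x b" by blast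
  show ?thesis unfolding b(2) by (rule action(3)[OF xx xx b(1)])
qed

lemma action_inverse: "(x, y) \<in> R \<Longrightarrow> a \<in> S y \<Longrightarrow> \<alpha> y x (\<alpha> x y a) = a"
  using action(3)[OF R_sym, of x y y a] action_refl[of y a] R_space[of x y] by simp

lemma orbit_action:
  assumes "(y, x) \<in> R" shows "\<alpha> y x ` orbit R \<alpha> \<sigma> x \<subseteq> orbit R \<alpha> \<sigma> y"
proof -
  have "\<alpha> y x (\<alpha> x z (\<sigma> z)) \<in> orbit R \<alpha> \<sigma> y" if "(x, z) \<in> R" for z
  proof -
    have "\<alpha> y x (\<alpha> x z (\<sigma> z)) = \<alpha> y z (\<sigma> z)"
      using R_space that by (intro action(3)[OF assms that] sectionD(2)[OF \<sigma>]) blast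
    then show ?thesis using R_trans[OF assms that] by (auto simp: orbit_def)
  qed
  then show ?thesis by (auto simp: orbit_def)
qed

lemma isometric_pair_action:
  assumes yx: "(y, x) \<in> R" and X: "hyperbolic_space (S x) d \<delta>" and Y: "hyperbolic_space (S y) d \<delta>'"
  shows "isometric_pair (S x) (S y) d \<delta> \<delta>' (\<alpha> y x) (\<alpha> x y)"
proof (rule isometric_pair.intro[OF X Y], unfold_locales)
  show "d (\<alpha> y x a) (\<alpha> y x b) = d a b" if "a \<in> S x" "b \<in> S x" for a b
    using action(2)[OF yx that] .
qed (simp_all add: action_in[OF yx] action_in[OF R_sym[OF yx]] action_inverse[OF yx] action_inverse[OF
    R_sym[OF yx]])

lemma hyperbolic_fiber:
  assumes "x \<in> space M" obtains \<delta> where "hyperbolic_space (S x) d \<delta>"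
proof -
  obtain \<delta> where \<delta>: "\<forall>a\<in>S x. \<forall>y\<in>S x. \<forall>z\<in>S x. \<forall>w\<in>S x.
     gromov_product d z a y \<ge> min (gromov_product d z a w) (gromov_product d z w y) - \<delta>"
    using main assms unfolding main_assumption_def hyperbolic_bundle_def gromov_hyperbolic_def by blast
  have "hyperbolic_space (S x) d (max 0 \<delta>)"
    unfolding hyperbolic_space_def hyperbolic_space_axioms_def using metric_fiber[OF assms] \<delta> by fastforce
  then show thesis by (rule that)
qed

abbreviation "L x \<equiv> limit_set R H p d \<alpha> \<sigma> x"
abbreviation "supp \<nu> x \<equiv> msupport (limit_topology R H p d \<alpha> \<sigma> x) (\<nu> x :: 'b gpoint measure)"

lemma limit_set_subset: "L x \<subseteq> gromov_boundary (S x) d"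
  by (auto simp: limit_set_def)

lemma ext_action_limit_set:
  assumes yx: "(y, x) \<in> R" and X: "hyperbolic_space (S x) d \<delta>" and Y: "hyperbolic_space (S y) d \<delta>'"
  shows "continuous_map (limit_topology R H p d \<alpha> \<sigma> x) (limit_topology R H p d \<alpha> \<sigma> y) (ext_isometry (\<alpha> y x))"
proof -
  interpret isometric_pair "S x" "S y" d \<delta> \<delta>' "\<alpha> y x" "\<alpha> x y" by (rule isometric_pair_action[OF assms])
  have "ext_isometry (\<alpha> y x) \<in> L x \<rightarrow> L y"
    using ext_isometry_closure_boundary[OF orbit_action[OF yx]] unfolding limit_set_def orbit_closure_def
        by blast
  then show ?thesis
    unfolding limit_topology_def
    by (intro continuous_map_into_subtopology continuous_map_from_subtopology ext_isometry_continuous) auto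
qed

lemma support_action:
  assumes yx: "(y, x) \<in> R" and sets: "sets (\<nu> x) = sets (borel_of (limit_topology R H p d \<alpha> \<sigma> x))"
    and push: "distr (\<nu> x) (borel_of (limit_topology R H p d \<alpha> \<sigma> y)) (ext_isometry (\<alpha> y x)) = \<nu> y"
    and card: "card (supp \<nu> x) = 2" "card (supp \<nu> y) = 2"
  shows "supp \<nu> y = ext_isometry (\<alpha> y x) ` supp \<nu> x"
proof -
  obtain \<delta> \<delta>' where X: "hyperbolic_space (S x) d \<delta>" and Y: "hyperbolic_space (S y) d \<delta>'"
    using hyperbolic_fiber R_space[OF yx] by metis
  interpret isometric_pair "S x" "S y" d \<delta> \<delta>' "\<alpha> y x" "\<alpha> x y" by (rule isometric_pair_action[OF yx X Y])
  have "ext_isometry (\<alpha> y x) ` supp \<nu> x \<subseteq> supp \<nu> y"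
    using msupport_distr[OF ext_action_limit_set[OF yx X Y] sets] unfolding push by blast
  moreover have "supp \<nu> x \<subseteq> gromov_completion (S x) d"
    using limit_set_subset X.boundary_in_completion(1) by (fastforce simp: msupport_def limit_topology_def)
  then have "inj_on (ext_isometry (\<alpha> y x)) (supp \<nu> x)" using ext_isometry_inj inj_on_subset by blast
  then have "card (ext_isometry (\<alpha> y x) ` supp \<nu> x) = 2" by (simp add: card_image card)
  ultimately show ?thesis using card by (metis card_gt_0_iff card_subset_eq zero_less_numeral)
qed

text \<open>
  The Borel structure of the action gives a Borel graph to \<open>y \<mapsto> \<alpha> y (\<psi> y) (\<sigma> (\<psi> y))\<close>; a measurable
  selection of this graph is the function itself, almost everywhere.
\<close>

lemma AE_cost_measurable:
  assumes \<psi>: "\<psi> \<in> full_group"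
  obtains c where "c \<in> borel_measurable M" "AE y in M. c y = d (\<sigma> y) (\<alpha> y (\<psi> y) (\<sigma> (\<psi> y)))"
proof -
  note [measurable] = full_groupD(1)[OF \<psi>] sectionD(1)[OF \<sigma>]
  define \<Gamma> where "\<Gamma> = {(a, b). a \<in> space H \<and> b \<in> space H \<and> (p a, p b) \<in> R \<and> \<alpha> (p a) (p b) b = a}"
  have [measurable]: "\<Gamma> \<in> sets (H \<Otimes>\<^sub>M H)"
    using main unfolding main_assumption_def isometric_action_def \<Gamma>_def by (elim conjE)
  define F where "F = {w \<in> space (M \<Otimes>\<^sub>M H). p (snd w) = fst w} \<inter> {w \<in> space (M \<Otimes>\<^sub>M H). (snd w, \<sigma> (\<psi> (fst w)))
      \<in> \<Gamma>}"
  have "{w \<in> space (M \<Otimes>\<^sub>M H). p (snd w) = fst w} \<in> sets (M \<Otimes>\<^sub>M H)"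
    by (rule sets_equaliser[OF standard]) measurable
  moreover have "{w \<in> space (M \<Otimes>\<^sub>M H). (snd w, \<sigma> (\<psi> (fst w))) \<in> \<Gamma>} \<in> sets (M \<Otimes>\<^sub>M H)"
    by measurable
  ultimately have F: "F \<in> sets (M \<Otimes>\<^sub>M H)" unfolding F_def by blast
  have \<sigma>S: "\<sigma> x \<in> S x" if "x \<in> space M" for x using sectionD(2)[OF \<sigma> that] .
  have H_ne: "space H \<noteq> {}" using \<sigma>S not_empty by (auto simp: fiber_def)
  obtain f where f[measurable]: "f \<in> M \<rightarrow>\<^sub>M H" and fAE: "AE x in M. \<forall>y. (x, y) \<in> F \<longrightarrow> (x, f x) \<in> F"
    using AE_measurable_selection[OF finite_measure_axioms H_standard H_ne F] by blast
  define f' where "f' x = (if p (f x) = x then f x else \<sigma> x)" for x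
  have "borel_section M H p f'"
    unfolding borel_section_def
  proof
    have [measurable]: "Measurable.pred M (\<lambda>x. p (f x) = x)" by (rule equaliser_pred) measurable
    show "f' \<in> M \<rightarrow>\<^sub>M H" unfolding f'_def by measurable
    show "\<forall>x\<in>space M. f' x \<in> S x"
      using \<sigma>S measurable_space[OF f] unfolding f'_def by (auto simp: fiber_def)
  qed
  from section_dist_measurable[OF \<sigma> this] have "(\<lambda>x. d (\<sigma> x) (f' x)) \<in> borel_measurable M" .
  moreover have "AE y in M. d (\<sigma> y) (f' y) = d (\<sigma> y) (\<alpha> y (\<psi> y) (\<sigma> (\<psi> y)))"
    using fAE AE_space
  proof eventually_elim
    case (elim y)
    let ?a = "\<alpha> y (\<psi> y) (\<sigma> (\<psi> y))"
    have R: "(y, \<psi> y) \<in> R" using full_groupD(3)[OF \<psi>] elim by blast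
    then have \<psi>y: "\<psi> y \<in> space M" using R_space by blast
    have a: "?a \<in> S y" using action_in[OF R \<sigma>S[OF \<psi>y]] .
    have "(y, ?a) \<in> F"
      unfolding F_def \<Gamma>_def using a \<sigma>S[OF \<psi>y] R elim(2) by (auto simp: space_pair_measure fiber_def)
    then have "(y, f y) \<in> F" using elim by blast
    then have "p (f y) = y" "\<alpha> (p (f y)) (p (\<sigma> (\<psi> y))) (\<sigma> (\<psi> y)) = f y" unfolding F_def \<Gamma>_def by auto
    then have "f' y = ?a" using fiber_base[OF \<sigma>S[OF \<psi>y]] by (simp add: f'_def)
    then show ?case by simp
  qed
  ultimately show thesis by (rule that)
qed

end


section \<open>Borel test functions on the limit bundle\<close>

lemma (in Metric_space) gromov_product_perturb:
  assumes "x \<in> M" "y \<in> M" "z \<in> M" "x' \<in> M" "y' \<in> M" "z' \<in> M"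
  shows "gromov_product d z x y \<le> gromov_product d z' x' y' + (d x x' + d y y' + d z z')"
proof -
  have "d a b \<le> d a a' + d a' b' + d b b'" if "a \<in> M" "b \<in> M" "a' \<in> M" "b' \<in> M" for a b a' b'
    using triangle[of a a' b] triangle[of a' b' b] that commute[of b b'] by simp
  from this[of x z x' z'] this[of y z y' z'] this[of x' y' x y] show ?thesis
    using assms by (simp add: gromov_product_def commute field_simps)
qed

locale separable_orbit_bundle = hyperbolic_orbit_bundle +
  fixes s :: "nat \<Rightarrow> 'a \<Rightarrow> 'b"
  assumes s: "\<And>i. borel_section M H p (s i)"
    and s_dense: "\<And>x. x \<in> space M \<Longrightarrow> Metric_space.mtopology (S x) d closure_of (range (\<lambda>i. s i x)) = S x"
begin

text \<open>
  Hyperbolicity constants vary with the fibre. The base is cut into the sets \<open>uniform_locus l\<close>, on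
  which \<open>slack l\<close> is a hyperbolicity constant; testing on the dense sections with \<open>l + 1\<close> keeps
  these sets measurable, and the remaining \<open>1\<close> pays for passing to arbitrary points.
\<close>

definition slack :: "nat \<Rightarrow> real" where "slack l = real l + 2"

definition uniform_locus :: "nat \<Rightarrow> 'a set" where
  "uniform_locus l = {x \<in> space M. \<forall>i j k m. gromov_product d (s k x) (s i x) (s j x) \<ge>
     min (gromov_product d (s k x) (s i x) (s m x)) (gromov_product d (s k x) (s m x) (s j x)) - (real l +
         1)}"

lemma uniform_locus_sets[measurable]: "uniform_locus l \<in> sets M"
proof -
  note [measurable] = section_gp_measurable[OF s s s]
  show ?thesis unfolding uniform_locus_def by measurable
qed

lemma dense_section:
  assumes x: "x \<in> space M" and a: "a \<in> S x" and e: "e > 0"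
  shows "\<exists>i. d a (s i x) < e"
proof -
  interpret Metric_space "S x" d by (rule metric_fiber[OF x])
  have "a \<in> mtopology closure_of (range (\<lambda>i. s i x))" using s_dense[OF x] a by simp
  then show ?thesis using e unfolding metric_closure_of by (force simp: in_mball)
qed

lemma uniform_locus_hyperbolic:
  assumes x: "x \<in> uniform_locus l"
  shows "dense_hyperbolic_space (S x) d (slack l) (\<sigma> x) (\<lambda>i. s i x)"
proof -
  have xM: "x \<in> space M" using x by (simp add: uniform_locus_def)
  interpret Metric_space "S x" d by (rule metric_fiber[OF xM])
  have sS: "s i x \<in> S x" for i using sectionD(2)[OF s xM] .
  show ?thesis
  proof (unfold_locales, goal_cases)
    case (2 a y z w)
    obtain i j k m where i: "d a (s i x) < 1/6" and j: "d y (s j x) < 1/6" and k: "d z (s k x) < 1/6"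
        and m: "d w (s m x) < 1/6"
      using dense_section[OF xM] 2 by (metis zero_less_divide_1_iff zero_less_numeral)
    \<comment> \<open>moving three points by at most \<open>1/6\<close> changes a product by at most \<open>1/2\<close>, which happens on both sides\<close>
    have 1: "gromov_product d z a w \<le> gromov_product d (s k x) (s i x) (s m x) + (d a (s i x) + d w (s m x) +
        d z (s k x))"
      using 2 sS by (intro gromov_product_perturb)
    have 2: "gromov_product d z w y \<le> gromov_product d (s k x) (s m x) (s j x) + (d w (s m x) + d y (s j x) +
        d z (s k x))"
      using 2 sS by (intro gromov_product_perturb)
    have 3: "gromov_product d (s k x) (s i x) (s j x) \<le> gromov_product d z a y + (d (s i x) a + d (s j x) y +
        d (s k x) z)"
      using \<open>a \<in> S x\<close> \<open>y \<in> S x\<close> \<open>z \<in> S x\<close> sS by (intro gromov_product_perturb)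
    have 4: "gromov_product d (s k x) (s i x) (s j x) \<ge>
     min (gromov_product d (s k x) (s i x) (s m x)) (gromov_product d (s k x) (s m x) (s j x)) - (real l + 1)"
      using x unfolding uniform_locus_def by blast
    show ?case using 1 2 3 4 i j k m unfolding slack_def commute[of "s i x"] commute[of "s j x"] commute[of "s
        k x" z]
      by linarith
  next
    case (6 a e) then show ?case by (rule dense_section[OF xM])
  qed (use sS sectionD(2)[OF \<sigma> xM] in \<open>auto simp: slack_def\<close>)
qed

lemma uniform_locus_cover:
  assumes x: "x \<in> space M" shows "\<exists>l. x \<in> uniform_locus l"
proof -
  obtain \<delta> where "hyperbolic_space (S x) d \<delta>" using hyperbolic_fiber[OF x] by blast
  then interpret hyperbolic_space "S x" d \<delta> .
  obtain l :: nat where l: "\<delta> \<le> real l" using real_arch_simple by blast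
  have sS: "s i x \<in> S x" for i using sectionD(2)[OF s x] .
  have "gromov_product d (s k x) (s i x) (s j x) \<ge>
     min (gromov_product d (s k x) (s i x) (s m x)) (gromov_product d (s k x) (s m x) (s j x)) - (real l + 1)"
         for i j k m
    using hyp[OF sS[of i] sS[of j] sS[of k] sS[of m]] l by linarith
  then show ?thesis unfolding uniform_locus_def using x by blast
qed

definition base_point :: "'b gpoint \<Rightarrow> 'a" where
  "base_point \<xi> = (THE x. x \<in> space M \<and> \<xi> \<in> gromov_completion (S x) d)"

text \<open>
  Sequences that represent a boundary point run in one fibre, so the boundary point determines its
  base point too.
\<close>

lemma base_point_eq:
  assumes x: "x \<in> space M" and \<xi>: "\<xi> \<in> gromov_completion (S x) d"
  shows "base_point \<xi> = x"
  unfolding base_point_def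
proof (rule the_equality)
  fix y assume y: "y \<in> space M \<and> \<xi> \<in> gromov_completion (S y) d"
  obtain \<delta> \<delta>' where "hyperbolic_space (S x) d \<delta>" "hyperbolic_space (S y) d \<delta>'"
    using hyperbolic_fiber x y by metis
  then interpret X: hyperbolic_space "S x" d \<delta> + Y: hyperbolic_space "S y" d \<delta>' .
  obtain u where u: "u \<in> representatives \<xi>" using X.representatives_nonempty[OF \<xi>] by blast
  have "u 0 \<in> S x" "u 0 \<in> S y" using X.representatives_in[OF \<xi> u] Y.representatives_in[OF _ u] y by auto
  then show "y = x" using fiber_base by metis
qed (use assms in blast)

definition chain_section_dist :: "nat \<Rightarrow> nat \<Rightarrow> 'a \<Rightarrow> nat \<Rightarrow> real" where
  "chain_section_dist l k x i =
     chain_dist (visual_weight d (dense_hyperbolic_space.\<epsilon> (slack l)) (\<sigma> x) (\<lambda>i. s i x)) k i"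

text \<open>
  At boundary points of the fibres over \<open>uniform_locus l\<close> this is \<open>dist_to k\<close>, and on all other
  fibres it is constant. The condition on the base point stands inside the infimum so that each
  term is visibly Borel.
\<close>

definition test_function :: "nat \<Rightarrow> nat \<Rightarrow> 'b gpoint \<Rightarrow> real" where
  "test_function l k \<xi> = (SUP n::nat. INF i.
     if base_point \<xi> \<in> uniform_locus l \<and>
        ereal (real n) < ext_gromov_product d (\<sigma> (base_point \<xi>)) \<xi> (Inl (s i (base_point \<xi>)))
     then chain_section_dist l k (base_point \<xi>) i else 1)"

lemma chain_section_dist_measurable[measurable]: "(\<lambda>x. chain_section_dist l k x i) \<in> borel_measurable M"
proof -
  let ?w = "\<lambda>x. visual_weight d (dense_hyperbolic_space.\<epsilon> (slack l)) (\<sigma> x) (\<lambda>i. s i x)"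
  have w[measurable]: "(\<lambda>x. ?w x i j) \<in> borel_measurable M" for i j
    unfolding visual_weight_def using section_gp_measurable[OF \<sigma> s s, of i j] by measurable
  have cost: "(\<lambda>x. chain_cost (?w x) k js i) \<in> borel_measurable M" for js k i
  proof (induction js arbitrary: k)
    case (Cons j js)
    note [measurable] = Cons[of j]
    show ?case unfolding chain_cost.simps by measurable
  qed simp
  show ?thesis
    unfolding chain_section_dist_def chain_dist_def
    by (rule borel_measurable_cINF[OF _ cost]) (auto intro!: chain_dist_properties(1) simp: visual_weight_def)
qed

lemma chain_section_dist_bounds:
  assumes "x \<in> uniform_locus l" shows "0 \<le> chain_section_dist l k x i" "chain_section_dist l k x i \<le> 1"
proof -
  interpret dense_hyperbolic_space "S x" d "slack l" "\<sigma> x" "\<lambda>i. s i x"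
      by (rule uniform_locus_hyperbolic[OF assms])
  show "0 \<le> chain_section_dist l k x i" "chain_section_dist l k x i \<le> 1"
    unfolding chain_section_dist_def by (rule chain_dist_bounds)+
qed

abbreviation "BC \<equiv> bundle_completion_borel M H p d"

text \<open>
  The generators of the Borel structure of the completed bundle do not mention the base point. To
  impose that it lies in \<open>A\<close>, replace the section \<open>s i\<close> by \<open>\<sigma>\<close> outside \<open>A\<close>: products with \<open>\<sigma> x\<close>
  based at \<open>\<sigma> x\<close> vanish, so they never exceed \<open>n\<close>.
\<close>

lemma space_BC: "space BC = bundle_completion M H p d"
  and superlevel_sets: "A \<in> sets M \<Longrightarrow>
    {\<xi> \<in> space BC. base_point \<xi> \<in> A \<and> ereal (real n) < ext_gromov_product d (\<sigma> (base_point \<xi>)) \<xi> (Inl (s i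
        (base_point \<xi>)))} \<in> sets BC"
proof -
  define gen where "gen \<sigma>' \<eta> B = {\<xi>. \<exists>x\<in>space M. \<xi> \<in> gromov_completion (fiber H p x) d \<and>
            ext_gromov_product d (\<eta> x) \<xi> (Inl (\<sigma>' x)) \<in> ereal ` B}" for \<sigma>' \<eta> B
  let ?G = "{gen \<sigma>' \<eta> B | \<sigma>' \<eta> B.
        borel_section M H p \<sigma>' \<and> borel_section M H p \<eta> \<and> B \<in> sets borel \<and> B \<subseteq> {0..}}"
  have BC: "BC = sigma (bundle_completion M H p d) ?G"
    unfolding bundle_completion_borel_def gen_def ..
  have sub: "?G \<subseteq> Pow (bundle_completion M H p d)"
    unfolding gen_def bundle_completion_def by blast
  show sp: "space BC = bundle_completion M H p d" unfolding BC using sub by (rule space_measure_of)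
  have sets: "sets BC = sigma_sets (bundle_completion M H p d) ?G" unfolding BC using sub
      by (rule sets_measure_of)
  assume A[measurable]: "A \<in> sets M"
  note [measurable] = sectionD(1)[OF \<sigma>] sectionD(1)[OF s]
  define \<sigma>' where "\<sigma>' x = (if x \<in> A then s i x else \<sigma> x)" for x
  have \<sigma>': "borel_section M H p \<sigma>'"
    unfolding borel_section_def
  proof
    show "\<sigma>' \<in> M \<rightarrow>\<^sub>M H" unfolding \<sigma>'_def by measurable
  qed (auto simp: \<sigma>'_def intro: sectionD(2)[OF \<sigma>] sectionD(2)[OF s])
  have "gen \<sigma>' \<sigma> {real n<..} \<in> sets BC"
    unfolding sets using \<sigma>' \<sigma>
    by (intro sigma_sets.Basic CollectI exI[of _ \<sigma>'] exI[of _ \<sigma>] exI[of _ "{real n<..}"])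
      (auto intro: order_trans[OF of_nat_0_le_iff less_imp_le])
  also have "gen \<sigma>' \<sigma> {real n<..} = {\<xi> \<in> space BC. base_point \<xi> \<in> A \<and>
    ereal (real n) < ext_gromov_product d (\<sigma> (base_point \<xi>)) \<xi> (Inl (s i (base_point \<xi>)))}"
  proof -
    have "\<xi> \<in> gen \<sigma>' \<sigma> {real n<..} \<longleftrightarrow> x \<in> A \<and> ereal (real n) < ext_gromov_product d (\<sigma> x) \<xi> (Inl (s i x))"
      if x: "x \<in> space M" and \<xi>: "\<xi> \<in> gromov_completion (S x) d" for \<xi> x
    proof -
      obtain \<delta> where "hyperbolic_space (S x) d \<delta>" using hyperbolic_fiber[OF x] by blast
      then interpret hyperbolic_space "S x" d \<delta> .
      have iff: "\<xi> \<in> gen \<sigma>' \<sigma> {real n<..} \<longleftrightarrow> ext_gromov_product d (\<sigma> x) \<xi> (Inl (\<sigma>' x)) \<in> ereal ` {real n<..}"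
        unfolding gen_def using x \<xi> base_point_eq by blast
      have "\<sigma>' x \<in> S x" "\<sigma> x \<in> S x" using sectionD(2)[OF \<sigma>' x] sectionD(2)[OF \<sigma> x] .
      then have le: "ext_gromov_product d (\<sigma> x) \<xi> (Inl (\<sigma>' x)) \<le> ereal (d (\<sigma>' x) (\<sigma> x))"
        using ext_Inl_le \<xi> by (subst ext_commute) blast
      have "ext_gromov_product d (\<sigma> x) \<xi> (Inl (\<sigma>' x)) \<in> ereal ` {real n<..} \<longleftrightarrow>
          ereal (real n) < ext_gromov_product d (\<sigma> x) \<xi> (Inl (\<sigma>' x))"
        using le by (cases "ext_gromov_product d (\<sigma> x) \<xi> (Inl (\<sigma>' x))") auto
      moreover have "\<not> ereal (real n) < ext_gromov_product d (\<sigma> x) \<xi> (Inl (\<sigma>' x))" if "x \<notin> A"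
      proof -
        have "d (\<sigma>' x) (\<sigma> x) = 0" using that \<open>\<sigma> x \<in> S x\<close> by (simp add: \<sigma>'_def)
        then have "ereal (d (\<sigma>' x) (\<sigma> x)) \<le> ereal (real n)" by simp
        then show ?thesis using order_trans[OF le] by (meson leD)
      qed
      ultimately show ?thesis unfolding iff by (auto simp: \<sigma>'_def)
    qed
    moreover have "gen \<sigma>' \<sigma> {real n<..} \<subseteq> bundle_completion M H p d" unfolding gen_def bundle_completion_def
        by blast
    ultimately show ?thesis unfolding sp bundle_completion_def by (auto simp: base_point_eq)
  qed
  finally show "{\<xi> \<in> space BC. base_point \<xi> \<in> A \<and>
    ereal (real n) < ext_gromov_product d (\<sigma> (base_point \<xi>)) \<xi> (Inl (s i (base_point \<xi>)))} \<in> sets BC" .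
qed

lemma test_function_measurable: "test_function l k \<in> borel_measurable BC"
proof -
  define h where "h n i \<xi> = (if base_point \<xi> \<in> uniform_locus l \<and>
        ereal (real n) < ext_gromov_product d (\<sigma> (base_point \<xi>)) \<xi> (Inl (s i (base_point \<xi>)))
     then chain_section_dist l k (base_point \<xi>) i else 1)" for n i \<xi>
  have bounds: "0 \<le> h n i \<xi>" "h n i \<xi> \<le> 1" for n i \<xi>
    unfolding h_def using chain_section_dist_bounds by auto
  have h: "h n i \<in> borel_measurable BC" for n i
    unfolding borel_measurable_iff_less
  proof
    fix c :: real
    show "{\<xi> \<in> space BC. h n i \<xi> < c} \<in> sets BC"
    proof (cases "c > 1")
      case True
      then have "{\<xi> \<in> space BC. h n i \<xi> < c} = space BC" using order.strict_trans1[OF bounds(2)] by blast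
      then show ?thesis by simp
    next
      case False
      let ?A = "{x \<in> space M. x \<in> uniform_locus l \<and> chain_section_dist l k x i < c}"
      have "?A \<in> sets M" by measurable
      moreover have "{\<xi> \<in> space BC. h n i \<xi> < c} = {\<xi> \<in> space BC. base_point \<xi> \<in> ?A \<and>
          ereal (real n) < ext_gromov_product d (\<sigma> (base_point \<xi>)) \<xi> (Inl (s i (base_point \<xi>)))}"
        using False unfolding h_def by (auto simp: uniform_locus_def split: if_splits)
      ultimately show ?thesis using superlevel_sets[of ?A n i] by (simp only:)
    qed
  qed
  have bdd: "bdd_below (range (\<lambda>i. h n i \<xi>))" for n \<xi> by (rule bdd_belowI[of _ 0]) (auto simp: bounds)
  have inf: "(\<lambda>\<xi>. INF i. h n i \<xi>) \<in> borel_measurable BC" for n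
    by (rule borel_measurable_cINF[OF _ h]) (auto simp: bdd)
  have "(\<lambda>\<xi>. SUP n. INF i. h n i \<xi>) \<in> borel_measurable BC"
  proof (rule borel_measurable_cSUP[OF _ inf])
    show "bdd_above (range (\<lambda>n. INF i. h n i \<xi>))" for \<xi>
      by (rule bdd_aboveI[of _ 1]) (auto intro: order_trans[OF cINF_lower[OF bdd, of 0] bounds(2)])
  qed simp
  then show ?thesis unfolding test_function_def h_def .
qed

lemma test_function_eq:
  assumes x: "x \<in> uniform_locus l" and \<xi>: "\<xi> \<in> gromov_boundary (S x) d"
  shows "test_function l k \<xi> = dense_hyperbolic_space.dist_to d (slack l) (\<sigma> x) (\<lambda>i. s i x) k \<xi>"
proof -
  interpret dense_hyperbolic_space "S x" d "slack l" "\<sigma> x" "\<lambda>i. s i x"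
      by (rule uniform_locus_hyperbolic[OF x])
  have "base_point \<xi> = x" using x boundary_in_completion(1)[OF \<xi>]
      by (intro base_point_eq) (auto simp: uniform_locus_def)
  then show ?thesis
    using x unfolding test_function_def dist_to_def boundary_limit_def chain_section_dist_def by simp
qed

lemma test_function_off:
  assumes x: "x \<in> space M" "x \<notin> uniform_locus l" and \<xi>: "\<xi> \<in> gromov_boundary (S x) d"
  shows "test_function l k \<xi> = 1"
proof -
  have "\<xi> \<in> gromov_completion (S x) d" using \<xi> by (simp add: gromov_completion_def)
  then have "base_point \<xi> = x" using x by (intro base_point_eq)
  then show ?thesis using x(2) unfolding test_function_def by simp
qed

lemma test_function_continuous:
  assumes x: "x \<in> space M"
  shows "continuous_map (limit_topology R H p d \<alpha> \<sigma> x) euclideanreal (test_function l k)"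
proof (cases "x \<in> uniform_locus l")
  case True
  interpret dense_hyperbolic_space "S x" d "slack l" "\<sigma> x" "\<lambda>i. s i x"
      by (rule uniform_locus_hyperbolic[OF True])
  show ?thesis
    unfolding limit_topology_def
    by (rule continuous_map_eq[OF dist_to_continuous[OF limit_set_subset, of k]])
      (use test_function_eq[OF True] limit_set_subset[of x] in auto)
next
  case False
  show ?thesis
    unfolding limit_topology_def
    by (rule continuous_map_eq[where f = "\<lambda>_. 1"]) (use test_function_off[OF x False] limit_set_subset[of x]
        in auto)
qed

lemma test_function_bounds:
  assumes x: "x \<in> space M" and \<xi>: "\<xi> \<in> L x"
  shows "0 \<le> test_function l k \<xi>" "test_function l k \<xi> \<le> 1"
proof -
  have \<xi>b: "\<xi> \<in> gromov_boundary (S x) d" using \<xi> limit_set_subset by blast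
  have "0 \<le> test_function l k \<xi> \<and> test_function l k \<xi> \<le> 1"
  proof (cases "x \<in> uniform_locus l")
    case True
    interpret dense_hyperbolic_space "S x" d "slack l" "\<sigma> x" "\<lambda>i. s i x"
        by (rule uniform_locus_hyperbolic[OF True])
    show ?thesis unfolding test_function_eq[OF True \<xi>b] using dist_to_bounds by blast
  qed (simp add: test_function_off[OF x _ \<xi>b])
  then show "0 \<le> test_function l k \<xi>" "test_function l k \<xi> \<le> 1" by auto
qed

lemma test_function_power_limit_functions:
  "(\<lambda>\<xi>. complex_of_real (test_function l k \<xi> ^ m)) \<in> limit_functions M R H p d \<alpha> \<sigma>"
  unfolding limit_functions_def
proof (intro CollectI conjI)
  have [measurable]: "test_function l k \<in> borel_measurable BC" by (rule test_function_measurable)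
  show "(\<lambda>\<xi>. complex_of_real (test_function l k \<xi> ^ m)) \<in>
      borel_measurable (restrict_space BC (limit_bundle M R H p d \<alpha> \<sigma>))"
    by (rule measurable_restrict_space1) measurable
  show "AE x in M. continuous_map (limit_topology R H p d \<alpha> \<sigma> x) euclidean (\<lambda>\<xi>. complex_of_real (test_function
      l k \<xi> ^ m))"
  proof (rule AE_I2)
    fix x assume x: "x \<in> space M"
    have "continuous_map euclideanreal euclidean (\<lambda>r. complex_of_real (r ^ m))"
      by (auto intro!: continuous_intros)
    from continuous_map_compose[OF test_function_continuous[OF x] this]
    show "continuous_map (limit_topology R H p d \<alpha> \<sigma> x) euclidean (\<lambda>\<xi>. complex_of_real (test_function l k \<xi> ^
        m))"
      by (simp add: comp_def)
  qed
  show "\<exists>C. AE x in M. \<forall>\<xi>\<in>L x. cmod (complex_of_real (test_function l k \<xi> ^ m)) \<le> C"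
    by (intro exI[of _ 1] AE_I2 ballI) (use test_function_bounds in \<open>auto simp: norm_power power_le_one simp
        del: of_real_power\<close>)
qed

text \<open>
  The integrals are complex because the measurability of a field is stated for complex functions.
\<close>

definition field_variance :: "('a \<Rightarrow> 'b gpoint measure) \<Rightarrow> nat \<Rightarrow> nat \<Rightarrow> 'a \<Rightarrow> real" where
  "field_variance \<nu> l k x = Re (\<integral>\<xi>. complex_of_real (test_function l k \<xi> ^ 2) \<partial>\<nu> x) -
     (Re (\<integral>\<xi>. complex_of_real (test_function l k \<xi> ^ 1) \<partial>\<nu> x))\<^sup>2"

lemma field_variance_measurable:
  assumes "\<nu> \<in> boundary_measure_fields M R H p d \<alpha> \<sigma>"
  shows "field_variance \<nu> l k \<in> borel_measurable (completion M)"
proof -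
  have [measurable]: "(\<lambda>x. \<integral>\<xi>. complex_of_real (test_function l k \<xi> ^ m) \<partial>\<nu> x) \<in> borel_measurable (completion
      M)" for m
    using assms test_function_power_limit_functions unfolding boundary_measure_fields_def by blast
  show ?thesis unfolding field_variance_def by measurable
qed

text \<open>
  The set with index \<open>(l, k, m)\<close> consists of the points over \<open>uniform_locus l\<close> at which the
  variance of \<open>dist_to k\<close> exceeds \<open>inverse (Suc m)\<close>. It is Borel after correcting the variance on
  a null set.
\<close>

lemma AE_near_cover:
  assumes \<nu>: "\<nu> \<in> boundary_measure_fields M R H p d \<alpha> \<sigma>"
    and card: "AE x in M. card (supp \<nu> x) = 2"
  obtains Y :: "nat \<times> nat \<times> nat \<Rightarrow> 'a set" and D where "\<And>n. Y n \<in> sets M" "AE x in M. \<exists>n. x \<in> Y n"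
    "\<And>n. AE x in M. x \<in> Y n \<longrightarrow> (\<forall>a b. supp \<nu> x = {a, b} \<longrightarrow> ext_gromov_product d (\<sigma> x) a b \<le> ereal (D n))"
proof -
  have "\<exists>V. V \<in> borel_measurable M \<and> (AE x in M. field_variance \<nu> l k x = V x)" for l k
    using completion_ex_borel_measurable_real[OF field_variance_measurable[OF \<nu>, of l k]] by blast
  then obtain V where V[measurable]: "\<And>l k. V l k \<in> borel_measurable M"
    and V_AE: "\<And>l k. AE x in M. field_variance \<nu> l k x = V l k x" by metis
  define Y where "Y = (\<lambda>(l, k, m). {x \<in> space M. x \<in> uniform_locus l \<and> inverse (real (Suc m)) < V l k x})"
  define D where "D = (\<lambda>(l, k::nat, m). 2 * slack l + 1 + ln (2 * real (Suc m)) / dense_hyperbolic_space.\<epsilon>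
      (slack l))"
  have "Y n \<in> sets M" for n
  proof -
    obtain l k m where "n = (l, k, m)" by (cases n) auto
    then show ?thesis unfolding Y_def by simp
  qed
  moreover have good: "AE x in M. prob_space (\<nu> x)
      \<and> sets (\<nu> x) = sets (borel_of (limit_topology R H p d \<alpha> \<sigma> x)) \<and>
      (\<forall>l k. field_variance \<nu> l k x = V l k x)"
  proof -
    have "AE x in M. \<forall>l k. field_variance \<nu> l k x = V l k x" using V_AE by (simp add: AE_all_countable)
    then show ?thesis using \<nu> unfolding boundary_measure_fields_def by simp
  qed
  have var: "field_variance \<nu> l k x = dense_hyperbolic_space.variance_of d (slack l) (\<sigma> x) (\<lambda>i. s i x) (\<nu> x)
      k"
    if x: "x \<in> uniform_locus l" and pr: "prob_space (\<nu> x)"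
        and sets: "sets (\<nu> x) = sets (borel_of (limit_topology R H p d \<alpha> \<sigma> x))" for x l k
  proof -
    interpret dense_hyperbolic_space "S x" d "slack l" "\<sigma> x" "\<lambda>i. s i x"
        by (rule uniform_locus_hyperbolic[OF x])
    have "space (\<nu> x) \<subseteq> gromov_boundary (S x) d"
      using sets_eq_imp_space_eq[OF sets] limit_set_subset by (auto simp: limit_topology_def)
    then have eq: "test_function l k \<xi> = dist_to k \<xi>" if "\<xi> \<in> space (\<nu> x)" for \<xi>
      using test_function_eq[OF x] that by blast
    have pw: "(\<integral>\<xi>. complex_of_real (test_function l k \<xi> ^ m) \<partial>\<nu> x) = complex_of_real (\<integral>\<xi>. dist_to k \<xi> ^ m \<partial>\<nu>
        x)" for m
      by (subst integral_complex_of_real[symmetric]) (intro Bochner_Integration.integral_cong refl, simp add: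
          eq)
    show ?thesis
      unfolding field_variance_def variance_of_def[OF limit_set_subset[of x] pr sets[unfolded
          limit_topology_def]]
        pw Re_complex_of_real by simp
  qed
  have lt: "limit_topology R H p d \<alpha> \<sigma> x = subtopology (TG x) (L x)" for x by (simp add: limit_topology_def)
  have supp_bdry: "supp \<nu> x \<subseteq> gromov_boundary (S x) d" for x
    using limit_set_subset[of x] by (auto simp: msupport_def limit_topology_def)
  have "AE x in M. \<exists>n. x \<in> Y n"
    using good card AE_space
  proof eventually_elim
    case (elim x)
    then have pr: "prob_space (\<nu> x)" and st: "sets (\<nu> x) = sets (borel_of (limit_topology R H p d \<alpha> \<sigma> x))"
        by auto
    obtain l where l: "x \<in> uniform_locus l" using uniform_locus_cover elim by blast
    interpret dense_hyperbolic_space "S x" d "slack l" "\<sigma> x" "\<lambda>i. s i x"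
        by (rule uniform_locus_hyperbolic[OF l])
    obtain a b where "supp \<nu> x = {a, b}" "a \<noteq> b" using elim(2) by (auto simp: card_2_iff)
    then have "a \<in> supp \<nu> x" "b \<in> supp \<nu> x" "a \<noteq> b" by auto
    then obtain k where "0 < variance_of (\<nu> x) k"
      using exists_positive_variance[OF limit_set_subset pr st[unfolded lt]] unfolding lt by blast
    then have "0 < V l k x" using var[OF l pr st, of k] elim(1) by simp
    then obtain m where "inverse (real (Suc m)) < V l k x" using reals_Archimedean by blast
    then have "x \<in> Y (l, k, m)" using l elim unfolding Y_def by simp
    then show ?case ..
  qed
  moreover have "AE x in M. x \<in> Y n \<longrightarrow>
      (\<forall>a b. supp \<nu> x = {a, b} \<longrightarrow> ext_gromov_product d (\<sigma> x) a b \<le> ereal (D n))" for n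
    using good
  proof eventually_elim
    case (elim x)
    then have pr: "prob_space (\<nu> x)" and st: "sets (\<nu> x) = sets (borel_of (limit_topology R H p d \<alpha> \<sigma> x))"
        by auto
    show ?case
    proof (intro impI allI)
      fix a b assume xY: "x \<in> Y n" and ab: "supp \<nu> x = {a, b}"
      obtain l k m where n: "n = (l, k, m)" by (cases n) auto
      have l: "x \<in> uniform_locus l" and gap: "inverse (real (Suc m)) < V l k x" using xY unfolding n Y_def
          by auto
      interpret dense_hyperbolic_space "S x" d "slack l" "\<sigma> x" "\<lambda>i. s i x"
          by (rule uniform_locus_hyperbolic[OF l])
      have "V l k x = variance_of (\<nu> x) k" using var[OF l pr st, of k] elim by simp
      also have "\<dots> \<le> (dist_to k a - dist_to k b)\<^sup>2"
        by (rule variance_le_of_two_point_support[OF limit_set_subset pr st[unfolded lt] ab[unfolded lt]])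
      finally have "inverse (real (Suc m)) < (dist_to k a - dist_to k b)\<^sup>2" using gap by simp
      then show "ext_gromov_product d (\<sigma> x) a b \<le> ereal (D n)"
        using product_bound_of_dist_to_gap[of a b m k] supp_bdry[of x] ab unfolding n D_def by simp
    qed
  qed
  ultimately show thesis by (rule that)
qed

end


section \<open>The limit set is the support\<close>

locale enumerated_orbit_bundle = hyperbolic_orbit_bundle + orbit_enumeration
begin

abbreviation "translate x y \<equiv> \<alpha> x y (\<sigma> y)"

lemma translate_in: "(x, y) \<in> R \<Longrightarrow> translate x y \<in> S x"
  using action_in sectionD(2)[OF \<sigma>] R_space by blast

lemma action_translate:
  assumes "(x, y) \<in> R" "(y, z) \<in> R" shows "\<alpha> x y (translate y z) = translate x z"
  by (rule action(3)[OF assms(1,2)]) (use assms R_space sectionD(2)[OF \<sigma>] in blast)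

lemma translate_self: "x \<in> space M \<Longrightarrow> translate x x = \<sigma> x"
  using action_refl sectionD(2)[OF \<sigma>] by blast

lemma translate_distance:
  assumes "(x, y) \<in> R" "(y, z) \<in> R"
  shows "d (translate x y) (translate x z) = d (\<sigma> y) (translate y z)"
proof -
  have "y \<in> space M" using assms R_space by blast
  then show ?thesis
    using action(2)[OF assms(1) sectionD(2)[OF \<sigma>] translate_in[OF assms(2)]] action_translate[OF assms]
        by simp
qed

definition proper_at :: "'a \<Rightarrow> bool" where
  "proper_at x \<longleftrightarrow> (\<forall>c\<in>S x. \<forall>r. finite {y \<in> R `` {x}. translate x y \<in> Metric_space.mball (S x) d c r})"

lemma AE_proper: "AE x in M. proper_at x"
  using main unfolding main_assumption_def metrically_proper_def proper_at_def by blast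

lemma proper_at_finite:
  assumes x: "x \<in> space M" and "proper_at x"
  shows "finite {w. (x, w) \<in> R \<and> d (\<sigma> x) (translate x w) < r}"
proof -
  interpret Metric_space "S x" d by (rule metric_fiber[OF x])
  have "\<sigma> x \<in> S x" using sectionD(2)[OF \<sigma> x] .
  then have "finite {y \<in> R `` {x}. translate x y \<in> mball (\<sigma> x) r}"
    using assms(2) unfolding proper_at_def by blast
  moreover have "{w. (x, w) \<in> R \<and> d (\<sigma> x) (translate x w) < r} = {y \<in> R `` {x}. translate x y \<in> mball (\<sigma> x)
      r}"
    using translate_in \<open>\<sigma> x \<in> S x\<close> by auto
  ultimately show ?thesis by simp
qed

definition nearest :: "'a set \<Rightarrow> 'a \<Rightarrow> 'a \<Rightarrow> bool" where
  "nearest Y y w \<longleftrightarrow> w \<in> Y \<and> (y, w) \<in> R \<and>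
     (\<forall>v\<in>Y. (y, v) \<in> R \<longrightarrow> d (\<sigma> y) (translate y w) \<le> d (\<sigma> y) (translate y v))"

lemma exists_nearest:
  assumes y: "y \<in> space M" and "proper_at y" and v: "v \<in> Y" "(y, v) \<in> R"
  shows "\<exists>w. nearest Y y w"
proof -
  let ?e = "\<lambda>w. d (\<sigma> y) (translate y w)"
  let ?W = "{w. (y, w) \<in> R \<and> ?e w < ?e v + 1} \<inter> Y"
  have "finite ?W" using proper_at_finite[OF assms(1,2)] by blast
  moreover have vW: "v \<in> ?W" using v by simp
  then have "?W \<noteq> {}" by blast
  ultimately obtain w where w: "w \<in> ?W" "\<And>u. u \<in> ?W \<Longrightarrow> ?e w \<le> ?e u"
    using ex_is_arg_min_if_finite[of ?W ?e] unfolding is_arg_min_linorder by blast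
  have "?e w \<le> ?e u" if "u \<in> Y" "(y, u) \<in> R" for u
  proof (cases "u \<in> ?W")
    case False
    then show ?thesis using w(2)[OF vW] that by simp
  qed (rule w(2))
  then show ?thesis using w(1) unfolding nearest_def by blast
qed

text \<open>
  Among the images \<open>\<phi> m y\<close> in \<open>Y\<close> take one of least cost, and the first such index.
\<close>

lemma AE_nearest_map:
  assumes [measurable]: "Y \<in> sets M"
  obtains t where "t \<in> M \<rightarrow>\<^sub>M M" "AE y in M. (\<exists>w. nearest Y y w) \<longrightarrow> nearest Y y (t y)"
proof -
  define cost_of where "cost_of m c \<longleftrightarrow> c \<in> borel_measurable M
      \<and> (AE y in M. c y = d (\<sigma> y) (translate y (\<phi> m y)))" for m c
  have "\<exists>c. cost_of m c" for m
    using AE_cost_measurable[OF \<phi>[of m]] unfolding cost_of_def by blast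
  then obtain c where c: "\<And>m. cost_of m (c m)" by metis
  then have [measurable]: "c m \<in> borel_measurable M" for m unfolding cost_of_def by blast
  have "AE y in M. c m y = d (\<sigma> y) (translate y (\<phi> m y))" for m using c unfolding cost_of_def by blast
  then have cAE: "AE y in M. \<forall>m. c m y = d (\<sigma> y) (translate y (\<phi> m y))" by (simp add: AE_all_countable)
  \<comment> \<open>\<open>\<phi> m y\<close> is a nearest point of \<open>Y\<close>, expressed through the measurable costs\<close>
  define best where "best y m \<longleftrightarrow> \<phi> m y \<in> Y \<and> (\<forall>m'. \<phi> m' y \<in> Y \<longrightarrow> c m y \<le> c m' y)" for y m
  have [measurable]: "Measurable.pred M (\<lambda>y. best y m)" for m unfolding best_def by measurable
  define t where "t y = \<phi> (LEAST m. best y m) y" for y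
  have "t \<in> M \<rightarrow>\<^sub>M M"
    unfolding t_def by (rule measurable_compose_countable[OF \<phi>_measurable]) measurable
  moreover have "AE y in M. (\<exists>w. nearest Y y w) \<longrightarrow> nearest Y y (t y)"
    using cAE \<phi>_AE AE_space
  proof eventually_elim
    case (elim y)
    have near: "nearest Y y (\<phi> m y) \<longleftrightarrow> best y m" for m
    proof -
      have R: "(y, \<phi> m y) \<in> R" for m using full_groupD(3)[OF \<phi>] elim by blast
      show ?thesis
      proof
        assume "nearest Y y (\<phi> m y)"
        then show "best y m" using elim(1) R unfolding nearest_def best_def by simp
      next
        assume b: "best y m"
        have "d (\<sigma> y) (translate y (\<phi> m y)) \<le> d (\<sigma> y) (translate y v)" if v: "v \<in> Y" "(y, v) \<in> R" for v
        proof -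
          obtain m' where "\<phi> m' y = v" using elim(2) v by blast
          then show ?thesis using b v elim(1) unfolding best_def by metis
        qed
        then show "nearest Y y (\<phi> m y)" using b R unfolding nearest_def best_def by blast
      qed
    qed
    show ?case
    proof
      assume "\<exists>w. nearest Y y w"
      then obtain w where w: "nearest Y y w" by blast
      then obtain m where "\<phi> m y = w" using elim(2) unfolding nearest_def by blast
      then have "best y m" using near w by blast
      then have "best y (LEAST m. best y m)" by (rule LeastI)
      then show "nearest Y y (t y)" using near unfolding t_def by blast
    qed
  qed
  ultimately show thesis by (rule that)
qed

text \<open>
  The main argument. For \<open>x \<in> Y\<close> the point \<open>\<sigma> x\<close> is itself a translate indexed by \<open>Y\<close>, so it
  competes with the nearest translate of any \<open>y\<close>. The set \<open>B\<close> of the indices of translates close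
  to \<open>\<xi>\<close> is sent by \<open>t\<close> into a finite set with finite fibres, although \<open>\<xi>\<close> is a limit of
  translates.
\<close>

lemma AE_limit_set_subset_support:
  assumes \<nu>: "\<nu> \<in> fixed_fields M R H p d \<alpha> \<sigma>"
    and card: "AE x in M. card (supp \<nu> x) = 2"
    and Y: "Y \<in> sets M"
    and near: "AE x in M. x \<in> Y \<longrightarrow> (\<forall>a b. supp \<nu> x = {a, b} \<longrightarrow> ext_gromov_product d (\<sigma> x) a b \<le> ereal D)"
  shows "AE x in M. x \<in> Y \<longrightarrow> L x \<subseteq> supp \<nu> x"
proof -
  obtain t where t: "t \<in> M \<rightarrow>\<^sub>M M" "AE y in M. (\<exists>w. nearest Y y w) \<longrightarrow> nearest Y y (t y)"
    using AE_nearest_map[OF Y] by blast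
  define push where "push x y \<longleftrightarrow> distr (\<nu> x) (borel_of (limit_topology R H p d \<alpha> \<sigma> y)) (ext_isometry (\<alpha> y x))
      = \<nu> y" for x y
  define good where "good y \<longleftrightarrow> y \<in> space M \<and> card (supp \<nu> y) = 2 \<and>
      (y \<in> Y \<longrightarrow> (\<forall>a b. supp \<nu> y = {a, b} \<longrightarrow> ext_gromov_product d (\<sigma> y) a b \<le> ereal D)) \<and>
      proper_at y \<and> ((\<exists>w. nearest Y y w) \<longrightarrow> nearest Y y (t y)) \<and>
      finite {z. (y, z) \<in> R \<and> t z = y} \<and> sets (\<nu> y) = sets (borel_of (limit_topology R H p d \<alpha> \<sigma> y))" for y
  have fields: "AE x in M. sets (\<nu> x) = sets (borel_of (limit_topology R H p d \<alpha> \<sigma> x))"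
    using \<nu> unfolding fixed_fields_def boundary_measure_fields_def by (auto elim: AE_mp)
  have "AE y in M. good y"
    using card near AE_proper t(2) AE_finite_fibres[OF t(1)] fields AE_space
    by eventually_elim (simp add: good_def)
  then have goodAE: "AE x in M. \<forall>y. (x, y) \<in> R \<longrightarrow> good y" by (rule AE_class)
  have "rel_ae M R push"
    using \<nu> unfolding fixed_fields_def push_def by blast
  then have "AE x in M. \<forall>y z. (x, y) \<in> R \<longrightarrow> (x, z) \<in> R \<longrightarrow> push y z"
    by (intro AE_class2 rel_ae_imp_AE)
  then show ?thesis using goodAE AE_space
  proof eventually_elim
    case (elim x)
    have xM: "x \<in> space M" and xx: "(x, x) \<in> R" using elim(3) R_refl by auto
    have good: "good y" if "(x, y) \<in> R" for y using elim(2) that by blast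
    show ?case
    proof (intro impI subsetI, rule ccontr)
      fix \<xi> assume xY: "x \<in> Y" and \<xi>L: "\<xi> \<in> L x" and \<xi>: "\<xi> \<notin> supp \<nu> x"
      obtain \<delta> where X: "hyperbolic_space (S x) d \<delta>" using hyperbolic_fiber[OF xM] by blast
      interpret hyperbolic_space "S x" d \<delta> by (rule X)
      have q: "\<sigma> x \<in> S x" using sectionD(2)[OF \<sigma> xM] .
      have \<xi>b: "\<xi> \<in> bdry" using \<xi>L limit_set_subset by blast
      obtain a b where ab: "supp \<nu> x = {a, b}" "a \<noteq> b"
        using good[OF xx] unfolding good_def card_2_iff by blast
      have abb: "a \<in> bdry" "b \<in> bdry"
        using ab limit_set_subset[of x] by (auto simp: msupport_def limit_topology_def)
      obtain T where T: "\<And>w. w \<in> S x \<Longrightarrow> ext w a b \<le> ereal D \<Longrightarrow> ext (\<sigma> x) (Inl w) \<xi> \<le> ereal T"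
        using near_line_bounded_product[OF q \<xi>b abb, of D] \<xi> ab by blast
      have bound: "ext (\<sigma> x) (Inl (translate x w)) \<xi> \<le> ereal T" if w: "w \<in> Y" "(x, w) \<in> R" for w
      proof (rule T)
        have wM: "w \<in> space M" using R_space w by blast
        obtain \<delta>' where W: "hyperbolic_space (S w) d \<delta>'" using hyperbolic_fiber[OF wM] by blast
        interpret I: isometric_pair "S w" "S x" d \<delta>' \<delta> "\<alpha> x w" "\<alpha> w x"
          by (rule isometric_pair_action[OF w(2) W X])
        have "supp \<nu> x = ext_isometry (\<alpha> x w) ` supp \<nu> w"
          using good[OF w(2)] good[OF xx] elim(1) w(2) xx
          by (intro support_action[OF w(2)]) (auto simp: good_def push_def)
        then obtain a' b' where a': "a' \<in> supp \<nu> w" "a = ext_isometry (\<alpha> x w) a'"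
          and b': "b' \<in> supp \<nu> w" "b = ext_isometry (\<alpha> x w) b'" using ab(1) by blast
        have "supp \<nu> w = {a', b'}"
          using good[OF w(2)] a' b' ab(2) unfolding good_def card_2_iff by auto
        then have le: "ext (\<sigma> w) a' b' \<le> ereal D" using good[OF w(2)] w(1) unfolding good_def by blast
        have "a' \<in> gromov_completion (S w) d" "b' \<in> gromov_completion (S w) d"
          using a'(1) b'(1) limit_set_subset[of w] I.X.boundary_in_completion(1)
          by (auto simp: msupport_def limit_topology_def)
        then show "ext (translate x w) a b \<le> ereal D"
          using le I.ext_isometry_product[OF sectionD(2)[OF \<sigma> wM]] a'(2) b'(2) by simp
        show "translate x w \<in> S x" using translate_in[OF w(2)] .
      qed
      define B where "B = {y. (x, y) \<in> R \<and> ereal (T + \<delta> + 1) < ext (\<sigma> x) (Inl (translate x y)) \<xi>}"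
      define W where "W = {w. (x, w) \<in> R \<and> d (\<sigma> x) (translate x w) < 2 * (T + \<delta> + 1) + 1}"
      have "B \<subseteq> (\<Union>w\<in>W. {y. (w, y) \<in> R \<and> t y = w})"
      proof
        fix y assume y: "y \<in> B"
        then have xy: "(x, y) \<in> R" and far: "ereal (T + \<delta> + 1) < ext (\<sigma> x) (Inl (translate x y)) \<xi>"
          unfolding B_def by auto
        have yx: "(y, x) \<in> R" using R_sym[OF xy] .
        have "\<exists>w. nearest Y y w"
          using exists_nearest[OF _ _ xY yx] good[OF xy] unfolding good_def by blast
        then have ty: "nearest Y y (t y)" using good[OF xy] unfolding good_def by blast
        then have yt: "(y, t y) \<in> R" and tY: "t y \<in> Y" unfolding nearest_def by auto
        have xt: "(x, t y) \<in> R" using R_trans[OF xy yt] .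
        have "d (translate x y) (translate x (t y)) \<le> d (translate x y) (translate x x)"
          unfolding translate_distance[OF xy yt] translate_distance[OF xy yx]
          using ty xY yx unfolding nearest_def by blast
        then have "d (translate x y) (translate x (t y)) \<le> d (translate x y) (\<sigma> x)"
          by (simp add: translate_self[OF xM])
        then have "d (translate x (t y)) (\<sigma> x) \<le> 2 * (T + \<delta> + 1)"
          by (rule nearest_point_bound[OF q translate_in[OF xy] translate_in[OF xt] \<xi>b far bound[OF tY xt]])
        then have "t y \<in> W" unfolding W_def using xt commute[of "\<sigma> x"] by simp
        then show "y \<in> (\<Union>w\<in>W. {y. (w, y) \<in> R \<and> t y = w})" using R_sym[OF yt] by blast
      qed
      moreover have "finite W"
        unfolding W_def using good[OF xx] by (intro proper_at_finite) (auto simp: good_def)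
      moreover have "finite {y. (w, y) \<in> R \<and> t y = w}" if "w \<in> W" for w
        using good[of w] that unfolding good_def W_def by blast
      ultimately have finB: "finite B" by (meson finite_UN_I finite_subset)
      have "\<xi> \<in> gromov_topology (S x) d closure_of (Inl ` orbit R \<alpha> \<sigma> x)"
        using \<xi>L unfolding limit_set_def orbit_closure_def by blast
      \<comment> \<open>a product larger than all distances from \<open>\<sigma> x\<close> to the finitely many translates in \<open>B\<close>\<close>
      from closure_of_orbit_boundary[OF \<xi>b this q, of "max (T + \<delta> + 1) (\<Sum>y\<in>B. d (translate x y) (\<sigma> x))"]
      obtain y where xy: "(x, y) \<in> R"
        and far: "ereal (max (T + \<delta> + 1) (\<Sum>y\<in>B. d (translate x y) (\<sigma> x))) < ext (\<sigma> x) (Inl (translate x y)) \<xi>"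
        unfolding orbit_def by blast
      have "ereal (T + \<delta> + 1) < ext (\<sigma> x) (Inl (translate x y)) \<xi>"
        by (rule order.strict_trans1[OF _ far]) simp
      then have "y \<in> B" using xy unfolding B_def by blast
      then have "d (translate x y) (\<sigma> x) \<le> (\<Sum>y\<in>B. d (translate x y) (\<sigma> x))"
        using finB by (intro member_le_sum) auto
      moreover have "ereal (max (T + \<delta> + 1) (\<Sum>y\<in>B. d (translate x y) (\<sigma> x)))
          < ereal (d (translate x y) (\<sigma> x))"
        using order.strict_trans2[OF far ext_Inl_le[OF translate_in[OF xy] boundary_in_completion(1)[OF \<xi>b]
            q]] .
      ultimately show False by simp
    qed
  qed
qed

end

theorem lemma3p4:
  fixes M :: "'a measure" and R :: "('a \<times> 'a) set"
    and H :: "'b measure" and p :: "'b \<Rightarrow> 'a" and d :: "'b \<Rightarrow> 'b \<Rightarrow> real"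
    and \<alpha> :: "'a \<Rightarrow> 'a \<Rightarrow> 'b \<Rightarrow> 'b" and \<sigma> :: "'a \<Rightarrow> 'b"
    and \<nu> :: "'a \<Rightarrow> 'b gpoint measure"
  assumes "main_assumption M R H p d \<alpha> \<sigma>"
    and "loxodromic M R H p d \<alpha> \<sigma>"
    and "\<nu> \<in> fixed_fields M R H p d \<alpha> \<sigma>"
    and "AE x in M. card (msupport (limit_topology R H p d \<alpha> \<sigma> x) (\<nu> x)) = 2"
  shows "(AE x in M. limit_set R H p d \<alpha> \<sigma> x = msupport (limit_topology R H p d \<alpha> \<sigma> x) (\<nu> x)) \<and>
         (AE x in M. card (limit_set R H p d \<alpha> \<sigma> x) = 2)"
proof -
  obtain s :: "nat \<Rightarrow> 'a \<Rightarrow> 'b" where s: "\<And>i. borel_section M H p (s i)"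
    "\<And>x. x \<in> space M \<Longrightarrow> Metric_space.mtopology (fiber H p x) d closure_of (range (\<lambda>i. s i x)) = fiber H p x"
    using assms(1) unfolding main_assumption_def separable_bundle_def by blast
  interpret hyperbolic_orbit_bundle M R H p d \<alpha> \<sigma> by unfold_locales (rule assms(1))
  interpret separable_orbit_bundle M R H p d \<alpha> \<sigma> s by unfold_locales (rule s, rule s(2))
  obtain X0 and Rn :: "nat \<Rightarrow> ('a \<times> 'a) set" where X0: "X0 \<in> sets M" "emeasure M (space M - X0) = 0"
    and Rn: "\<And>n. Rn n \<in> sets (M \<Otimes>\<^sub>M M)" "\<And>n x. x \<in> X0 \<Longrightarrow> finite (Rn n `` {x})" "(\<Union>n. Rn n) = R \<inter> X0 \<times> X0"
    using assms(2) unfolding loxodromic_def hyperfinite_def by blast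
  interpret hf: hyperfinite_pmp_relation M R X0 Rn
    by unfold_locales (use X0 Rn in blast)+
  obtain \<phi> :: "nat \<Rightarrow> 'a \<Rightarrow> 'a" where \<phi>: "\<And>m. \<phi> m \<in> full_group" "AE x in M. \<forall>y. (x, y) \<in> R \<longrightarrow> (\<exists>m. \<phi> m x = y)"
  proof (rule hf.AE_cover_by_full_group, goal_cases)
    case (1 \<phi>)
    show ?case by (rule 1(1)[OF 1(2,3)])
  qed
  interpret enumerated_orbit_bundle M R H p d \<alpha> \<sigma> \<phi> by unfold_locales (rule \<phi>)+
  have \<nu>: "\<nu> \<in> boundary_measure_fields M R H p d \<alpha> \<sigma>" using assms(3) unfolding fixed_fields_def by blast
  obtain Y :: "nat \<times> nat \<times> nat \<Rightarrow> 'a set" and D where Y: "\<And>n. Y n \<in> sets M" "AE x in M. \<exists>n. x \<in> Y n"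
    "\<And>n. AE x in M. x \<in> Y n \<longrightarrow> (\<forall>a b. supp \<nu> x = {a, b} \<longrightarrow> ext_gromov_product d (\<sigma> x) a b \<le> ereal (D n))"
  proof (rule AE_near_cover[OF \<nu> assms(4)], goal_cases)
    case (1 Y D)
    show ?case by (rule 1(1)[OF 1(2-4)])
  qed
  have "AE x in M. x \<in> Y n \<longrightarrow> L x \<subseteq> supp \<nu> x" for n
    by (rule AE_limit_set_subset_support[OF assms(3,4) Y(1) Y(3)])
  then have "AE x in M. \<forall>n. x \<in> Y n \<longrightarrow> L x \<subseteq> supp \<nu> x" by (subst AE_all_countable) blast
  then have eq: "AE x in M. L x = supp \<nu> x"
    using Y(2)
  proof eventually_elim
    case (elim x)
    have "supp \<nu> x \<subseteq> L x" by (auto simp: msupport_def limit_topology_def)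
    then show ?case using elim by blast
  qed
  moreover have "AE x in M. card (L x) = 2"
    using eq assms(4) by eventually_elim simp
  ultimately show ?thesis ..
qed

end
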